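(* The assignment $\mathbf{C}\mapsto\mathcal{O}_{\mathbf{C}}$ extends to a functor $\mathcal{O}_{(-)}:\mathbf{Cat}\to\mathbf{Op}$ from the category of small categories to the category of colored operads. Explicitly, to a functor $F:\mathbf{C}\to\mathbf{D}$ it assigns the operad morphism $\mathcal{O}_F:\mathcal{O}_{\mathbf{C}}\to\mathcal{O}_{\mathbf{D}}$ whose map of colors is the action $F:\mathbf{C}_0\to\mathbf{D}_0$ of $F$ on objects and which is given on operations by $\mathcal{O}_{\mathbf{C}}\binom{t}{\underline{c}}\to\mathcal{O}_{\mathbf{D}}\binom{F(t)}{F(\underline{c})}$, $(\sigma,\underline{f})\mapsto(\sigma,F(\underline{f}))$ with $F(\underline{f})=(F(f_1),\dots,F(f_n))$. Similarly, the assignment $\overline{\mathbf{C}}\mapsto\mathcal{O}_{\overline{\mathbf{C}}}$ extends to a functor $\mathcal{O}_{(-)}:\mathbf{OrthCat}\to\mathbf{Op}$, given on an orthogonal functor $F:\overline{\mathbf{C}}\to\overline{\mathbf{D}}$ by $F$ on colors and by $[(\sigma,\underline{f})]\mapsto[(\sigma,F(\underline{f}))]$ on operations. Denoting by $\Pi:\mathbf{OrthCat}\to\mathbf{Cat}$, $(\mathbf{C},\perp)\mapsto\mathbf{C}$ the forgetful functor, the morphisms $p_{\overline{\mathbf{C}}}:\mathcal{O}_{\mathbf{C}}\to\mathcal{O}_{\overline{\mathbf{C}}}$ are the components of a natural transformation $p:\mathcal{O}_{\Pi(-)}\to\mathcal{O}_{(-)}$ between functors from $\mathbf{OrthCat}$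 to $\mathbf{Op}$.
   Context: Colored operads are symmetric and $\mathbf{Set}$-valued: a colored operad $\mathcal{O}$ has a set of colors, sets of operations $\mathcal{O}\binom{t}{\underline{c}}$ for each color $t$ and each tuple of colors $\underline{c}=(c_1,\dots,c_n)$, $n\ge 0$, maps $\mathcal{O}(\sigma):\mathcal{O}\binom{t}{\underline{c}}\to\mathcal{O}\binom{t}{\underline{c}\sigma}$ for $\sigma\in\Sigma_n$ with $\underline{c}\sigma=(c_{\sigma(1)},\dots,c_{\sigma(n)})$, compositions $\gamma$ and units, subject to the usual axioms. A morphism in $\mathbf{Op}$ consists of a map of color sets and compatible maps of operations preserving permutation actions, compositions and units. $\mathbf{Op}_{\mathfrak{C}}$ is the category of operads with color set $\mathfrak{C}$ and morphisms that are the identity on colors. Orthogonal category: a pair $\overline{\mathbf{C}}=(\mathbf{C},\perp)$ of a small category $\mathbf{C}$ and a set $\perp$ of pairs $(f_1,f_2)$ of $\mathbf{C}$-morphisms with common target (written $f_1\perp f_2$) that is symmetric and stable under post-composition ($f_1\perp f_2\Rightarrow gf_1\perp gf_2$) and pre-composition ($f_1\perp f_2\Rightarrow f_1h_1\perp f_2h_2$). An orthogonal functor $F:(\mathbf{C},\perp_{\mathbf{C}})\to(\mathbf{D},\perp_{\mathbf{D}})$ is a functor with $f_1\perp_{\mathbf{C}}f_2\Rightarrow F(f_1)\perp_{\mathbf{D}}F(f_2)$. $\mathbf{OrthCat}$ is the category of orthogonal categories and orthogonal functors. The operad $\mathcal{O}_{\mathbf{C}}$: the colors are the objects $\mathbf{C}_0$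 of $\mathbf{C}$; $\mathcal{O}_{\mathbf{C}}\binom{t}{\underline{c}}=\Sigma_n\times\prod_{i=1}^n\mathbf{C}(c_i,t)$ with elements $(\sigma,\underline{f})$; permutations act by $(\sigma,\underline{f})\mapsto(\sigma\sigma',\underline{f}\sigma')$ with $\underline{f}\sigma'=(f_{\sigma'(1)},\dots,f_{\sigma'(n)})$; composition is $\gamma\big((\sigma,\underline{f}),((\sigma_1,\underline{g}_1),\dots,(\sigma_m,\underline{g}_m))\big)=\big(\sigma(\sigma_1,\dots,\sigma_m),(f_1g_{11},\dots,f_1g_{1k_1},\dots,f_mg_{m1},\dots,f_mg_{mk_m})\big)$, where $\sigma(\sigma_1,\dots,\sigma_m)\in\Sigma_{k_1+\cdots+k_m}$ is the composition of the associative operad, i.e. the sum permutation $\sigma_1\oplus\cdots\oplus\sigma_m$ followed by the block permutation moving the $i$-th block (of length $k_i$) to the $\sigma(i)$-th block position; the units are $(e,\mathrm{id}_t)$. The operad $\mathcal{O}_{\overline{\mathbf{C}}}$, with canonical morphism $p_{\overline{\mathbf{C}}}:\mathcal{O}_{\mathbf{C}}\to\mathcal{O}_{\overline{\mathbf{C}}}$, is the coequalizer in $\mathbf{Op}_{\mathbf{C}_0}$ that universally identifies the operations $(e,(f_1,f_2))$ and $(\tau,(f_1,f_2))$ of $\mathcal{O}_{\mathbf{C}}$ for all $f_1\perp f_2$, where $e,\tau\in\Sigma_2$ are the identity and the transposition. It is a quotient $\mathcal{O}_{\mathbf{C}}/{\sim_\perp}$ of $\mathcal{O}_{\mathbf{C}}$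 (with $(\sigma,\underline f)\sim_\perp(\sigma',\underline f)$ iff the sequence $\underline f\sigma'^{-1}$ is obtained from $\underline f\sigma^{-1}$, via the permutation $\sigma\sigma'^{-1}$, by successively transposing adjacent orthogonal pairs); $[(\sigma,\underline f)]$ denotes the class of $(\sigma,\underline f)$ and $p_{\overline{\mathbf{C}}}$ is the quotient map. *)

theory Defs
  imports "HOL-Combinatorics.Permutations" "HOL-Library.FuncSet"
begin

section \<open>Categories, functors, natural transformations\<close>

record ('o, 'm) category =
  Obj :: "'o set"
  Arr :: "'m set"
  src :: "'m \<Rightarrow> 'o"
  tgt :: "'m \<Rightarrow> 'o"
  idn :: "'o \<Rightarrow> 'm"
  cmp :: "'m \<Rightarrow> 'm \<Rightarrow> 'm"

text \<open>\<open>cmp C g f\<close> is the composite \<open>g f\<close> (first \<open>f\<close>, then \<open>g\<close>).\<close>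

locale category =
  fixes C :: "('o, 'm) category"
  assumes src_Obj: "f \<in> Arr C \<Longrightarrow> src C f \<in> Obj C"
    and tgt_Obj: "f \<in> Arr C \<Longrightarrow> tgt C f \<in> Obj C"
    and idn_Arr: "c \<in> Obj C \<Longrightarrow> idn C c \<in> Arr C"
    and src_idn: "c \<in> Obj C \<Longrightarrow> src C (idn C c) = c"
    and tgt_idn: "c \<in> Obj C \<Longrightarrow> tgt C (idn C c) = c"
    and cmp_Arr: "\<lbrakk>f \<in> Arr C; g \<in> Arr C; src C g = tgt C f\<rbrakk> \<Longrightarrow> cmp C g f \<in> Arr C"
    and src_cmp: "\<lbrakk>f \<in> Arr C; g \<in> Arr C; src C g = tgt C f\<rbrakk> \<Longrightarrow> src C (cmp C g f) = src C f"
    and tgt_cmp: "\<lbrakk>f \<in> Arr C; g \<in> Arr C; src C g = tgt C f\<rbrakk> \<Longrightarrow> tgt C (cmp C g f) = tgt C g"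
    and cmp_idn_left: "f \<in> Arr C \<Longrightarrow> cmp C (idn C (tgt C f)) f = f"
    and cmp_idn_right: "f \<in> Arr C \<Longrightarrow> cmp C f (idn C (src C f)) = f"
    and cmp_assoc: "\<lbrakk>f \<in> Arr C; g \<in> Arr C; h \<in> Arr C; src C g = tgt C f; src C h = tgt C g\<rbrakk>
      \<Longrightarrow> cmp C (cmp C h g) f = cmp C h (cmp C g f)"

record ('a, 'f, 'b, 'g) functr =
  fdom :: "('a, 'f) category"
  fcod :: "('b, 'g) category"
  fobj :: "'a \<Rightarrow> 'b"
  farr :: "'f \<Rightarrow> 'g"

text \<open>The two maps are extensional (\<open>\<rightarrow>\<^sub>E\<close>), so that HOL equality of functor records
  is equality of functors; the same convention is used for operad morphisms below.\<close>

locale is_functor =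
  dom: category "fdom F" + cod: category "fcod F"
  for F :: "('a, 'f, 'b, 'g) functr" +
  assumes fobj_ext: "fobj F \<in> Obj (fdom F) \<rightarrow>\<^sub>E Obj (fcod F)"
    and farr_ext: "farr F \<in> Arr (fdom F) \<rightarrow>\<^sub>E Arr (fcod F)"
    and farr_src: "f \<in> Arr (fdom F) \<Longrightarrow> src (fcod F) (farr F f) = fobj F (src (fdom F) f)"
    and farr_tgt: "f \<in> Arr (fdom F) \<Longrightarrow> tgt (fcod F) (farr F f) = fobj F (tgt (fdom F) f)"
    and farr_idn: "c \<in> Obj (fdom F) \<Longrightarrow> farr F (idn (fdom F) c) = idn (fcod F) (fobj F c)"
    and farr_cmp: "\<lbrakk>f \<in> Arr (fdom F); g \<in> Arr (fdom F); src (fdom F) g = tgt (fdom F) f\<rbrakk>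
      \<Longrightarrow> farr F (cmp (fdom F) g f) = cmp (fcod F) (farr F g) (farr F f)"

definition functor_id :: "('a, 'f) category \<Rightarrow> ('a, 'f, 'a, 'f) functr" where
  "functor_id C = \<lparr>fdom = C, fcod = C, fobj = restrict id (Obj C), farr = restrict id (Arr C)\<rparr>"

definition functor_comp ::
  "('b, 'g, 'c, 'h) functr \<Rightarrow> ('a, 'f, 'b, 'g) functr \<Rightarrow> ('a, 'f, 'c, 'h) functr" where
  "functor_comp G F = \<lparr>fdom = fdom F, fcod = fcod G,
     fobj = compose (Obj (fdom F)) (fobj G) (fobj F),
     farr = compose (Arr (fdom F)) (farr G) (farr F)\<rparr>"

locale natural_transformation =
  source: is_functor F + target: is_functor G
  for F G :: "('a, 'f, 'b, 'g) functr" and \<eta> :: "'a \<Rightarrow> 'g" +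
  assumes same_dom: "fdom G = fdom F"
    and same_cod: "fcod G = fcod F"
    and component_Arr: "c \<in> Obj (fdom F) \<Longrightarrow> \<eta> c \<in> Arr (fcod F)"
    and component_src: "c \<in> Obj (fdom F) \<Longrightarrow> src (fcod F) (\<eta> c) = fobj F c"
    and component_tgt: "c \<in> Obj (fdom F) \<Longrightarrow> tgt (fcod F) (\<eta> c) = fobj G c"
    and natural: "f \<in> Arr (fdom F) \<Longrightarrow>
      cmp (fcod F) (\<eta> (tgt (fdom F) f)) (farr F f) = cmp (fcod F) (farr G f) (\<eta> (src (fdom F) f))"

text \<open>Small categories, with objects and arrows taken from the types \<open>'o\<close> and \<open>'m\<close>.\<close>

definition Cat :: "(('o, 'm) category, ('o, 'm, 'o, 'm) functr) category" where
  "Cat = \<lparr>Obj = {C. category C}, Arr = {F. is_functor F}, src = fdom, tgt = fcod,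
     idn = functor_id, cmp = functor_comp\<rparr>"

section \<open>Orthogonal categories\<close>

record ('o, 'm) orth_category =
  ucat :: "('o, 'm) category"
  orth :: "('m \<times> 'm) set"

locale orth_category =
  category "ucat Cb" for Cb :: "('o, 'm) orth_category" +
  assumes orth_Arr: "(f1, f2) \<in> orth Cb \<Longrightarrow> f1 \<in> Arr (ucat Cb) \<and> f2 \<in> Arr (ucat Cb)"
    and orth_tgt: "(f1, f2) \<in> orth Cb \<Longrightarrow> tgt (ucat Cb) f1 = tgt (ucat Cb) f2"
    and orth_sym: "(f1, f2) \<in> orth Cb \<Longrightarrow> (f2, f1) \<in> orth Cb"
    and orth_post: "\<lbrakk>(f1, f2) \<in> orth Cb; g \<in> Arr (ucat Cb); src (ucat Cb) g = tgt (ucat Cb) f1\<rbrakk>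
      \<Longrightarrow> (cmp (ucat Cb) g f1, cmp (ucat Cb) g f2) \<in> orth Cb"
    and orth_pre: "\<lbrakk>(f1, f2) \<in> orth Cb; h1 \<in> Arr (ucat Cb); h2 \<in> Arr (ucat Cb);
        tgt (ucat Cb) h1 = src (ucat Cb) f1; tgt (ucat Cb) h2 = src (ucat Cb) f2\<rbrakk>
      \<Longrightarrow> (cmp (ucat Cb) f1 h1, cmp (ucat Cb) f2 h2) \<in> orth Cb"

record ('o, 'm) orth_functor =
  odom :: "('o, 'm) orth_category"
  ocod :: "('o, 'm) orth_category"
  ufun :: "('o, 'm, 'o, 'm) functr"

locale is_orth_functor =
  odom: orth_category "odom F" + ocod: orth_category "ocod F" + is_functor "ufun F"
  for F :: "('o, 'm) orth_functor" +
  assumes fdom_ufun: "fdom (ufun F) = ucat (odom F)"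
    and fcod_ufun: "fcod (ufun F) = ucat (ocod F)"
    and preserves_orth: "(f1, f2) \<in> orth (odom F)
      \<Longrightarrow> (farr (ufun F) f1, farr (ufun F) f2) \<in> orth (ocod F)"

definition OrthCat :: "(('o, 'm) orth_category, ('o, 'm) orth_functor) category" where
  "OrthCat = \<lparr>Obj = {Cb. orth_category Cb}, Arr = {F. is_orth_functor F}, src = odom, tgt = ocod,
     idn = (\<lambda>Cb. \<lparr>odom = Cb, ocod = Cb, ufun = functor_id (ucat Cb)\<rparr>),
     cmp = (\<lambda>G F. \<lparr>odom = odom F, ocod = ocod G, ufun = functor_comp (ufun G) (ufun F)\<rparr>)\<rparr>"

definition Forget ::
  "(('o, 'm) orth_category, ('o, 'm) orth_functor,
    ('o, 'm) category, ('o, 'm, 'o, 'm) functr) functr" where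
  "Forget = \<lparr>fdom = OrthCat, fcod = Cat,
     fobj = restrict ucat (Obj OrthCat), farr = restrict ufun (Arr OrthCat)\<rparr>"

section \<open>Block and sum permutations\<close>

text \<open>
  Elements of \<open>\<Sigma>\<^sub>n\<close> are functions \<open>\<sigma>\<close> with \<open>\<sigma> permutes {..<n}\<close>, indices starting at \<open>0\<close>;
  the right action \<open>\<open>c\<close>\<sigma>\<close> on tuples is \<^const>\<open>permute_list\<close>.

  For a list \<open>ks\<close> of block lengths, position \<open>p < sum_list ks\<close> of the concatenated blocks
  lies in block number \<open>block_index ks p\<close>, and block \<open>i\<close> begins at position \<open>block_start ks i\<close>.
\<close>

definition block_start :: "nat list \<Rightarrow> nat \<Rightarrow> nat" where
  "block_start ks i = sum_list (take i ks)"

definition block_index :: "nat list \<Rightarrow> nat \<Rightarrow> nat" where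
  "block_index ks p = (LEAST i. p < block_start ks (Suc i))"

text \<open>The sum \<open>\<sigma>\<^sub>1 \<oplus> \<dots> \<oplus> \<sigma>\<^sub>m\<close>, where \<open>\<sigma>\<^sub>i\<close> permutes \<open>k\<^sub>i\<close> letters.\<close>

definition sum_perm :: "nat list \<Rightarrow> (nat \<Rightarrow> nat) list \<Rightarrow> nat \<Rightarrow> nat" where
  "sum_perm ks \<sigma>s p =
    (if p < sum_list ks
     then let i = block_index ks p in block_start ks i + (\<sigma>s ! i) (p - block_start ks i)
     else p)"

text \<open>The permutation that moves the \<open>i\<close>-th block (of length \<open>k\<^sub>i\<close>) to the \<open>\<sigma>(i)\<close>-th block
  position. After the move the block lengths are \<open>permute_list (inv \<sigma>) ks\<close>.\<close>

definition block_perm :: "(nat \<Rightarrow> nat) \<Rightarrow> nat list \<Rightarrow> nat \<Rightarrow> nat" where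
  "block_perm \<sigma> ks p =
    (if p < sum_list ks
     then let i = block_index ks p
          in block_start (permute_list (inv \<sigma>) ks) (\<sigma> i) + (p - block_start ks i)
     else p)"

section \<open>Colored operads\<close>

text \<open>
  \<open>ops P t cs\<close> is the set of operations with input colors \<open>cs\<close> and output color \<open>t\<close>;
  these sets need not be disjoint, so the structure maps take the colors as arguments.
  \<open>act P t cs \<sigma>\<close> maps \<open>ops P t cs\<close> to \<open>ops P t (permute_list \<sigma> cs)\<close>, and
  \<open>gamma P t as bss x ys\<close> is the composite of \<open>x \<in> ops P t as\<close>
  with \<open>ys ! i \<in> ops P (as ! i) (bss ! i)\<close>.
\<close>

record ('c, 'x) operad =
  colors :: "'c set"
  ops :: "'c \<Rightarrow> 'c list \<Rightarrow> 'x set"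
  act :: "'c \<Rightarrow> 'c list \<Rightarrow> (nat \<Rightarrow> nat) \<Rightarrow> 'x \<Rightarrow> 'x"
  gamma :: "'c \<Rightarrow> 'c list \<Rightarrow> 'c list list \<Rightarrow> 'x \<Rightarrow> 'x list \<Rightarrow> 'x"
  opunit :: "'c \<Rightarrow> 'x"

definition is_op :: "('c, 'x) operad \<Rightarrow> 'c \<Rightarrow> 'c list \<Rightarrow> 'x \<Rightarrow> bool" where
  "is_op P t cs x \<longleftrightarrow> t \<in> colors P \<and> set cs \<subseteq> colors P \<and> x \<in> ops P t cs"

definition is_ops :: "('c, 'x) operad \<Rightarrow> 'c list \<Rightarrow> 'c list list \<Rightarrow> 'x list \<Rightarrow> bool" where
  "is_ops P as bss ys \<longleftrightarrow> length bss = length as \<and> length ys = length as \<and>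
     (\<forall>i<length as. is_op P (as ! i) (bss ! i) (ys ! i))"

locale operad =
  fixes P :: "('c, 'x) operad"
  assumes act_op: "\<lbrakk>is_op P t cs x; \<sigma> permutes {..<length cs}\<rbrakk>
      \<Longrightarrow> is_op P t (permute_list \<sigma> cs) (act P t cs \<sigma> x)"
    and gamma_op: "\<lbrakk>is_op P t as x; is_ops P as bss ys\<rbrakk>
      \<Longrightarrow> is_op P t (concat bss) (gamma P t as bss x ys)"
    and opunit_op: "c \<in> colors P \<Longrightarrow> is_op P c [c] (opunit P c)"
    and act_id: "is_op P t cs x \<Longrightarrow> act P t cs id x = x"
    and act_act: "\<lbrakk>is_op P t cs x; \<sigma> permutes {..<length cs}; \<sigma>' permutes {..<length cs}\<rbrakk>
      \<Longrightarrow> act P t (permute_list \<sigma> cs) \<sigma>' (act P t cs \<sigma> x) = act P t cs (\<sigma> \<circ> \<sigma>') x"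
    and unit_left: "is_op P t cs x \<Longrightarrow> gamma P t [t] [cs] (opunit P t) [x] = x"
    and unit_right: "is_op P t cs x
      \<Longrightarrow> gamma P t cs (map (\<lambda>c. [c]) cs) x (map (opunit P) cs) = x"
    and assoc: "\<lbrakk>is_op P t as x; is_ops P as bss ys;
        length csss = length as; length zss = length as;
        \<And>i. i < length as \<Longrightarrow> is_ops P (bss ! i) (csss ! i) (zss ! i)\<rbrakk>
      \<Longrightarrow> gamma P t (concat bss) (concat csss) (gamma P t as bss x ys) (concat zss) =
          gamma P t as (map concat csss) x
            (map (\<lambda>i. gamma P (as ! i) (bss ! i) (csss ! i) (ys ! i) (zss ! i)) [0..<length as])"
    and equivariance_outer:
      "\<lbrakk>is_op P t as x; is_ops P as bss ys; \<sigma> permutes {..<length as}\<rbrakk>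
      \<Longrightarrow> gamma P t (permute_list \<sigma> as) (permute_list \<sigma> bss) (act P t as \<sigma> x) (permute_list \<sigma> ys) =
          act P t (concat bss) (block_perm \<sigma> (permute_list \<sigma> (map length bss)))
            (gamma P t as bss x ys)"
    and equivariance_inner:
      "\<lbrakk>is_op P t as x; is_ops P as bss ys; length \<tau>s = length as;
        \<And>i. i < length as \<Longrightarrow> \<tau>s ! i permutes {..<length (bss ! i)}\<rbrakk>
      \<Longrightarrow> gamma P t as (map2 permute_list \<tau>s bss) x
            (map (\<lambda>i. act P (as ! i) (bss ! i) (\<tau>s ! i) (ys ! i)) [0..<length as]) =
          act P t (concat bss) (sum_perm (map length bss) \<tau>s) (gamma P t as bss x ys)"

record ('c, 'x, 'd, 'y) operad_hom =
  hdom :: "('c, 'x) operad"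
  hcod :: "('d, 'y) operad"
  cmap :: "'c \<Rightarrow> 'd"
  omap :: "'c \<Rightarrow> 'c list \<Rightarrow> 'x \<Rightarrow> 'y"

text \<open>The compatibility conditions on a morphism; that domain and codomain are operads
  is required separately.\<close>

locale operad_hom =
  fixes \<phi> :: "('c, 'x, 'd, 'y) operad_hom"
  assumes cmap_ext: "cmap \<phi> \<in> colors (hdom \<phi>) \<rightarrow>\<^sub>E colors (hcod \<phi>)"
    and omap_op: "is_op (hdom \<phi>) t cs x
      \<Longrightarrow> is_op (hcod \<phi>) (cmap \<phi> t) (map (cmap \<phi>) cs) (omap \<phi> t cs x)"
    and omap_ext: "\<not> is_op (hdom \<phi>) t cs x \<Longrightarrow> omap \<phi> t cs x = undefined"
    and omap_act: "\<lbrakk>is_op (hdom \<phi>) t cs x; \<sigma> permutes {..<length cs}\<rbrakk>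
      \<Longrightarrow> omap \<phi> t (permute_list \<sigma> cs) (act (hdom \<phi>) t cs \<sigma> x) =
          act (hcod \<phi>) (cmap \<phi> t) (map (cmap \<phi>) cs) \<sigma> (omap \<phi> t cs x)"
    and omap_gamma: "\<lbrakk>is_op (hdom \<phi>) t as x; is_ops (hdom \<phi>) as bss ys\<rbrakk>
      \<Longrightarrow> omap \<phi> t (concat bss) (gamma (hdom \<phi>) t as bss x ys) =
          gamma (hcod \<phi>) (cmap \<phi> t) (map (cmap \<phi>) as) (map (map (cmap \<phi>)) bss) (omap \<phi> t as x)
            (map (\<lambda>i. omap \<phi> (as ! i) (bss ! i) (ys ! i)) [0..<length as])"
    and omap_opunit: "c \<in> colors (hdom \<phi>)
      \<Longrightarrow> omap \<phi> c [c] (opunit (hdom \<phi>) c) = opunit (hcod \<phi>) (cmap \<phi> c)"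

definition hom_id :: "('c, 'x) operad \<Rightarrow> ('c, 'x, 'c, 'x) operad_hom" where
  "hom_id P = \<lparr>hdom = P, hcod = P, cmap = restrict id (colors P),
     omap = (\<lambda>t cs x. if is_op P t cs x then x else undefined)\<rparr>"

definition hom_comp ::
  "('d, 'y, 'e, 'z) operad_hom \<Rightarrow> ('c, 'x, 'd, 'y) operad_hom \<Rightarrow> ('c, 'x, 'e, 'z) operad_hom" where
  "hom_comp \<psi> \<phi> = \<lparr>hdom = hdom \<phi>, hcod = hcod \<psi>,
     cmap = compose (colors (hdom \<phi>)) (cmap \<psi>) (cmap \<phi>),
     omap = (\<lambda>t cs x. if is_op (hdom \<phi>) t cs x
       then omap \<psi> (cmap \<phi> t) (map (cmap \<phi>) cs) (omap \<phi> t cs x) else undefined)\<rparr>"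

definition Opd :: "(('c, 'x) operad, ('c, 'x, 'c, 'x) operad_hom) category" where
  "Opd = \<lparr>Obj = {P. operad P}, Arr = {\<phi>. operad_hom \<phi> \<and> operad (hdom \<phi>) \<and> operad (hcod \<phi>)},
     src = hdom, tgt = hcod, idn = hom_id, cmp = hom_comp\<rparr>"

section \<open>The operad of a category\<close>

text \<open>A word \<open>(\<sigma>, fs)\<close> is a permutation together with a tuple of arrows.\<close>

type_synonym 'm word = "(nat \<Rightarrow> nat) \<times> 'm list"

text \<open>
  The operad of \<open>C\<close> has words as operations, the operad of an orthogonal category has sets of
  words. A natural transformation relates the two inside one category of operads, hence one type
  for both kinds of operations.
\<close>

datatype 'm operation = Word (the_word: "'m word") | Class (the_class: "'m word set")

definition words :: "('o, 'm) category \<Rightarrow> 'o \<Rightarrow> 'o list \<Rightarrow> 'm word set" where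
  "words C t cs = {(\<sigma>, fs). \<sigma> permutes {..<length cs} \<and> length fs = length cs \<and>
     (\<forall>i<length cs. fs ! i \<in> Arr C \<and> src C (fs ! i) = cs ! i \<and> tgt C (fs ! i) = t)}"

definition word_act :: "(nat \<Rightarrow> nat) \<Rightarrow> 'm word \<Rightarrow> 'm word" where
  "word_act \<sigma>' w = (fst w \<circ> \<sigma>', permute_list \<sigma>' (snd w))"

definition word_gamma :: "('o, 'm) category \<Rightarrow> 'm word \<Rightarrow> 'm word list \<Rightarrow> 'm word" where
  "word_gamma C w vs =
    (let ks = map (\<lambda>v. length (snd v)) vs
     in (block_perm (fst w) ks \<circ> sum_perm ks (map fst vs),
         concat (map2 (\<lambda>f v. map (cmp C f) (snd v)) (snd w) vs)))"

definition cat_operad :: "('o, 'm) category \<Rightarrow> ('o, 'm operation) operad" where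
  "cat_operad C = \<lparr>colors = Obj C,
     ops = (\<lambda>t cs. Word ` words C t cs),
     act = (\<lambda>t cs \<sigma>' x. Word (word_act \<sigma>' (the_word x))),
     gamma = (\<lambda>t as bss x ys. Word (word_gamma C (the_word x) (map the_word ys))),
     opunit = (\<lambda>t. Word (id, [idn C t]))\<rparr>"

section \<open>The operad of an orthogonal category\<close>

text \<open>\<open>transposes R gs \<rho> hs\<close>: the sequence \<open>hs = gs \<rho>\<close> is obtained from \<open>gs\<close> by successively
  transposing adjacent pairs in \<open>R\<close>, the product of these transpositions being \<open>\<rho>\<close>.\<close>

inductive transposes :: "('m \<times> 'm) set \<Rightarrow> 'm list \<Rightarrow> (nat \<Rightarrow> nat) \<Rightarrow> 'm list \<Rightarrow> bool"
  for R :: "('m \<times> 'm) set" and gs :: "'m list" where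
  refl: "transposes R gs id gs"
| step: "\<lbrakk>transposes R gs \<rho> hs; Suc i < length hs; (hs ! i, hs ! Suc i) \<in> R\<rbrakk>
    \<Longrightarrow> transposes R gs (\<rho> \<circ> transpose i (Suc i)) (permute_list (transpose i (Suc i)) hs)"

definition orth_eq :: "('o, 'm) orth_category \<Rightarrow> 'm word \<Rightarrow> 'm word \<Rightarrow> bool" where
  "orth_eq Cb v w \<longleftrightarrow> snd v = snd w \<and>
     fst v permutes {..<length (snd v)} \<and> fst w permutes {..<length (snd w)} \<and>
     transposes (orth Cb) (permute_list (inv (fst v)) (snd v))
       (fst v \<circ> inv (fst w)) (permute_list (inv (fst w)) (snd w))"

definition orth_class :: "('o, 'm) orth_category \<Rightarrow> 'm word \<Rightarrow> 'm operation" where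
  "orth_class Cb v = Class {w. orth_eq Cb v w}"

text \<open>The quotient operad: the structure maps send classes to the class of the result
  computed on representatives.\<close>

definition orth_operad :: "('o, 'm) orth_category \<Rightarrow> ('o, 'm operation) operad" where
  "orth_operad Cb = \<lparr>colors = Obj (ucat Cb),
     ops = (\<lambda>t cs. orth_class Cb ` words (ucat Cb) t cs),
     act = (\<lambda>t cs \<sigma>' x. Class {w. \<exists>v\<in>the_class x. orth_eq Cb (word_act \<sigma>' v) w}),
     gamma = (\<lambda>t as bss x ys. Class {w. \<exists>v\<in>the_class x. \<exists>vs.
       list_all2 (\<lambda>v y. v \<in> the_class y) vs ys \<and> orth_eq Cb (word_gamma (ucat Cb) v vs) w}),
     opunit = (\<lambda>t. orth_class Cb (id, [idn (ucat Cb) t]))\<rparr>"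

definition orth_proj ::
  "('o, 'm) orth_category \<Rightarrow> ('o, 'm operation, 'o, 'm operation) operad_hom" where
  "orth_proj Cb = \<lparr>hdom = cat_operad (ucat Cb), hcod = orth_operad Cb,
     cmap = restrict id (Obj (ucat Cb)),
     omap = (\<lambda>t cs x. if is_op (cat_operad (ucat Cb)) t cs x
       then orth_class Cb (the_word x) else undefined)\<rparr>"

subsection \<open>Comparison with the coequalizer\<close>

text \<open>
  The quotient is the coequalizer, among operads on the same colors, that identifies
  \<open>(id, [f1, f2])\<close> with \<open>(transpose 0 1, [f1, f2])\<close> for orthogonal \<open>f1\<close>, \<open>f2\<close>.
  The lemma \<open>orth_class_generator\<close> says that the projection identifies these operations, and
  \<open>hom_orth_eq\<close> says that every morphism out of \<open>cat_operad (ucat Cb)\<close> that identifies them is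
  constant on the classes of \<^const>\<open>orth_eq\<close>, so that it factors through the
  (on operations surjective) projection.
\<close>

lemma transposes_permute:
  assumes "transposes R gs \<rho> hs"
  shows "\<rho> permutes {..<length gs}" "hs = permute_list \<rho> gs"
proof -
  have "\<rho> permutes {..<length gs} \<and> hs = permute_list \<rho> gs"
    using assms
  proof induction
    case refl
    show "id permutes {..<length gs} \<and> gs = permute_list id gs" by simp
  next
    case (step \<rho> hs i)
    have IH: "\<rho> permutes {..<length gs}" "hs = permute_list \<rho> gs"
      using step.IH by simp_all
    have t: "transpose i (Suc i) permutes {..<length gs}"
      using step by (intro permutes_swap_id) auto
    show "\<rho> \<circ> transpose i (Suc i) permutes {..<length gs} \<and>
        permute_list (transpose i (Suc i)) hs = permute_list (\<rho> \<circ> transpose i (Suc i)) gs"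
      using IH t permutes_compose[OF t IH(1)] by (simp add: permute_list_compose)
  qed
  then show "\<rho> permutes {..<length gs}" "hs = permute_list \<rho> gs" by auto
qed

lemma transposes_trans:
  assumes "transposes R gs \<rho> hs" "transposes R hs \<rho>' ks"
  shows "transposes R gs (\<rho> \<circ> \<rho>') ks"
  using assms(2)
proof induction
  case refl
  show "transposes R gs (\<rho> \<circ> id) hs" using assms(1) by (simp only: comp_id)
next
  case (step \<rho>' ks i)
  have "transposes R gs ((\<rho> \<circ> \<rho>') \<circ> transpose i (Suc i)) (permute_list (transpose i (Suc i)) ks)"
    by (rule transposes.step[OF step.IH step.hyps(2,3)])
  then show "transposes R gs (\<rho> \<circ> (\<rho>' \<circ> transpose i (Suc i))) (permute_list (transpose i (Suc i)) ks)"
    by (simp only: comp_assoc)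
qed

lemma transposes_sym:
  assumes "transposes R gs \<rho> hs" and sym: "\<And>f g. (f, g) \<in> R \<Longrightarrow> (g, f) \<in> R"
  shows "transposes R hs (inv \<rho>) gs"
  using assms(1)
proof induction
  case refl
  show "transposes R gs (inv id) gs" unfolding inv_id by (rule transposes.refl)
next
  case (step \<rho> hs i)
  let ?s = "transpose i (Suc i)"
  let ?hs = "permute_list ?s hs"
  have s: "?s permutes {..<length hs}"
    using step by (intro permutes_swap_id) auto
  have bij: "bij \<rho>" "bij ?s"
    using transposes_permute(1)[OF step.hyps(1)] s by (auto simp: permutes_bij)
  have "(?hs ! i, ?hs ! Suc i) \<in> R"
    using step.hyps sym by (simp add: permute_list_def)
  then have "transposes R ?hs (id \<circ> ?s) (permute_list ?s ?hs)"
    using step.hyps by (intro transposes.step transposes.refl) auto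
  moreover have "permute_list ?s ?hs = hs"
    using permute_list_compose[OF s, of ?s] by simp
  ultimately have "transposes R ?hs (?s \<circ> inv \<rho>) gs"
    using transposes_trans[OF _ step.IH] by simp
  moreover have "inv (\<rho> \<circ> ?s) = ?s \<circ> inv \<rho>"
    using bij by (simp add: o_inv_distrib)
  ultimately show "transposes R ?hs (inv (\<rho> \<circ> ?s)) gs" by (simp only:)
qed

lemma orth_eq_refl: "fst v permutes {..<length (snd v)} \<Longrightarrow> orth_eq Cb v v"
  unfolding orth_eq_def using transposes.refl by (simp add: permutes_inv_o)

lemma orth_eq_sym:
  assumes "orth_category Cb" "orth_eq Cb v w"
  shows "orth_eq Cb w v"
proof -
  have "bij (fst v)" "bij (fst w)"
    using assms(2) unfolding orth_eq_def by (auto dest: permutes_bij)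
  then have inv: "inv (fst v \<circ> inv (fst w)) = fst w \<circ> inv (fst v)"
    by (simp add: o_inv_distrib bij_imp_bij_inv inv_inv_eq)
  have "transposes (orth Cb) (permute_list (inv (fst w)) (snd w)) (inv (fst v \<circ> inv (fst w)))
      (permute_list (inv (fst v)) (snd v))"
    using assms(2) orth_category.orth_sym[OF assms(1)]
    unfolding orth_eq_def by (intro transposes_sym) auto
  then show ?thesis
    using assms(2) unfolding inv orth_eq_def by auto
qed

lemma orth_eq_trans:
  assumes "orth_eq Cb u v" "orth_eq Cb v w"
  shows "orth_eq Cb u w"
proof -
  have "fst v permutes {..<length (snd v)}"
    using assms unfolding orth_eq_def by auto
  then have "inv (fst v) \<circ> fst v = id" by (rule permutes_inv_o(2))
  then have comp: "(fst u \<circ> inv (fst v)) \<circ> (fst v \<circ> inv (fst w)) = fst u \<circ> inv (fst w)"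
    by (metis comp_assoc comp_id)
  have "transposes (orth Cb) (permute_list (inv (fst u)) (snd u))
      ((fst u \<circ> inv (fst v)) \<circ> (fst v \<circ> inv (fst w))) (permute_list (inv (fst w)) (snd w))"
    using assms unfolding orth_eq_def
    by (intro transposes_trans[where hs = "permute_list (inv (fst v)) (snd v)"
          and \<rho> = "fst u \<circ> inv (fst v)" and \<rho>' = "fst v \<circ> inv (fst w)"]) auto
  then show ?thesis
    using assms unfolding comp orth_eq_def by auto
qed

lemma orth_class_eqI:
  assumes "orth_category Cb" "orth_eq Cb v w"
  shows "orth_class Cb v = orth_class Cb w"
proof -
  have "orth_eq Cb v u \<longleftrightarrow> orth_eq Cb w u" for u
    using assms(2) orth_eq_sym[OF assms] orth_eq_trans[of Cb v w u] orth_eq_trans[of Cb w v u] by auto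
  then show ?thesis by (simp add: orth_class_def)
qed

lemma orth_class_generator:
  assumes "orth_category Cb" "(f1, f2) \<in> orth Cb"
  shows "orth_class Cb (id, [f1, f2]) = orth_class Cb (transpose 0 1, [f1, f2])"
proof (rule orth_class_eqI[OF assms(1)])
  let ?s = "transpose 0 (Suc 0) :: nat \<Rightarrow> nat"
  have s: "?s permutes {..<2}" by (intro permutes_swap_id) auto
  have "transposes (orth Cb) [f1, f2] (id \<circ> ?s) (permute_list ?s [f1, f2])"
    using assms(2) by (intro transposes.step transposes.refl) auto
  then show "orth_eq Cb (id, [f1, f2]) (transpose 0 1, [f1, f2])"
    using s unfolding orth_eq_def by (simp add: numeral_2_eq_2 permutes_id)
qed

lemma block_index_bounds:
  assumes "p < sum_list ks"
  shows "block_start ks (block_index ks p) \<le> p" "p < block_start ks (Suc (block_index ks p))"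
proof -
  have "p < block_start ks (Suc (length ks))"
    using assms by (simp add: block_start_def)
  then show "p < block_start ks (Suc (block_index ks p))"
    unfolding block_index_def by (rule LeastI)
  show "block_start ks (block_index ks p) \<le> p"
  proof (cases "block_index ks p")
    case 0
    then show ?thesis by (simp add: block_start_def)
  next
    case (Suc j)
    then have "\<not> p < block_start ks (Suc j)"
      unfolding block_index_def using not_less_Least by (metis lessI)
    then show ?thesis using Suc by simp
  qed
qed

lemma block_perm_id: "block_perm id ks = id"
  using block_index_bounds(1)[of _ ks] by (auto simp: block_perm_def Let_def fun_eq_iff)

lemma sum_perm_three:
  assumes "\<sigma> permutes {..<m}"
  shows "sum_perm [k, m, l] [id, \<sigma>, id] = (\<lambda>p. if k \<le> p \<and> p < k + m then k + \<sigma> (p - k) else p)"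
proof
  fix p
  consider "p < k" | "k \<le> p" "p < k + m" | "k + m \<le> p" "p < k + m + l" | "k + m + l \<le> p"
    by linarith
  then show "sum_perm [k, m, l] [id, \<sigma>, id] p = (if k \<le> p \<and> p < k + m then k + \<sigma> (p - k) else p)"
  proof cases
    case 1
    then have "block_index [k, m, l] p = 0"
      unfolding block_index_def by (intro Least_equality) (auto simp: block_start_def)
    with 1 show ?thesis by (simp add: sum_perm_def block_start_def)
  next
    case 2
    have "block_index [k, m, l] p = Suc 0"
      unfolding block_index_def
    proof (rule Least_equality)
      fix i assume "p < block_start [k, m, l] (Suc i)"
      with 2 show "Suc 0 \<le> i" by (cases i) (auto simp: block_start_def)
    qed (use 2 in \<open>auto simp: block_start_def\<close>)
    with 2 show ?thesis by (simp add: sum_perm_def block_start_def)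
  next
    case 3
    have "block_index [k, m, l] p = Suc (Suc 0)"
      unfolding block_index_def
    proof (rule Least_equality)
      fix i assume *: "p < block_start [k, m, l] (Suc i)"
      show "Suc (Suc 0) \<le> i"
      proof (rule ccontr)
        assume "\<not> ?thesis"
        then have "i = 0 \<or> i = Suc 0" by linarith
        with 3 * show False by (auto simp: block_start_def)
      qed
    qed (use 3 in \<open>auto simp: block_start_def\<close>)
    with 3 show ?thesis by (simp add: sum_perm_def block_start_def)
  next
    case 4
    then show ?thesis by (simp add: sum_perm_def)
  qed
qed

lemma words_arrow:
  assumes "(\<sigma>, fs) \<in> words C t cs" "i < length cs"
  shows "fs ! i \<in> Arr C" "src C (fs ! i) = cs ! i" "tgt C (fs ! i) = t"
  using assms by (auto simp: words_def)

lemma word_permute: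
  assumes "(\<sigma>, fs) \<in> words C t cs" "\<tau> permutes {..<length cs}" "\<rho> permutes {..<length cs}"
  shows "(\<tau>, permute_list \<rho> fs) \<in> words C t (permute_list \<rho> cs)"
  using assms permutes_in_image[OF assms(3)] by (auto simp: words_def permute_list_nth)

lemma hom_adjacent:
  fixes \<phi> :: "('o, 'm operation, 'o, 'x) operad_hom"
  assumes orth: "orth_category Cb"
    and hom: "operad_hom \<phi>" "hdom \<phi> = cat_operad (ucat Cb)"
    and gen: "\<And>f1 f2. (f1, f2) \<in> orth Cb \<Longrightarrow>
      omap \<phi> (tgt (ucat Cb) f1) [src (ucat Cb) f1, src (ucat Cb) f2] (Word (id, [f1, f2])) =
      omap \<phi> (tgt (ucat Cb) f1) [src (ucat Cb) f1, src (ucat Cb) f2] (Word (transpose 0 1, [f1, f2]))"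
    and t: "t \<in> Obj (ucat Cb)" and cs: "set cs \<subseteq> Obj (ucat Cb)"
    and w: "(id, hs) \<in> words (ucat Cb) t cs"
    and i: "Suc i < length hs" "(hs ! i, hs ! Suc i) \<in> orth Cb"
  shows "omap \<phi> t cs (Word (id, hs)) = omap \<phi> t cs (Word (transpose i (Suc i), hs))"
proof -
  interpret orth_category Cb by (rule orth)
  interpret operad_hom \<phi> by (rule hom(1))
  define C where "C = ucat Cb"
  define n where "n = length cs"
  have len: "length hs = n" using w by (simp add: words_def n_def)
  define as where "as = [t, t, t]"
  define bss where "bss = [take i cs, [cs ! i, cs ! Suc i], drop (i + 2) cs]"
  define x where "x = Word (id :: nat \<Rightarrow> nat, [idn C t, idn C t, idn C t])"
  define ys where "ys \<sigma> = [Word (id, take i hs), Word (\<sigma>, [hs ! i, hs ! Suc i]),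
    Word (id, drop (i + 2) hs)]" for \<sigma> :: "nat \<Rightarrow> nat"
  have split: "zs = take i zs @ [zs ! i, zs ! Suc i] @ drop (i + 2) zs"
    if "length zs = n" for zs :: "'z list"
    using that i len id_take_nth_drop[of i zs] Cons_nth_drop_Suc[of "Suc i" zs] by simp
  have x: "is_op (cat_operad C) t as x"
    using t idn_Arr src_idn tgt_idn
    by (auto simp: is_op_def cat_operad_def words_def x_def as_def C_def nth_Cons' permutes_id)
  have arr: "hs ! j \<in> Arr C" "src C (hs ! j) = cs ! j" "tgt C (hs ! j) = t" if "j < n" for j
    using words_arrow[OF w, of j] that by (auto simp: C_def n_def)
  have ys: "is_ops (cat_operad C) as bss (ys \<sigma>)" if "\<sigma> permutes {..<2}" for \<sigma>
  proof -
    have "is_op (cat_operad C) t (take i cs) (Word (id, take i hs))"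
      using t cs arr len i by (auto simp: is_op_def cat_operad_def words_def C_def n_def permutes_id
          dest: in_set_takeD)
    moreover have "is_op (cat_operad C) t [cs ! i, cs ! Suc i] (Word (\<sigma>, [hs ! i, hs ! Suc i]))"
    proof -
      have "cs ! i \<in> set cs" "cs ! Suc i \<in> set cs" using i len by (auto simp: n_def)
      then show ?thesis using t cs arr[of i] arr[of "Suc i"] len i that
        by (auto simp: is_op_def cat_operad_def words_def C_def n_def less_Suc_eq numeral_2_eq_2)
    qed
    moreover have "is_op (cat_operad C) t (drop (i + 2) cs) (Word (id, drop (i + 2) hs))"
      using t cs arr len i by (auto simp: is_op_def cat_operad_def words_def C_def n_def permutes_id
          dest: in_set_dropD)
    ultimately show ?thesis
      by (auto simp: is_ops_def as_def bss_def ys_def nth_Cons' less_Suc_eq)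
  qed
  have cc: "concat bss = cs" using split[of cs] by (simp add: bss_def n_def)
  have mapid: "map (cmp C (idn C t)) zs = zs" if "set zs \<subseteq> set hs" for zs
  proof (rule map_idI)
    fix f assume "f \<in> set zs"
    then have "f \<in> set hs" using that by blast
    then obtain j where "j < n" "f = hs ! j" using len by (metis in_set_conv_nth)
    then show "cmp C (idn C t) f = f"
      using arr[of j] cmp_idn_left[of f] by (auto simp: C_def)
  qed
  have gam: "gamma (cat_operad C) t as bss x (ys \<sigma>) =
    Word (\<lambda>p. if i \<le> p \<and> p < i + 2 then i + \<sigma> (p - i) else p, hs)" if "\<sigma> permutes {..<2}" for \<sigma>
  proof -
    have ks: "map (\<lambda>v. length (snd v)) (map the_word (ys \<sigma>)) = [i, 2, n - (i + 2)]"
      using len i by (simp add: ys_def)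
    have "map fst (map the_word (ys \<sigma>)) = [id, \<sigma>, id]" by (simp add: ys_def)
    moreover have "concat (map2 (\<lambda>f v. map (cmp C f) (snd v)) [idn C t, idn C t, idn C t]
      (map the_word (ys \<sigma>))) = hs"
    proof -
      have "map (cmp C (idn C t)) (take i hs) = take i hs"
        by (rule mapid) (rule set_take_subset)
      moreover have "map (cmp C (idn C t)) (drop (i + 2) hs) = drop (i + 2) hs"
        by (rule mapid) (rule set_drop_subset)
      moreover have "map (cmp C (idn C t)) [hs ! i, hs ! Suc i] = [hs ! i, hs ! Suc i]"
        by (rule mapid) (use i in auto)
      ultimately show ?thesis using split[OF len] by (simp add: ys_def)
    qed
    ultimately show ?thesis
      using sum_perm_three[OF that] ks
      by (simp add: cat_operad_def word_gamma_def x_def block_perm_id)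
  qed
  have eq: "omap \<phi> t cs (gamma (cat_operad C) t as bss x (ys \<sigma>)) =
    gamma (hcod \<phi>) (cmap \<phi> t) (map (cmap \<phi>) as) (map (map (cmap \<phi>)) bss) (omap \<phi> t as x)
      [omap \<phi> t (take i cs) (Word (id, take i hs)),
       omap \<phi> t [cs ! i, cs ! Suc i] (Word (\<sigma>, [hs ! i, hs ! Suc i])),
       omap \<phi> t (drop (i + 2) cs) (Word (id, drop (i + 2) hs))]" if "\<sigma> permutes {..<2}" for \<sigma>
  proof -
    have "map (\<lambda>j. omap \<phi> (as ! j) (bss ! j) (ys \<sigma> ! j)) [0..<length as] =
      [omap \<phi> t (take i cs) (Word (id, take i hs)),
       omap \<phi> t [cs ! i, cs ! Suc i] (Word (\<sigma>, [hs ! i, hs ! Suc i])),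
       omap \<phi> t (drop (i + 2) cs) (Word (id, drop (i + 2) hs))]"
      by (simp add: as_def bss_def ys_def upt_rec)
    then show ?thesis
      using omap_gamma[of t as x bss "ys \<sigma>"] x ys[OF that] hom(2) cc by (simp add: C_def)
  qed
  have s: "transpose 0 1 permutes {..<2::nat}" by (intro permutes_swap_id) auto
  have e: "id permutes {..<2::nat}" by (rule permutes_id)
  have "omap \<phi> t [cs ! i, cs ! Suc i] (Word (id, [hs ! i, hs ! Suc i])) =
      omap \<phi> t [cs ! i, cs ! Suc i] (Word (transpose 0 1, [hs ! i, hs ! Suc i]))"
    using gen[OF i(2)] arr[of i] arr[of "Suc i"] i len by (simp add: C_def)
  then have "omap \<phi> t cs (gamma (cat_operad C) t as bss x (ys id)) =
      omap \<phi> t cs (gamma (cat_operad C) t as bss x (ys (transpose 0 1)))"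
    using eq[OF e] eq[OF s] by simp
  moreover have "(\<lambda>p. if i \<le> p \<and> p < i + 2 then i + id (p - i) else p) = id"
    by auto
  moreover have "(\<lambda>p. if i \<le> p \<and> p < i + 2 then i + transpose 0 1 (p - i) else p) =
      transpose i (Suc i)"
    by (auto simp: fun_eq_iff transpose_def)
  ultimately show ?thesis using gam[OF e] gam[OF s] by simp
qed

lemma hom_orth_eq:
  fixes \<phi> :: "('o, 'm operation, 'o, 'x) operad_hom"
  assumes orth: "orth_category Cb"
    and hom: "operad_hom \<phi>" "hdom \<phi> = cat_operad (ucat Cb)"
    and gen: "\<And>f1 f2. (f1, f2) \<in> orth Cb \<Longrightarrow>
      omap \<phi> (tgt (ucat Cb) f1) [src (ucat Cb) f1, src (ucat Cb) f2] (Word (id, [f1, f2])) =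
      omap \<phi> (tgt (ucat Cb) f1) [src (ucat Cb) f1, src (ucat Cb) f2] (Word (transpose 0 1, [f1, f2]))"
    and t: "t \<in> Obj (ucat Cb)" and cs: "set cs \<subseteq> Obj (ucat Cb)"
    and v: "v \<in> words (ucat Cb) t cs" and eq: "orth_eq Cb v w"
  shows "omap \<phi> t cs (Word v) = omap \<phi> t cs (Word w)"
proof -
  interpret operad_hom \<phi> by (rule hom(1))
  obtain \<sigma> fs where v': "v = (\<sigma>, fs)" by force
  obtain \<sigma>' where w': "w = (\<sigma>', fs)" using eq v' by (cases w) (auto simp: orth_eq_def)
  define n where "n = length cs"
  define C where "C = ucat Cb"
  have act: "omap \<phi> u (permute_list \<tau> ds) (Word (\<pi> \<circ> \<tau>, permute_list \<tau> gs)) =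
      act (hcod \<phi>) (cmap \<phi> u) (map (cmap \<phi>) ds) \<tau> (omap \<phi> u ds (Word (\<pi>, gs)))"
    if "(\<pi>, gs) \<in> words C u ds" "u \<in> Obj C" "set ds \<subseteq> Obj C" "\<tau> permutes {..<length ds}"
    for u ds \<pi> gs \<tau>
    using omap_act[of u ds "Word (\<pi>, gs)" \<tau>] that hom(2)
    by (simp add: is_op_def cat_operad_def word_act_def C_def)
  have len: "length fs = n" and \<sigma>: "\<sigma> permutes {..<n}" and \<sigma>': "\<sigma>' permutes {..<n}"
    using v eq v' w' by (auto simp: words_def orth_eq_def n_def)
  define gs where "gs = permute_list (inv \<sigma>) fs"
  define ds where "ds = permute_list (inv \<sigma>) cs"
  have i\<sigma>: "inv \<sigma> permutes {..<n}" using \<sigma> by (rule permutes_inv)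
  have wgs: "(id, gs) \<in> words C t ds"
    using word_permute[of \<sigma> fs C t cs id "inv \<sigma>"] v v' i\<sigma>
    by (simp add: gs_def ds_def C_def n_def permutes_id)
  have dsO: "set ds \<subseteq> Obj C" using cs i\<sigma> by (simp add: ds_def n_def C_def)
  have lds: "length ds = n" "length gs = n" by (simp_all add: ds_def gs_def n_def len[unfolded n_def])
  have bk: "permute_list \<sigma> ds = cs" "permute_list \<sigma> gs = fs"
    using permute_list_compose[of \<sigma> cs "inv \<sigma>"] permute_list_compose[of \<sigma> fs "inv \<sigma>"] \<sigma> len
    by (simp_all add: ds_def gs_def n_def permutes_inv_o)
  have "transposes (orth Cb) gs (\<sigma> \<circ> inv \<sigma>') (permute_list (inv \<sigma>') fs)"
    using eq v' w' by (simp add: orth_eq_def gs_def)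
  moreover have "omap \<phi> t ds (Word (id, gs)) = omap \<phi> t ds (Word (inv \<rho>, gs))"
    if "transposes (orth Cb) gs \<rho> hs" for \<rho> hs
    using that
  proof induction
    case refl
    show "omap \<phi> t ds (Word (id, gs)) = omap \<phi> t ds (Word (inv id, gs))" by simp
  next
    case (step \<rho> hs i)
    have IH: "omap \<phi> t ds (Word (id, gs)) = omap \<phi> t ds (Word (inv \<rho>, gs))" by (rule step.IH)
    let ?s = "transpose i (Suc i)"
    have \<rho>: "\<rho> permutes {..<n}" and hs: "hs = permute_list \<rho> gs"
      using transposes_permute[OF step.hyps(1)] lds by simp_all
    have i\<rho>: "inv \<rho> permutes {..<n}" using \<rho> by (rule permutes_inv)
    have s: "?s permutes {..<n}"
      using step.hyps hs lds by (intro permutes_swap_id) auto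
    define es where "es = permute_list \<rho> ds"
    have es: "set es \<subseteq> Obj C" "length es = n" using dsO \<rho> lds by (simp_all add: es_def)
    have whs: "(\<pi>, hs) \<in> words C t es" if "\<pi> permutes {..<n}" for \<pi>
      using word_permute[OF wgs, of \<pi> \<rho>] \<rho> that lds by (simp add: hs es_def)
    have b: "permute_list (inv \<rho>) es = ds" "permute_list (inv \<rho>) hs = gs"
      using permute_list_compose[of "inv \<rho>" ds \<rho>] permute_list_compose[of "inv \<rho>" gs \<rho>] i\<rho> \<rho> lds
      by (simp_all add: es_def hs permutes_inv_o)
    have "omap \<phi> t es (Word (id, hs)) = omap \<phi> t es (Word (?s, hs))"
      using hom_adjacent[OF orth hom gen, of t es hs i] t es whs[OF permutes_id] step.hyps
      by (simp add: C_def)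
    then have "omap \<phi> t ds (Word (inv \<rho>, gs)) = omap \<phi> t ds (Word (?s \<circ> inv \<rho>, gs))"
      using act[OF whs[OF permutes_id], of "inv \<rho>"] act[OF whs[OF s], of "inv \<rho>"] t es i\<rho> b
      by (simp add: C_def)
    moreover have "inv (\<rho> \<circ> ?s) = ?s \<circ> inv \<rho>"
      using \<rho> s by (simp add: o_inv_distrib permutes_bij)
    ultimately show "omap \<phi> t ds (Word (id, gs)) = omap \<phi> t ds (Word (inv (\<rho> \<circ> ?s), gs))"
      using IH by (simp only:)
  qed
  ultimately have "omap \<phi> t ds (Word (id, gs)) = omap \<phi> t ds (Word (inv (\<sigma> \<circ> inv \<sigma>'), gs))"
    by blast
  also have "inv (\<sigma> \<circ> inv \<sigma>') = \<sigma>' \<circ> inv \<sigma>"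
    using \<sigma> \<sigma>' by (metis bij_imp_bij_inv inv_inv_eq o_inv_distrib permutes_bij)
  finally have *: "omap \<phi> t ds (Word (id, gs)) = omap \<phi> t ds (Word (\<sigma>' \<circ> inv \<sigma>, gs))" .
  have w2: "(\<sigma>' \<circ> inv \<sigma>, gs) \<in> words C t ds"
    using wgs permutes_compose[OF i\<sigma> \<sigma>'] lds by (simp add: words_def)
  have "\<sigma>' \<circ> inv \<sigma> \<circ> \<sigma> = \<sigma>'"
    using \<sigma> by (simp add: comp_assoc permutes_inv_o)
  then show ?thesis
    using act[OF wgs, of \<sigma>] act[OF w2, of \<sigma>] * t dsO \<sigma> lds bk v' w' by (simp add: C_def)
qed

end

theory Submission
  imports Defs
begin

text \<open>
  A permutation of an initial segment of \<open>nat\<close> is determined by the order it induces on positions.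
  The permutation of a composite word orders the positions of the concatenated blocks
  lexicographically, first by the outer and then by the inner permutations; this makes the operad
  axioms for \<open>\<O>\<^sub>C\<close> statements about lexicographic orders. By bubble sort, \<open>(\<sigma>, f)\<close> and \<open>(\<sigma>', f)\<close> are
  equivalent iff \<open>f a \<perp> f b\<close> for every pair of positions \<open>a, b\<close> that \<open>\<sigma>\<close> and \<open>\<sigma>'\<close> order differently.
  In this form the relation is visibly compatible with permutations, compositions (pairs in
  different blocks by stability under pre-composition, pairs in the same block by
  stability under post-composition) and orthogonal functors. So the operad of an orthogonal
  category inherits its axioms from \<open>\<O>\<^sub>C\<close> along the surjective projection, and the morphism
  induced by an orthogonal functor is obtained by descent from \<open>p \<circ> \<O>\<^sub>F\<close>.
\<close>

section \<open>Positions in concatenated blocks\<close>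

text \<open>\<open>block_perm\<close> and \<open>sum_perm\<close> act on flat positions, and the
  starting points of the blocks change with every block move. Evaluated directly, an operad axiom
  becomes an equation between nested offsets containing inverse permutations. Coordinates (i, r),
  place r of block i, remove the offsets: \<open>block_pos\<close> carries their lexicographic order
  to the order of positions, so composite permutations need only be compared on two positions at a
  time. One implication between comparisons gives an equality, because distinct positions are always
  comparable.

  A second obstacle is the form of \<open>orth_eq\<close>, which speaks of two sequences rearranged
  by different inverse permutations and of a chain of swaps between them. The order description
  returns to the original positions, where equivalent words carry the same arrows; no chain of swaps
  has to be pushed through a composition.

  Finally, the structure maps of the quotient collect results over all representatives.
  Compatibility of the relation with the operation in question reduces each of them to its value on
  one representative.\<close>

definition block_pos :: "nat list \<Rightarrow> nat \<Rightarrow> nat \<Rightarrow> nat" where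
  "block_pos ks i r = block_start ks i + r"

lemma block_start_Suc: "i < length ks \<Longrightarrow> block_start ks (Suc i) = block_start ks i + ks ! i"
  by (simp add: block_start_def take_Suc_conv_app_nth)

lemma block_start_Cons: "block_start (k # ks) (Suc i) = k + block_start ks i"
  by (simp add: block_start_def)

lemma block_start_mono: "i \<le> j \<Longrightarrow> block_start ks i \<le> block_start ks j"
proof (induction ks arbitrary: i j)
  case (Cons k ks)
  then show ?case
    by (cases i; cases j) (auto simp: block_start_Cons, auto simp: block_start_def)
qed (simp add: block_start_def)

lemma block_start_le: "block_start ks i \<le> sum_list ks"
  using block_start_mono[of i "max i (length ks)" ks] by (simp add: block_start_def)

lemma block_pos_less:
  assumes "i < length ks" "r < ks ! i"
  shows "block_pos ks i r < sum_list ks"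
  using assms block_start_le[of ks "Suc i"] by (simp add: block_start_Suc block_pos_def)

lemma block_index_pos:
  assumes "i < length ks" "r < ks ! i"
  shows "block_index ks (block_pos ks i r) = i"
  unfolding block_index_def
proof (rule Least_equality)
  show "block_pos ks i r < block_start ks (Suc i)"
    using assms by (simp add: block_pos_def block_start_Suc)
next
  fix j assume *: "block_pos ks i r < block_start ks (Suc j)"
  show "i \<le> j"
  proof (rule ccontr)
    assume "\<not> i \<le> j"
    then show False using * block_start_mono[of "Suc j" i ks] by (simp add: block_pos_def)
  qed
qed

lemma block_pos_eq_iff:
  assumes "i < length ks" "r < ks ! i" "j < length ks" "s < ks ! j"
  shows "block_pos ks i r = block_pos ks j s \<longleftrightarrow> i = j \<and> r = s"
  using block_index_pos[OF assms(1,2)] block_index_pos[OF assms(3,4)]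
  by (auto simp: block_pos_def)

text \<open>If a < c, block a ends no later than block c begins, whatever the places inside. This
  turns every comparison of values of a composite permutation into a lexicographic one.\<close>

lemma block_pos_less_iff:
  assumes "i < length ks" "r < ks ! i" "j < length ks" "s < ks ! j"
  shows "block_pos ks i r < block_pos ks j s \<longleftrightarrow> i < j \<or> i = j \<and> r < s"
proof -
  have *: "block_pos ks a b < block_pos ks c d"
    if "a < c" "a < length ks" "b < ks ! a" for a b c d
    using block_start_mono[of "Suc a" c ks] that by (simp add: block_pos_def block_start_Suc)
  consider "i < j" | "j < i" | "i = j" by linarith
  then show ?thesis
    using *[of i j r s] *[of j i s r] assms by cases (auto simp: block_pos_def)
qed

lemma block_pos_cases:
  assumes "p < sum_list ks"
  obtains i r where "i < length ks" "r < ks ! i" "p = block_pos ks i r"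
proof -
  let ?i = "block_index ks p"
  note b = block_index_bounds[OF assms]
  \<comment> \<open>For an index past the last block, \<open>block_start\<close> is the total
    length, which exceeds \<open>p\<close>.\<close>
  have i: "?i < length ks"
  proof (rule ccontr)
    assume "\<not> ?i < length ks"
    then show False using b(1) assms by (simp add: block_start_def)
  qed
  show thesis
    using b i by (intro that[of ?i "p - block_start ks ?i"])
      (auto simp: block_pos_def block_start_Suc)
qed

lemma nth_concat_block_pos:
  assumes "i < length xss" "r < length (xss ! i)"
  shows "concat xss ! block_pos (map length xss) i r = xss ! i ! r"
  using assms
proof (induction xss arbitrary: i)
  case (Cons xs xss)
  then show ?case
    by (cases i) (auto simp: block_pos_def block_start_Cons nth_append add.assoc,
      auto simp: block_start_def)
qed simp

text \<open>A triple (i, r, q) names one flat position, whether (i, r) or (r, q) is flattened first.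
  This aligns the two sides of the associativity axiom.\<close>

lemma block_pos_concat:
  assumes "i < length kss" "r < length (kss ! i)"
  shows "block_pos (concat kss) (block_pos (map length kss) i r) q =
    block_pos (map sum_list kss) i (block_pos (kss ! i) r q)"
  using assms
proof (induction kss arbitrary: i)
  case (Cons ks kss)
  show ?case
  proof (cases i)
    case 0
    then show ?thesis using Cons.prems by (simp add: block_pos_def block_start_def)
  next
    case (Suc j)
    have "block_start (ks @ ls) (length ks + m) = sum_list ks + block_start ls m" for ls m
      by (simp add: block_start_def)
    then show ?thesis
      using Cons.IH[of j] Cons.prems Suc by (simp add: block_pos_def block_start_Cons add.assoc)
  qed
qed simp

section \<open>Sum and block permutations in coordinates\<close>

lemma permutes_lessThanI:
  fixes f :: "nat \<Rightarrow> nat"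
  assumes "\<And>p. p < n \<Longrightarrow> f p < n" "inj_on f {..<n}" "\<And>p. n \<le> p \<Longrightarrow> f p = p"
  shows "f permutes {..<n}"
proof (rule bij_imp_permutes)
  have "f ` {..<n} = {..<n}" using assms(1,2) by (intro endo_inj_surj) auto
  then show "bij_betw f {..<n} {..<n}" using assms(2) by (simp add: bij_betw_def)
qed (use assms(3) in auto)

text \<open>In coordinates the two constructions separate: the sum permutation changes only the
  place r, the block permutation only the block i, the result of the latter being read in the
  permuted list of block lengths.\<close>

lemma sum_perm_pos:
  assumes "i < length ks" "r < ks ! i"
  shows "sum_perm ks \<tau>s (block_pos ks i r) = block_pos ks i ((\<tau>s ! i) r)"
  using block_pos_less[OF assms] block_index_pos[OF assms]
  by (simp add: sum_perm_def Let_def) (simp add: block_pos_def)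

lemma block_perm_pos:
  assumes "i < length ks" "r < ks ! i"
  shows "block_perm \<sigma> ks (block_pos ks i r) = block_pos (permute_list (inv \<sigma>) ks) (\<sigma> i) r"
  using block_pos_less[OF assms] block_index_pos[OF assms]
  by (simp add: block_perm_def Let_def) (simp add: block_pos_def)

lemma sum_perm_permutes:
  assumes "\<And>i. i < length ks \<Longrightarrow> \<tau>s ! i permutes {..<ks ! i}"
  shows "sum_perm ks \<tau>s permutes {..<sum_list ks}"
proof (rule permutes_lessThanI)
  have \<tau>: "(\<tau>s ! i) r < ks ! i" if "i < length ks" "r < ks ! i" for i r
    using permutes_in_image[OF assms[OF that(1)], of r] that by simp
  show "sum_perm ks \<tau>s p < sum_list ks" if "p < sum_list ks" for p
    using that by (elim block_pos_cases) (simp add: sum_perm_pos block_pos_less \<tau>)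
  show "inj_on (sum_perm ks \<tau>s) {..<sum_list ks}"
  proof (rule inj_onI)
    fix p q assume "p \<in> {..<sum_list ks}" "q \<in> {..<sum_list ks}"
      and e: "sum_perm ks \<tau>s p = sum_perm ks \<tau>s q"
    then obtain i r j s where ir: "i < length ks" "r < ks ! i" "p = block_pos ks i r"
      and js: "j < length ks" "s < ks ! j" "q = block_pos ks j s"
      by (metis block_pos_cases lessThan_iff)
    then have "i = j \<and> (\<tau>s ! i) r = (\<tau>s ! j) s"
      using e by (auto simp: sum_perm_pos block_pos_eq_iff \<tau>)
    then show "p = q"
      using ir js permutes_inj[OF assms[OF ir(1)]] by (auto dest: injD)
  qed
qed (simp add: sum_perm_def)

text \<open>Applied to a list of block lengths, this says that the block moved to \<sigma>(i) keeps
  its length, so that (\<sigma>(i), r) is a legitimate coordinate after the move.\<close>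

lemma permute_list_inv_nth:
  assumes "\<sigma> permutes {..<length xs}" "i < length xs"
  shows "\<sigma> i < length xs" "permute_list (inv \<sigma>) xs ! \<sigma> i = xs ! i"
proof -
  show "\<sigma> i < length xs" using permutes_in_image[OF assms(1), of i] assms(2) by simp
  then show "permute_list (inv \<sigma>) xs ! \<sigma> i = xs ! i"
    by (simp add: permute_list_nth[OF permutes_inv[OF assms(1)]] permutes_inverses(2)[OF assms(1)])
qed

lemma sum_list_permute_list:
  fixes xs :: "'a::comm_monoid_add list"
  assumes "\<sigma> permutes {..<length xs}"
  shows "sum_list (permute_list \<sigma> xs) = sum_list xs"
  by (metis assms mset_permute_list sum_mset_sum_list)

text \<open>Rearranging the lengths keeps their sum, so coordinates taken in the permuted list still
  name positions below the same bound; injectivity is uniqueness of coordinates.\<close>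

lemma block_perm_permutes:
  assumes \<sigma>: "\<sigma> permutes {..<length ks}"
  shows "block_perm \<sigma> ks permutes {..<sum_list ks}"
proof (rule permutes_lessThanI)
  let ?ls = "permute_list (inv \<sigma>) ks"
  note n = permute_list_inv_nth[OF \<sigma>]
  show "block_perm \<sigma> ks p < sum_list ks" if "p < sum_list ks" for p
    using that
  proof (elim block_pos_cases)
    fix i r assume "i < length ks" "r < ks ! i" "p = block_pos ks i r"
    then show ?thesis
      using block_pos_less[of "\<sigma> i" ?ls r] n[of i] sum_list_permute_list[OF permutes_inv[OF \<sigma>]]
      by (simp add: block_perm_pos)
  qed
  show "inj_on (block_perm \<sigma> ks) {..<sum_list ks}"
  proof (rule inj_onI)
    fix p q assume "p \<in> {..<sum_list ks}" "q \<in> {..<sum_list ks}"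
      and e: "block_perm \<sigma> ks p = block_perm \<sigma> ks q"
    then obtain i r j s where ir: "i < length ks" "r < ks ! i" "p = block_pos ks i r"
      and js: "j < length ks" "s < ks ! j" "q = block_pos ks j s"
      by (metis block_pos_cases lessThan_iff)
    then have "\<sigma> i = \<sigma> j" "r = s"
      using e n[of i] n[of j] by (simp_all add: block_perm_pos block_pos_eq_iff)
    then show "p = q"
      using ir js permutes_inj[OF \<sigma>] by (auto dest: injD)
  qed
qed (simp add: block_perm_def)

section \<open>Permutations and the orders they induce\<close>

text \<open>Increasing values force i \<le> \<rho>(i), and a permutation of an initial segment with
  this property is the identity. The hypothesis concerns neighbours only, as this is exactly what
  holds when bubble sort finds nothing left to swap.\<close>

lemma permutes_eqI_Suc:
  fixes \<rho> :: "nat \<Rightarrow> nat"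
  assumes \<rho>: "\<rho> permutes {..<n}" and asc: "\<And>i. Suc i < n \<Longrightarrow> \<rho> i < \<rho> (Suc i)"
  shows "\<rho> = id"
proof (rule permutes_natset_ge[OF \<rho>])
  have "i \<le> \<rho> i" if "i < n" for i
    using that
  proof (induction i)
    case (Suc i)
    then show ?case using asc[of i] by simp
  qed simp
  then show "\<forall>i\<in>{..<n}. i \<le> \<rho> i" by simp
qed

text \<open>The permutation \<open>\<rho> \<circ> inv \<pi>\<close> is increasing, hence the
  identity. This is the tool by which permutations are identified without computing their
  values.\<close>

lemma permutes_order_eqI:
  fixes \<pi> \<rho> :: "nat \<Rightarrow> nat"
  assumes \<pi>: "\<pi> permutes {..<n}" and \<rho>: "\<rho> permutes {..<n}"
    and ord: "\<And>a b. a < n \<Longrightarrow> b < n \<Longrightarrow> \<pi> a < \<pi> b \<Longrightarrow> \<rho> a < \<rho> b"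
  shows "\<pi> = \<rho>"
proof -
  have "\<rho> \<circ> inv \<pi> = id"
  proof (rule permutes_eqI_Suc)
    show "\<rho> \<circ> inv \<pi> permutes {..<n}" using \<pi> \<rho> by (intro permutes_compose permutes_inv)
    fix i assume "Suc i < n"
    then show "(\<rho> \<circ> inv \<pi>) i < (\<rho> \<circ> inv \<pi>) (Suc i)"
      using permutes_in_image[OF permutes_inv[OF \<pi>], of i]
        permutes_in_image[OF permutes_inv[OF \<pi>], of "Suc i"]
      by (auto intro!: ord simp: permutes_inverses(1)[OF \<pi>])
  qed
  then have "\<rho> \<circ> (inv \<pi> \<circ> \<pi>) = \<pi>" by (simp add: comp_assoc[symmetric])
  then show ?thesis using permutes_inv_o(2)[OF \<pi>] by simp
qed

text \<open>Swapping two neighbours reverses the order of that one pair only, which controls how the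
  set of inversions changes in a step of bubble sort.\<close>

lemma transpose_Suc_less:
  assumes "p < q" "\<not> (p = i \<and> q = Suc i)"
  shows "transpose i (Suc i) p < transpose i (Suc i) q"
  using assms by (auto simp: transpose_def)

text \<open>Bubble sort; the converse direction is by induction on the number of inversions.\<close>

lemma transposes_iff:
  assumes sym: "sym R"
  shows "transposes R gs \<rho> hs \<longleftrightarrow> \<rho> permutes {..<length gs} \<and> hs = permute_list \<rho> gs \<and>
    (\<forall>p q. p < q \<longrightarrow> q < length gs \<longrightarrow> \<rho> q < \<rho> p \<longrightarrow> (gs ! \<rho> p, gs ! \<rho> q) \<in> R)"
proof (intro iffI conjI allI impI; (elim conjE)?)
  assume t: "transposes R gs \<rho> hs"
  show "\<rho> permutes {..<length gs}" "hs = permute_list \<rho> gs"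
    using transposes_permute[OF t] .
  fix p q assume "p < q" "q < length gs" "\<rho> q < \<rho> p"
  with t show "(gs ! \<rho> p, gs ! \<rho> q) \<in> R"
  proof (induction arbitrary: p q rule: transposes.induct)
    case (step \<rho> hs i)
    note \<rho> = transposes_permute[OF step.hyps(1)]
    have i: "Suc i < length gs" using step.hyps \<rho> by simp
    show ?case
    \<comment> \<open>For the swapped pair the claim is the hypothesis of the step read backwards,
      hence the use of symmetry. The swap carries any other pair to a pair in the same order, which
      is covered by the induction hypothesis.\<close>
    proof (cases "p = i \<and> q = Suc i")
      case True
      have "(gs ! \<rho> i, gs ! \<rho> (Suc i)) \<in> R" using step.hyps(3) \<rho> i by (simp add: permute_list_nth)
      then show ?thesis using True symD[OF sym, of "gs ! \<rho> i"] by simp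
    next
      case False
      have "transpose i (Suc i) q < length gs" using i step.prems by (auto simp: transpose_def)
      then show ?thesis
        using step.IH[OF transpose_Suc_less[OF step.prems(1) False]] step.prems by simp
    qed
  qed simp
next
  let ?inv = "\<lambda>\<rho>. {(p, q). p < q \<and> q < length gs \<and> \<rho> q < (\<rho> p :: nat)}"
  assume "\<rho> permutes {..<length gs}" "hs = permute_list \<rho> gs"
    "\<forall>p q. p < q \<longrightarrow> q < length gs \<longrightarrow> \<rho> q < \<rho> p \<longrightarrow> (gs ! \<rho> p, gs ! \<rho> q) \<in> R"
  then show "transposes R gs \<rho> hs"
  proof (induction "card (?inv \<rho>)" arbitrary: \<rho> hs rule: less_induct)
    case less
    show ?case
    proof (cases "\<forall>i. Suc i < length gs \<longrightarrow> \<rho> i < \<rho> (Suc i)")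
      case True
      then have "\<rho> = id" using less.prems(1) by (intro permutes_eqI_Suc) auto
      then show ?thesis using less.prems(2) by (simp add: transposes.refl del: id_apply)
    next
      case False
      then obtain i where i: "Suc i < length gs" "\<rho> (Suc i) < \<rho> i"
        using permutes_inj[OF less.prems(1)] by (metis inj_eq linorder_neqE_nat n_not_Suc_n)
      let ?s = "transpose i (Suc i)"
      have s: "?s permutes {..<length gs}" using i by (intro permutes_swap_id) auto
      have \<rho>s: "\<rho> \<circ> ?s permutes {..<length gs}" by (intro permutes_compose s less.prems)
      \<comment> \<open>The swap maps inversions of \<open>\<rho> \<circ> ?s\<close> to inversions
        of \<rho>. It misses the descent (i, Suc i), which could only come from the pair (Suc i, i),
        listed in the wrong order.\<close>
      have smaller: "(?s p, ?s q) \<in> ?inv \<rho> - {(i, Suc i)}" if "(p, q) \<in> ?inv (\<rho> \<circ> ?s)" for p q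
      proof -
        have "\<not> (p = i \<and> q = Suc i)" using that i by auto
        then have "?s p < ?s q" using that by (intro transpose_Suc_less) auto
        moreover have "?s q < length gs" using that permutes_in_image[OF s, of q] by simp
        moreover have "(?s p, ?s q) \<noteq> (i, Suc i)" using that by (auto simp: transpose_def split: if_splits)
        ultimately show ?thesis using that by simp
      qed
      have fin: "finite (?inv \<rho>)"
        by (rule finite_subset[of _ "{..<length gs} \<times> {..<length gs}"]) auto
      have "card (?inv (\<rho> \<circ> ?s)) \<le> card (?inv \<rho> - {(i, Suc i)})"
      proof (rule card_inj_on_le[of "\<lambda>(p, q). (?s p, ?s q)"])
        show "inj_on (\<lambda>(p, q). (?s p, ?s q)) (?inv (\<rho> \<circ> ?s))"
          by (auto intro!: inj_onI dest: injD[OF permutes_inj[OF s]])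
        show "(\<lambda>(p, q). (?s p, ?s q)) ` ?inv (\<rho> \<circ> ?s) \<subseteq> ?inv \<rho> - {(i, Suc i)}"
        proof (rule image_subsetI)
          fix x assume "x \<in> ?inv (\<rho> \<circ> ?s)"
          then show "(case x of (p, q) \<Rightarrow> (?s p, ?s q)) \<in> ?inv \<rho> - {(i, Suc i)}"
            using smaller[of "fst x" "snd x"] by (simp only: prod.case_eq_if prod.collapse)
        qed
      qed (use fin in simp)
      also have "\<dots> < card (?inv \<rho>)"
        using i by (intro psubset_card_mono fin) auto
      finally have fewer: "card (?inv (\<rho> \<circ> ?s)) < card (?inv \<rho>)" .
      have "transposes R gs (\<rho> \<circ> ?s) (permute_list (\<rho> \<circ> ?s) gs)"
      proof (rule less.hyps[OF fewer \<rho>s HOL.refl])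
        show "\<forall>p q. p < q \<longrightarrow> q < length gs \<longrightarrow> (\<rho> \<circ> ?s) q < (\<rho> \<circ> ?s) p \<longrightarrow>
            (gs ! (\<rho> \<circ> ?s) p, gs ! (\<rho> \<circ> ?s) q) \<in> R"
          using smaller less.prems(3) by simp
      qed
      \<comment> \<open>Swapping once more restores \<rho>. The pair exchanged here is the descent
        of \<rho> with its entries in the opposite order, so symmetry supplies its membership in
        \<open>R\<close>.\<close>
      then have "transposes R gs (\<rho> \<circ> ?s \<circ> ?s) (permute_list ?s (permute_list (\<rho> \<circ> ?s) gs))"
      proof (rule transposes.step)
        have "(gs ! \<rho> (Suc i), gs ! \<rho> i) \<in> R"
          using i less.prems(3) by (intro symD[OF sym, of "gs ! \<rho> i"]) simp
        then show "(permute_list (\<rho> \<circ> ?s) gs ! i, permute_list (\<rho> \<circ> ?s) gs ! Suc i) \<in> R"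
          using i by (simp add: permute_list_nth[OF \<rho>s])
      qed (use i in simp)
      then show ?thesis
        using less.prems(2) s permute_list_compose[of ?s gs "\<rho> \<circ> ?s"] by (simp add: comp_assoc)
    qed
  qed
qed

section \<open>Words\<close>

abbreviation arity :: "'m word \<Rightarrow> nat" where
  "arity w \<equiv> length (snd w)"

text \<open>Well-formedness without colors. It suffices for everything that concerns permutations;
  sources and targets enter only where identity laws, associativity or stability of orthogonality in
  the category are used.\<close>

definition wf_word :: "'m word \<Rightarrow> bool" where
  "wf_word w \<longleftrightarrow> fst w permutes {..<arity w}"

definition word_family :: "'m word \<Rightarrow> 'm word list \<Rightarrow> bool" where
  "word_family w vs \<longleftrightarrow> wf_word w \<and> length vs = arity w \<and> (\<forall>i<length vs. wf_word (vs ! i))"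

lemma word_eqI:
  assumes "wf_word v" "wf_word w" "arity v = n" "arity w = n"
    and "\<And>p. p < n \<Longrightarrow> snd v ! p = snd w ! p"
    and "\<And>p q. p < n \<Longrightarrow> q < n \<Longrightarrow> fst v p < fst v q \<Longrightarrow> fst w p < fst w q"
  shows "v = w"
  using assms by (auto simp: wf_word_def prod_eq_iff intro: nth_equalityI permutes_order_eqI)

text \<open>The form in which equivariance, the left unit law and associativity are checked: one
  equation of arrows per coordinate and one comparison per pair of coordinates.\<close>

lemma word_eq_blockI:
  assumes "wf_word v" "wf_word w" "arity v = sum_list ks" "arity w = sum_list ks"
    and "\<And>i r. i < length ks \<Longrightarrow> r < ks ! i \<Longrightarrow>
      snd v ! block_pos ks i r = snd w ! block_pos ks i r"
    and "\<And>i r j s. i < length ks \<Longrightarrow> r < ks ! i \<Longrightarrow> j < length ks \<Longrightarrow> s < ks ! j \<Longrightarrow>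
      fst v (block_pos ks i r) < fst v (block_pos ks j s) \<Longrightarrow>
      fst w (block_pos ks i r) < fst w (block_pos ks j s)"
  shows "v = w"
proof (rule word_eqI[OF assms(1-4)])
  show "snd v ! p = snd w ! p" if "p < sum_list ks" for p
    using that by (rule block_pos_cases) (simp add: assms(5))
  show "fst w p < fst w q" if "p < sum_list ks" "q < sum_list ks" "fst v p < fst v q" for p q
    using that(1)
  proof (rule block_pos_cases)
    fix i r assume ir: "i < length ks" "r < ks ! i" "p = block_pos ks i r"
    from that(2) show ?thesis
      by (rule block_pos_cases) (use ir that(3) in \<open>simp add: assms(6)\<close>)
  qed
qed

lemma words_iff:
  "w \<in> words C t cs \<longleftrightarrow> wf_word w \<and> arity w = length cs \<and>
    (\<forall>i<length cs. snd w ! i \<in> Arr C \<and> src C (snd w ! i) = cs ! i \<and> tgt C (snd w ! i) = t)"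
  by (cases w) (auto simp: words_def wf_word_def)

lemma arity_word_act [simp]: "arity (word_act \<sigma> w) = arity w"
  by (simp add: word_act_def)

lemma wf_word_act: "wf_word w \<Longrightarrow> \<sigma> permutes {..<arity w} \<Longrightarrow> wf_word (word_act \<sigma> w)"
  by (simp add: wf_word_def word_act_def permutes_compose)

lemma word_act_words:
  assumes "w \<in> words C t cs" "\<sigma> permutes {..<length cs}"
  shows "word_act \<sigma> w \<in> words C t (permute_list \<sigma> cs)"
  using assms word_permute[of "fst w" "snd w" C t cs "fst w \<circ> \<sigma>" \<sigma>]
    permutes_compose[OF assms(2), of "fst w"]
  by (auto simp: word_act_def words_iff wf_word_def)

lemma map_arity_word_gamma:
  assumes "length vs = arity w"
  shows "map length (map2 (\<lambda>f v. map (cmp C f) (snd v)) (snd w) vs) = map arity vs"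
  using assms by (intro nth_equalityI) auto

lemma arity_word_gamma:
  assumes "length vs = arity w"
  shows "arity (word_gamma C w vs) = sum_list (map arity vs)"
  \<comment> \<open>With \<open>map_map\<close> active the nested maps would be fused and the list
    of lengths would no longer match the preceding lemma.\<close>
  by (simp add: word_gamma_def Let_def length_concat map_arity_word_gamma[OF assms] del: map_map)

lemma nth_word_gamma:
  assumes "length vs = arity w" "i < length vs" "r < arity (vs ! i)"
  shows "snd (word_gamma C w vs) ! block_pos (map arity vs) i r = cmp C (snd w ! i) (snd (vs ! i) ! r)"
  using nth_concat_block_pos[of i "map2 (\<lambda>f v. map (cmp C f) (snd v)) (snd w) vs" r] assms
  by (simp add: word_gamma_def Let_def map_arity_word_gamma del: map_map)

lemma wf_word_gamma:
  assumes "word_family w vs"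
  shows "wf_word (word_gamma C w vs)"
proof -
  have "block_perm (fst w) (map arity vs) \<circ> sum_perm (map arity vs) (map fst vs)
      permutes {..<sum_list (map arity vs)}"
    using assms block_perm_permutes[of "fst w" "map arity vs"]
      sum_perm_permutes[of "map arity vs" "map fst vs"]
    by (intro permutes_compose) (simp_all add: word_family_def wf_word_def)
  then show ?thesis
    using assms arity_word_gamma[of vs w C]
    by (simp add: wf_word_def word_family_def) (simp add: word_gamma_def Let_def)
qed

text \<open>The composite sends (i, r) to the coordinates (\<sigma>(i), \<tau>_i(r)) with respect to
  the permuted block lengths, and these are ordered lexicographically; injectivity of \<sigma> turns
  equality of target blocks into i = j. Every later comparison of positions under a composite rests
  on this.\<close>

lemma word_gamma_less_iff:
  assumes "word_family w vs" "i < length vs" "r < arity (vs ! i)" "j < length vs" "s < arity (vs ! j)"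
  shows "fst (word_gamma C w vs) (block_pos (map arity vs) i r) <
      fst (word_gamma C w vs) (block_pos (map arity vs) j s) \<longleftrightarrow>
    fst w i < fst w j \<or> i = j \<and> fst (vs ! i) r < fst (vs ! i) s"
proof -
  let ?ks = "map arity vs"
  let ?ls = "permute_list (inv (fst w)) ?ks"
  have w: "fst w permutes {..<length ?ks}" using assms(1) by (simp add: word_family_def wf_word_def)
  have pos: "fst (word_gamma C w vs) (block_pos ?ks k q) = block_pos ?ls (fst w k) (fst (vs ! k) q) \<and>
      fst w k < length ?ls \<and> fst (vs ! k) q < ?ls ! fst w k"
    if "k < length vs" "q < arity (vs ! k)" for k q
  proof -
    have "fst (vs ! k) permutes {..<arity (vs ! k)}"
      using assms(1) that by (simp add: word_family_def wf_word_def)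
    then have "fst (vs ! k) q < arity (vs ! k)" using permutes_in_image that by fastforce
    then show ?thesis
      using that permute_list_inv_nth[OF w, of k]
      by (simp add: word_gamma_def Let_def sum_perm_pos block_perm_pos)
  qed
  have "fst w i = fst w j \<longleftrightarrow> i = j" using permutes_inj[OF w] by (auto dest: injD)
  then show ?thesis
    using pos[OF assms(2,3)] pos[OF assms(4,5)] by (auto simp: block_pos_less_iff)
qed

lemma word_family_act:
  assumes "word_family w vs" "\<sigma> permutes {..<arity w}"
  shows "word_family (word_act \<sigma> w) (permute_list \<sigma> vs)"
proof -
  have "\<sigma> i < length vs" if "i < length vs" for i
    using assms permutes_in_image[of \<sigma> "{..<arity w}" i] that by (simp add: word_family_def)
  then show ?thesis
    using assms by (auto simp: word_family_def wf_word_act permute_list_nth)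
qed

section \<open>Equivariance, unit laws and associativity for words\<close>

lemma word_gamma_act_outer:
  assumes fam: "word_family w vs" and \<sigma>: "\<sigma> permutes {..<arity w}"
  shows "word_gamma C (word_act \<sigma> w) (permute_list \<sigma> vs) =
    word_act (block_perm \<sigma> (permute_list \<sigma> (map arity vs))) (word_gamma C w vs)"
proof -
  let ?ks = "map arity (permute_list \<sigma> vs)"
  have len: "length vs = arity w" using fam by (simp add: word_family_def)
  have \<sigma>': "\<sigma> permutes {..<length vs}" using \<sigma> len by simp
  have ks: "permute_list \<sigma> (map arity vs) = ?ks" using \<sigma>' by (simp add: permute_list_map)
  have sum: "sum_list ?ks = sum_list (map arity vs)"
    using \<sigma>' sum_list_permute_list[of \<sigma> "map arity vs"] by (simp add: ks)
  \<comment> \<open>Undoing the rearrangement gives back the block lengths of \<open>vs\<close>, so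
    images under the block permutation are read in the coordinates of
    \<open>word_gamma C w vs\<close>.\<close>
  have inv_ks: "permute_list (inv \<sigma>) ?ks = map arity vs"
    using permute_list_compose[of "inv \<sigma>" "map arity vs" \<sigma>] permutes_inv[OF \<sigma>'] \<sigma>'
    by (simp add: ks[symmetric] permutes_inv_o)
  have \<beta>: "block_perm \<sigma> ?ks permutes {..<sum_list (map arity vs)}"
    using block_perm_permutes[of \<sigma> ?ks] \<sigma>' sum by simp
  have fam': "word_family (word_act \<sigma> w) (permute_list \<sigma> vs)" by (rule word_family_act[OF fam \<sigma>])
  have nth: "\<sigma> i < length vs" "r < arity (vs ! \<sigma> i)" "permute_list \<sigma> vs ! i = vs ! \<sigma> i"
    "block_perm \<sigma> ?ks (block_pos ?ks i r) = block_pos (map arity vs) (\<sigma> i) r"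
    if "i < length ?ks" "r < ?ks ! i" for i r
    using that permutes_in_image[OF \<sigma>', of i] block_perm_pos[OF that, of \<sigma>] inv_ks
    by (auto simp: permute_list_nth[OF \<sigma>'])
  have pos: "block_pos ?ks i r < length (snd (word_gamma C w vs))" if "i < length ?ks" "r < ?ks ! i" for i r
    using block_pos_less[OF that] arity_word_gamma[OF len, of C] sum by simp
  show ?thesis
    unfolding ks
  proof (rule word_eq_blockI[where ks = ?ks])
    show "wf_word (word_gamma C (word_act \<sigma> w) (permute_list \<sigma> vs))"
      by (rule wf_word_gamma[OF fam'])
    show "wf_word (word_act (block_perm \<sigma> ?ks) (word_gamma C w vs))"
      using \<beta> by (intro wf_word_act wf_word_gamma fam) (simp add: arity_word_gamma len)
    show "arity (word_gamma C (word_act \<sigma> w) (permute_list \<sigma> vs)) = sum_list ?ks"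
      by (rule arity_word_gamma) (simp add: len)
    show "arity (word_act (block_perm \<sigma> ?ks) (word_gamma C w vs)) = sum_list ?ks"
      by (simp only: arity_word_act arity_word_gamma[OF len] sum)
  next
    fix i r assume i: "i < length ?ks" "r < ?ks ! i"
    have "i < arity w" using i len by simp
    then show "snd (word_gamma C (word_act \<sigma> w) (permute_list \<sigma> vs)) ! block_pos ?ks i r =
        snd (word_act (block_perm \<sigma> ?ks) (word_gamma C w vs)) ! block_pos ?ks i r"
      using i nth[OF i] \<beta> \<sigma> pos[OF i]
        nth_word_gamma[of "permute_list \<sigma> vs" "word_act \<sigma> w" i r C] nth_word_gamma[of vs w "\<sigma> i" r C]
      by (simp add: word_act_def permute_list_nth arity_word_gamma len)
  next
    fix i r j s assume i: "i < length ?ks" "r < ?ks ! i" and j: "j < length ?ks" "s < ?ks ! j"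
      and less: "fst (word_gamma C (word_act \<sigma> w) (permute_list \<sigma> vs)) (block_pos ?ks i r) <
        fst (word_gamma C (word_act \<sigma> w) (permute_list \<sigma> vs)) (block_pos ?ks j s)"
    \<comment> \<open>The condition of lying in the same block is thereby the same for the two
      composites, and their lexicographic comparisons agree clause by clause.\<close>
    have "\<sigma> i = \<sigma> j \<longleftrightarrow> i = j" using permutes_inj[OF \<sigma>] by (auto dest: injD)
    then show "fst (word_act (block_perm \<sigma> ?ks) (word_gamma C w vs)) (block_pos ?ks i r) <
        fst (word_act (block_perm \<sigma> ?ks) (word_gamma C w vs)) (block_pos ?ks j s)"
      using less i j nth[OF i] nth[OF j] word_gamma_less_iff[OF fam', of i r j s C]
        word_gamma_less_iff[OF fam, of "\<sigma> i" r "\<sigma> j" s C]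
      by (simp add: word_act_def)
  qed
qed

text \<open>The sum permutation keeps every block in place and replaces r by \<tau>_i(r) in block i.
  Acting on the i-th inner word has the same effect on its arrows and on its order.\<close>

lemma word_gamma_act_inner:
  assumes fam: "word_family w vs" and \<tau>s: "length \<tau>s = length vs"
    "\<And>i. i < length vs \<Longrightarrow> \<tau>s ! i permutes {..<arity (vs ! i)}"
  shows "word_gamma C w (map2 word_act \<tau>s vs) =
    word_act (sum_perm (map arity vs) \<tau>s) (word_gamma C w vs)"
proof -
  let ?vs = "map2 word_act \<tau>s vs" and ?ks = "map arity vs"
  have len: "length vs = arity w" using fam by (simp add: word_family_def)
  have ks: "map arity ?vs = ?ks" using \<tau>s(1) by (intro nth_equalityI) auto
  have fam': "word_family w ?vs"
    using fam \<tau>s by (auto simp: word_family_def intro: wf_word_act)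
  have \<beta>: "sum_perm ?ks \<tau>s permutes {..<sum_list ?ks}"
    using \<tau>s by (intro sum_perm_permutes) simp
  have nth: "(\<tau>s ! i) r < arity (vs ! i)"
    "sum_perm ?ks \<tau>s (block_pos ?ks i r) = block_pos ?ks i ((\<tau>s ! i) r)"
    if "i < length ?ks" "r < ?ks ! i" for i r
    using that permutes_in_image[OF \<tau>s(2), of i r] sum_perm_pos[OF that, of \<tau>s] by auto
  show ?thesis
  proof (rule word_eq_blockI[where ks = ?ks])
    show "wf_word (word_gamma C w ?vs)" by (rule wf_word_gamma[OF fam'])
    show "wf_word (word_act (sum_perm ?ks \<tau>s) (word_gamma C w vs))"
      using \<beta> by (intro wf_word_act wf_word_gamma fam) (simp add: arity_word_gamma len)
    show "arity (word_gamma C w ?vs) = sum_list ?ks"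
      using arity_word_gamma[of ?vs w C] \<tau>s(1) len unfolding ks by simp
    show "arity (word_act (sum_perm ?ks \<tau>s) (word_gamma C w vs)) = sum_list ?ks"
      by (simp add: arity_word_gamma len)
  next
    fix i r assume i: "i < length ?ks" "r < ?ks ! i"
    then show "snd (word_gamma C w ?vs) ! block_pos ?ks i r =
        snd (word_act (sum_perm ?ks \<tau>s) (word_gamma C w vs)) ! block_pos ?ks i r"
      using nth[OF i] \<beta> \<tau>s len block_pos_less[OF i]
        nth_word_gamma[of ?vs w i r C, unfolded ks] nth_word_gamma[of vs w i "(\<tau>s ! i) r" C]
      by (simp add: word_act_def permute_list_nth arity_word_gamma)
  next
    fix i r j s assume i: "i < length ?ks" "r < ?ks ! i" and j: "j < length ?ks" "s < ?ks ! j"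
      and less: "fst (word_gamma C w ?vs) (block_pos ?ks i r) < fst (word_gamma C w ?vs) (block_pos ?ks j s)"
    then show "fst (word_act (sum_perm ?ks \<tau>s) (word_gamma C w vs)) (block_pos ?ks i r) <
        fst (word_act (sum_perm ?ks \<tau>s) (word_gamma C w vs)) (block_pos ?ks j s)"
      using nth[OF i] nth[OF j] \<tau>s(1) word_gamma_less_iff[OF fam', of i r j s C, unfolded ks]
        word_gamma_less_iff[OF fam, of i "(\<tau>s ! i) r" j "(\<tau>s ! j) s" C]
      by (auto simp: word_act_def)
  qed
qed

text \<open>There is a single block, starting at 0, so inner and flat positions coincide and only
  the inner order survives.\<close>

lemma word_gamma_unit_left:
  assumes "wf_word w" "\<And>r. r < arity w \<Longrightarrow> cmp C f (snd w ! r) = snd w ! r"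
  shows "word_gamma C (id, [f]) [w] = w"
proof (rule word_eq_blockI[where ks = "[arity w]"])
  have fam: "word_family (id, [f]) [w]" using assms(1) by (simp add: word_family_def wf_word_def)
  show "wf_word (word_gamma C (id, [f]) [w])" by (rule wf_word_gamma[OF fam])
  show "arity (word_gamma C (id, [f]) [w]) = sum_list [arity w]" by (simp add: arity_word_gamma)
  have pos: "block_pos [arity w] 0 r = r" for r by (simp add: block_pos_def block_start_def)
  show "snd (word_gamma C (id, [f]) [w]) ! block_pos [arity w] i r = snd w ! block_pos [arity w] i r"
    if "i < length [arity w]" "r < [arity w] ! i" for i r
    using that nth_word_gamma[of "[w]" "(id, [f])" i r C] assms(2) pos by simp
  show "fst w (block_pos [arity w] i r) < fst w (block_pos [arity w] j s)"
    if "i < length [arity w]" "r < [arity w] ! i" "j < length [arity w]" "s < [arity w] ! j"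
      "fst (word_gamma C (id, [f]) [w]) (block_pos [arity w] i r) <
        fst (word_gamma C (id, [f]) [w]) (block_pos [arity w] j s)" for i r j s
    using that word_gamma_less_iff[OF fam, of i r j s C] pos by simp
qed (use assms in simp_all)

text \<open>All blocks have length one, so position p has coordinates (p, 0) and only the outer
  order survives.\<close>

lemma word_gamma_unit_right:
  assumes w: "wf_word w" "length us = arity w"
    and unit: "\<And>i. i < arity w \<Longrightarrow> cmp C (snd w ! i) (us ! i) = snd w ! i"
  shows "word_gamma C w (map (\<lambda>u. (id, [u])) us) = w"
proof (rule word_eqI)
  let ?vs = "map (\<lambda>u. (id, [u])) us"
  have fam: "word_family w ?vs" using w by (simp add: word_family_def wf_word_def)
  have ks: "map arity ?vs = replicate (arity w) 1" using w(2) by (intro nth_equalityI) auto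
  have "block_start (replicate (arity w) 1) i = i" if "i < arity w" for i
    using that by (simp add: block_start_def sum_list_replicate)
  then have pos: "block_pos (map arity ?vs) i 0 = i" if "i < arity w" for i
    using that unfolding ks by (simp add: block_pos_def)
  show "wf_word (word_gamma C w ?vs)" by (rule wf_word_gamma[OF fam])
  show "arity (word_gamma C w ?vs) = arity w"
    using arity_word_gamma[of ?vs w C] w(2) unfolding ks by (simp add: sum_list_replicate)
  show "snd (word_gamma C w ?vs) ! p = snd w ! p" if "p < arity w" for p
    using nth_word_gamma[of ?vs w p 0 C] pos[OF that] that w(2) unit by simp
  show "fst w p < fst w q" if "p < arity w" "q < arity w"
    "fst (word_gamma C w ?vs) p < fst (word_gamma C w ?vs) q" for p q
    using word_gamma_less_iff[OF fam, of p 0 q 0 C] pos[OF that(1)] pos[OF that(2)] that w(2) by simp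
qed (use w in simp_all)

text \<open>Both sides order triples (i, r, q) lexicographically by the outer, middle and inner
  permutations; the left side groups the first two components, the right side the last two. Since
  these words carry no colors, associativity of \<open>cmp\<close> is assumed just for the triples
  of arrows that occur.\<close>

lemma word_gamma_assoc:
  assumes fam: "word_family w vs" and len: "length uss = length vs"
    and fams: "\<And>i. i < length vs \<Longrightarrow> word_family (vs ! i) (uss ! i)"
    and assoc: "\<And>i r q. i < length vs \<Longrightarrow> r < arity (vs ! i) \<Longrightarrow> q < arity (uss ! i ! r) \<Longrightarrow>
      cmp C (cmp C (snd w ! i) (snd (vs ! i) ! r)) (snd (uss ! i ! r) ! q) =
      cmp C (snd w ! i) (cmp C (snd (vs ! i) ! r) (snd (uss ! i ! r) ! q))"
  shows "word_gamma C (word_gamma C w vs) (concat uss) = word_gamma C w (map2 (word_gamma C) vs uss)"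
proof -
  let ?x = "word_gamma C w vs" and ?zs = "map2 (word_gamma C) vs uss"
  let ?kss = "map (map arity) uss"
  let ?ks = "map arity (concat uss)"
  have ks: "?ks = concat ?kss" by (simp add: map_concat)
  have w: "length vs = arity w" using fam by (simp add: word_family_def)
  have lens: "length (uss ! i) = arity (vs ! i)" if "i < length vs" for i
    using fams[OF that] by (simp add: word_family_def)
  have vs_arity: "map arity vs = map length uss" "map arity vs = map length ?kss"
    using len lens by (auto intro!: nth_equalityI)
  have zs_arity: "map arity ?zs = map sum_list ?kss"
    using len lens by (auto intro!: nth_equalityI simp: arity_word_gamma)
  have x_arity: "length (concat uss) = arity ?x"
    using w by (simp add: arity_word_gamma length_concat vs_arity(1))
  have fam_x: "word_family ?x (concat uss)"
  proof -
    have "wf_word u" if "u \<in> set (concat uss)" for u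
    proof -
      from that obtain us where "us \<in> set uss" "u \<in> set us" by auto
      then obtain i r where "i < length uss" "us = uss ! i" "r < length us" "u = us ! r"
        by (metis in_set_conv_nth)
      then show ?thesis using fams[of i] len by (simp add: word_family_def)
    qed
    then show ?thesis
      using x_arity wf_word_gamma[OF fam, of C] nth_mem unfolding word_family_def by blast
  qed
  have fam_z: "word_family w ?zs"
    using fam fams len by (auto simp: word_family_def[of w] intro!: wf_word_gamma)
  have "sum_list (concat nss) = sum_list (map sum_list nss)" for nss :: "nat list list"
    by (induction nss) simp_all
  then have sum: "sum_list ?ks = sum_list (map arity ?zs)"
    unfolding ks zs_arity .
  \<comment> \<open>Dictionary between the two groupings: a block p of the left composite is a pair
    (i, r), and place q in it is place (r, q) in block i of the right composite.\<close>
  have pos: "\<exists>i r. i < length vs \<and> r < arity (vs ! i) \<and> q < arity (uss ! i ! r) \<and>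
      p = block_pos (map arity vs) i r \<and> concat uss ! p = uss ! i ! r \<and>
      block_pos ?ks p q = block_pos (map arity ?zs) i (block_pos (map arity (uss ! i)) r q) \<and>
      block_pos (map arity (uss ! i)) r q < arity (?zs ! i)"
    if "p < length ?ks" "q < ?ks ! p" for p q
  proof -
    have "p < sum_list (map arity vs)"
      using that by (simp add: length_concat vs_arity)
    then show ?thesis
    proof (rule block_pos_cases)
      fix i r assume i: "i < length (map arity vs)" "r < map arity vs ! i" "p = block_pos (map arity vs) i r"
      have u: "concat uss ! p = uss ! i ! r"
        using i len lens nth_concat_block_pos[of i uss r] by (simp add: vs_arity(1))
      then have q: "q < arity (uss ! i ! r)" using that by simp
      have "block_pos ?ks p q = block_pos (map arity ?zs) i (block_pos (map arity (uss ! i)) r q)"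
        using i len lens block_pos_concat[of i ?kss r q] unfolding ks zs_arity vs_arity(2) by simp
      moreover have "block_pos (map arity (uss ! i)) r q < arity (?zs ! i)"
        using i len lens q block_pos_less[of r "map arity (uss ! i)" q] by (simp add: arity_word_gamma)
      ultimately show ?thesis using i u q by auto
    qed
  qed
  show ?thesis
  proof (rule word_eq_blockI[where ks = ?ks])
    show "wf_word (word_gamma C ?x (concat uss))" by (rule wf_word_gamma[OF fam_x])
    show "wf_word (word_gamma C w ?zs)" by (rule wf_word_gamma[OF fam_z])
    show "arity (word_gamma C ?x (concat uss)) = sum_list ?ks"
      by (rule arity_word_gamma[OF x_arity])
    show "arity (word_gamma C w ?zs) = sum_list ?ks"
      unfolding sum using w len by (intro arity_word_gamma) simp
  next
    fix p q assume p: "p < length ?ks" "q < ?ks ! p"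
    obtain i r where i: "i < length vs" "r < arity (vs ! i)" "q < arity (uss ! i ! r)"
      and e: "p = block_pos (map arity vs) i r" "concat uss ! p = uss ! i ! r"
      "block_pos ?ks p q = block_pos (map arity ?zs) i (block_pos (map arity (uss ! i)) r q)"
      "block_pos (map arity (uss ! i)) r q < arity (?zs ! i)"
      using pos[OF p] by blast
    have "snd (word_gamma C ?x (concat uss)) ! block_pos ?ks p q =
        cmp C (cmp C (snd w ! i) (snd (vs ! i) ! r)) (snd (uss ! i ! r) ! q)"
      using nth_word_gamma[OF x_arity, of p q C] nth_word_gamma[OF w i(1,2), of C] p e(1,2) by simp
    also have "\<dots> = cmp C (snd w ! i) (snd (?zs ! i) ! block_pos (map arity (uss ! i)) r q)"
      using nth_word_gamma[of "uss ! i" "vs ! i" r q C] assoc[OF i] i lens len by simp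
    also have "\<dots> = snd (word_gamma C w ?zs) ! block_pos ?ks p q"
      using nth_word_gamma[of ?zs w i _ C, OF _ _ e(4)] e(3) w len i by simp
    finally show "snd (word_gamma C ?x (concat uss)) ! block_pos ?ks p q =
        snd (word_gamma C w ?zs) ! block_pos ?ks p q" .
  next
    fix p q p' q' assume p: "p < length ?ks" "q < ?ks ! p" and p': "p' < length ?ks" "q' < ?ks ! p'"
      and less: "fst (word_gamma C ?x (concat uss)) (block_pos ?ks p q) <
        fst (word_gamma C ?x (concat uss)) (block_pos ?ks p' q')"
    obtain i r where i: "i < length vs" "r < arity (vs ! i)" "q < arity (uss ! i ! r)"
      and e: "p = block_pos (map arity vs) i r" "concat uss ! p = uss ! i ! r"
      "block_pos ?ks p q = block_pos (map arity ?zs) i (block_pos (map arity (uss ! i)) r q)"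
      "block_pos (map arity (uss ! i)) r q < arity (?zs ! i)"
      using pos[OF p] by blast
    obtain i' r' where i': "i' < length vs" "r' < arity (vs ! i')" "q' < arity (uss ! i' ! r')"
      and e': "p' = block_pos (map arity vs) i' r'" "concat uss ! p' = uss ! i' ! r'"
      "block_pos ?ks p' q' = block_pos (map arity ?zs) i' (block_pos (map arity (uss ! i')) r' q')"
      "block_pos (map arity (uss ! i')) r' q' < arity (?zs ! i')"
      using pos[OF p'] by blast
    \<comment> \<open>Lying in the same block on the left means agreeing in the first two components
      of the triple.\<close>
    have eq: "p = p' \<longleftrightarrow> i = i' \<and> r = r'"
      using i i' unfolding e(1) e'(1) by (intro block_pos_eq_iff) auto
    have "fst ?x p < fst ?x p' \<or> p = p' \<and> fst (uss ! i ! r) q < fst (uss ! i ! r) q'"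
      using less word_gamma_less_iff[OF fam_x, of p q p' q' C] p p' e(2) by simp
    then have lex: "(fst w i < fst w i' \<or> i = i' \<and> fst (vs ! i) r < fst (vs ! i) r') \<or>
        i = i' \<and> r = r' \<and> fst (uss ! i ! r) q < fst (uss ! i ! r) q'"
      using word_gamma_less_iff[OF fam i(1,2) i'(1,2), of C] unfolding eq unfolding e(1) e'(1) by simp
    have "i = i' \<Longrightarrow> fst (?zs ! i) (block_pos (map arity (uss ! i)) r q) <
        fst (?zs ! i) (block_pos (map arity (uss ! i)) r' q') \<longleftrightarrow>
      fst (vs ! i) r < fst (vs ! i) r' \<or> r = r' \<and> fst (uss ! i ! r) q < fst (uss ! i ! r) q'"
      using word_gamma_less_iff[OF fams[OF i(1)], of r q r' q' C] i i' lens len by simp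
    then show "fst (word_gamma C w ?zs) (block_pos ?ks p q) < fst (word_gamma C w ?zs) (block_pos ?ks p' q')"
      using lex word_gamma_less_iff[OF fam_z _ e(4) _ e'(4), of C] i(1) i'(1) len unfolding e(3) e'(3)
      by auto
  qed
qed

text \<open>The color \<open>as ! i\<close> is at once the source of the i-th outer arrow and the
  target of all arrows of \<open>vs ! i\<close>, which makes every composite in the result
  legitimate.\<close>

lemma word_gamma_words:
  assumes C: "category C" and w: "w \<in> words C t as" and len: "length bss = length as" "length vs = length as"
    and vs: "\<And>i. i < length as \<Longrightarrow> vs ! i \<in> words C (as ! i) (bss ! i)"
  shows "word_family w vs" "word_gamma C w vs \<in> words C t (concat bss)"
proof -
  interpret category C by (rule C)
  show fam: "word_family w vs"
    using w len vs by (auto simp: word_family_def words_iff)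
  have ks: "map arity vs = map length bss"
    using len vs by (auto intro!: nth_equalityI simp: words_iff)
  have wl: "length vs = arity w" using w len by (simp add: words_iff)
  show "word_gamma C w vs \<in> words C t (concat bss)"
    unfolding words_iff
  proof (intro conjI allI impI)
    show "wf_word (word_gamma C w vs)" by (rule wf_word_gamma[OF fam])
    show "arity (word_gamma C w vs) = length (concat bss)"
      by (simp add: arity_word_gamma[OF wl] ks length_concat)
  next
    fix p assume "p < length (concat bss)"
    then have "p < sum_list (map arity vs)" by (simp add: ks length_concat)
    then obtain i r where i: "i < length vs" "r < arity (vs ! i)" and p: "p = block_pos (map arity vs) i r"
      by (rule block_pos_cases) auto
    have f: "snd w ! i \<in> Arr C" "src C (snd w ! i) = as ! i" "tgt C (snd w ! i) = t"
      using w i len by (auto simp: words_iff)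
    have r: "r < length (bss ! i)" and g: "snd (vs ! i) ! r \<in> Arr C"
      "src C (snd (vs ! i) ! r) = bss ! i ! r" "tgt C (snd (vs ! i) ! r) = as ! i"
      using vs[of i] i len by (auto simp: words_iff)
    have "concat bss ! p = bss ! i ! r"
      using nth_concat_block_pos[of i bss r] i r len by (simp add: p ks)
    then show "snd (word_gamma C w vs) ! p \<in> Arr C" "src C (snd (word_gamma C w vs) ! p) = concat bss ! p"
      "tgt C (snd (word_gamma C w vs) ! p) = t"
      using f g nth_word_gamma[OF wl i, of C] by (simp_all add: p cmp_Arr src_cmp tgt_cmp)
  qed
qed

section \<open>The orthogonality relation on words\<close>

text \<open>The definition uses the permutation \<open>fst v \<circ> inv (fst w)\<close> of the
  sequence rearranged by \<open>inv (fst v)\<close>. Substituting p = \<open>fst w a\<close> and q =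
  \<open>fst w b\<close> turns its inversions into the pairs (a, b) of original positions that the
  two words order oppositely, and the entries compared into the arrows at a and b.\<close>

lemma orth_eq_iff:
  assumes "orth_category Cb"
  shows "orth_eq Cb v w \<longleftrightarrow> wf_word v \<and> wf_word w \<and> snd v = snd w \<and>
    (\<forall>a<arity v. \<forall>b<arity v. fst w a < fst w b \<longrightarrow> fst v b < fst v a \<longrightarrow>
      (snd v ! a, snd v ! b) \<in> orth Cb)"
proof (cases "wf_word v \<and> wf_word w \<and> snd v = snd w")
  case True
  define n where "n = arity v"
  define fs where "fs = snd v"
  have fs: "snd w = fs" "snd v = fs" "length fs = n" using True by (auto simp: fs_def n_def)
  have \<sigma>: "fst v permutes {..<n}" and \<sigma>': "fst w permutes {..<n}"
    using True by (auto simp: n_def wf_word_def)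
  let ?\<rho> = "fst v \<circ> inv (fst w)"
  have sym: "sym (orth Cb)" using orth_category.orth_sym[OF assms] by (blast intro: symI)
  have i\<sigma>: "inv (fst v) permutes {..<n}" and i\<sigma>': "inv (fst w) permutes {..<n}"
    using \<sigma> \<sigma>' by (auto intro: permutes_inv)
  have \<rho>: "?\<rho> permutes {..<n}" using i\<sigma>' \<sigma> by (rule permutes_compose)
  \<comment> \<open>The end sequence required by \<open>orth_eq\<close> is the one that
    \<open>?\<rho>\<close> produces anyway, so only the condition on inversions remains.\<close>
  have "permute_list ?\<rho> (permute_list (inv (fst v)) fs) = permute_list (inv (fst v) \<circ> ?\<rho>) fs"
    using permute_list_compose[of ?\<rho> fs "inv (fst v)"] \<rho> fs by simp
  also have "inv (fst v) \<circ> ?\<rho> = inv (fst w)"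
    using permutes_inv_o(2)[OF \<sigma>] by (simp add: comp_assoc[symmetric])
  finally have p: "permute_list (inv (fst w)) fs = permute_list ?\<rho> (permute_list (inv (fst v)) fs)" ..
  have "orth_eq Cb v w \<longleftrightarrow> (\<forall>p q. p < q \<longrightarrow> q < n \<longrightarrow> ?\<rho> q < ?\<rho> p \<longrightarrow>
      (permute_list (inv (fst v)) fs ! ?\<rho> p, permute_list (inv (fst v)) fs ! ?\<rho> q) \<in> orth Cb)"
    using \<sigma> \<sigma>' \<rho> p by (simp add: orth_eq_def transposes_iff[OF sym] fs)
  also have "\<dots> \<longleftrightarrow> (\<forall>p q. p < q \<longrightarrow> q < n \<longrightarrow> ?\<rho> q < ?\<rho> p \<longrightarrow>
      (fs ! inv (fst w) p, fs ! inv (fst w) q) \<in> orth Cb)"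
  proof -
    have "permute_list (inv (fst v)) fs ! ?\<rho> p = fs ! inv (fst w) p" if "p < n" for p
      using permute_list_nth[of "inv (fst v)" fs "?\<rho> p"] i\<sigma> fs that permutes_in_image[OF \<rho>, of p]
        permutes_inverses(2)[OF \<sigma>] by simp
    then show ?thesis by (intro all_cong1 imp_cong HOL.refl) (simp del: o_apply)
  qed
  also have "\<dots> \<longleftrightarrow> (\<forall>a<n. \<forall>b<n. fst w a < fst w b \<longrightarrow> fst v b < fst v a \<longrightarrow> (fs ! a, fs ! b) \<in> orth Cb)"
  proof (intro iffI allI impI)
    fix a b
    assume *: "\<forall>p q. p < q \<longrightarrow> q < n \<longrightarrow> ?\<rho> q < ?\<rho> p \<longrightarrow> (fs ! inv (fst w) p, fs ! inv (fst w) q) \<in> orth Cb"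
      and "a < n" "b < n" "fst w a < fst w b" "fst v b < fst v a"
    then show "(fs ! a, fs ! b) \<in> orth Cb"
      using *[rule_format, of "fst w a" "fst w b"] permutes_in_image[OF \<sigma>', of b]
      by (simp add: permutes_inverses[OF \<sigma>'])
  next
    fix p q
    assume *: "\<forall>a<n. \<forall>b<n. fst w a < fst w b \<longrightarrow> fst v b < fst v a \<longrightarrow> (fs ! a, fs ! b) \<in> orth Cb"
      and "p < q" "q < n" "?\<rho> q < ?\<rho> p"
    then show "(fs ! inv (fst w) p, fs ! inv (fst w) q) \<in> orth Cb"
      using permutes_in_image[OF i\<sigma>', of p] permutes_in_image[OF i\<sigma>', of q]
      by (simp add: permutes_inverses[OF \<sigma>'])
  qed
  finally show ?thesis using True by (simp add: fs)
qed (auto simp: orth_eq_def wf_word_def)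

lemma orth_eq_words:
  assumes "orth_eq Cb v w" "v \<in> words C t cs"
  shows "w \<in> words C t cs"
  using assms by (auto simp: orth_eq_def words_iff wf_word_def)

text \<open>The action relabels positions in the same way in both words, so a pair (a, b) ordered
  oppositely afterwards comes from the pair (\<sigma>(a), \<sigma>(b)) ordered oppositely
  before.\<close>

lemma orth_eq_act:
  assumes Cb: "orth_category Cb" and eq: "orth_eq Cb v w" and \<sigma>: "\<sigma> permutes {..<arity v}"
  shows "orth_eq Cb (word_act \<sigma> v) (word_act \<sigma> w)"
proof -
  have "\<sigma> a < arity v" if "a < arity v" for a using permutes_in_image[OF \<sigma>, of a] that by simp
  then show ?thesis
    using eq \<sigma> wf_word_act[of v \<sigma>] wf_word_act[of w \<sigma>] unfolding orth_eq_iff[OF Cb]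
    by (auto simp: word_act_def permute_list_nth)
qed

text \<open>The outer word and all inner words are replaced simultaneously, because composition in
  the quotient ranges over representatives of all its arguments at once.\<close>

lemma orth_eq_gamma:
  assumes Cb: "orth_category Cb"
    and w: "w \<in> words (ucat Cb) t as" and len: "length bss = length as" "length vs = length as"
    and vs: "\<And>i. i < length as \<Longrightarrow> vs ! i \<in> words (ucat Cb) (as ! i) (bss ! i)"
    and eq: "orth_eq Cb w w'" "list_all2 (orth_eq Cb) vs vs'"
  shows "orth_eq Cb (word_gamma (ucat Cb) w vs) (word_gamma (ucat Cb) w' vs')"
proof -
  interpret orth_category Cb by (rule Cb)
  let ?C = "ucat Cb" and ?ks = "map arity vs"
  let ?x = "word_gamma ?C w vs" and ?x' = "word_gamma ?C w' vs'"
  have len': "length vs' = length as" using eq(2) len by (simp add: list_all2_lengthD)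
  have eqs: "orth_eq Cb (vs ! i) (vs' ! i)" if "i < length as" for i
    using eq(2) that len by (simp add: list_all2_nthD)
  have snds: "snd w' = snd w" "\<And>i. i < length as \<Longrightarrow> snd (vs' ! i) = snd (vs ! i)"
    using eq(1) eqs by (auto simp: orth_eq_iff[OF Cb])
  \<comment> \<open>Equivalent words have the same arrows, hence the same arities, so one system of
    coordinates serves both composites.\<close>
  have ks': "map arity vs' = ?ks" using len len' snds by (intro nth_equalityI) auto
  have w': "w' \<in> words ?C t as" by (rule orth_eq_words[OF eq(1) w])
  have vs': "vs' ! i \<in> words ?C (as ! i) (bss ! i)" if "i < length as" for i
    by (rule orth_eq_words[OF eqs[OF that] vs[OF that]])
  have fam: "word_family w vs" by (rule word_gamma_words[OF category_axioms w len vs])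
  have fam': "word_family w' vs'" by (rule word_gamma_words[OF category_axioms w' len(1) len' vs'])
  have wl: "length vs = arity w" "length vs' = arity w'" "length vs = length as"
    using fam fam' len by (simp_all add: word_family_def)
  have ar: "arity ?x = sum_list ?ks" "arity ?x' = sum_list ?ks"
    using arity_word_gamma[OF wl(1)] arity_word_gamma[OF wl(2)] ks' by simp_all
  show ?thesis
    unfolding orth_eq_iff[OF Cb]
  proof (intro conjI allI impI)
    show "wf_word ?x" "wf_word ?x'" using fam fam' by (auto intro: wf_word_gamma)
    show "snd ?x = snd ?x'"
    proof -
      have "map2 (\<lambda>f v. map (cmp ?C f) (snd v)) (snd w) vs = map2 (\<lambda>f v. map (cmp ?C f) (snd v)) (snd w') vs'"
        using snds wl len len' by (intro nth_equalityI) auto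
      then show ?thesis by (simp add: word_gamma_def Let_def)
    qed
  next
    fix a b assume "a < arity ?x" "b < arity ?x"
      and less: "fst ?x' a < fst ?x' b" "fst ?x b < fst ?x a"
    then have "a < sum_list ?ks" "b < sum_list ?ks" by (simp_all add: ar)
    then obtain i r j s where i: "i < length vs" "r < arity (vs ! i)" "a = block_pos ?ks i r"
      and j: "j < length vs" "s < arity (vs ! j)" "b = block_pos ?ks j s"
      by (elim block_pos_cases) auto
    have i': "i < length vs'" "r < arity (vs' ! i)" and j': "j < length vs'" "s < arity (vs' ! j)"
      using i j len len' snds by auto
    \<comment> \<open>In these two opposite comparisons the outer alternatives are void for i = j,
      leaving inner permutations that disagree; for distinct blocks the inner alternatives are void,
      leaving outer permutations that disagree.\<close>
    have l: "fst w' i < fst w' j \<or> i = j \<and> fst (vs' ! i) r < fst (vs' ! i) s"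
      using less(1) word_gamma_less_iff[OF fam' i' j', of ?C] by (simp add: i(3) j(3) ks')
    have l': "fst w j < fst w i \<or> j = i \<and> fst (vs ! j) s < fst (vs ! j) r"
      using less(2) word_gamma_less_iff[OF fam j(1,2) i(1,2), of ?C] by (simp add: i(3) j(3))
    have f: "snd w ! k \<in> Arr ?C" "src ?C (snd w ! k) = as ! k" if "k < length as" for k
      using w that by (auto simp: words_iff)
    have g: "snd (vs ! k) ! q \<in> Arr ?C" "tgt ?C (snd (vs ! k) ! q) = as ! k"
      if "k < length as" "q < arity (vs ! k)" for k q
      using vs[of k] that by (auto simp: words_iff)
    have "(cmp ?C (snd w ! i) (snd (vs ! i) ! r), cmp ?C (snd w ! j) (snd (vs ! j) ! s)) \<in> orth Cb"
    proof (cases "i = j")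
      case True
      then have "(snd (vs ! i) ! r, snd (vs ! i) ! s) \<in> orth Cb"
        using l l' eqs[of i] i j wl(3) by (auto simp: orth_eq_iff[OF Cb])
      then show ?thesis
        using True i j wl(3) f[of i] g[of i r] by (auto intro: orth_post)
    next
      case False
      then have "(snd w ! i, snd w ! j) \<in> orth Cb"
        using l l' eq(1) i j wl by (auto simp: orth_eq_iff[OF Cb])
      then show ?thesis
        using i j wl(3) f[of i] g[of i r] f[of j] g[of j s] by (auto intro: orth_pre)
    qed
    then show "(snd ?x ! a, snd ?x ! b) \<in> orth Cb"
      using nth_word_gamma[OF wl(1) i(1,2), of ?C] nth_word_gamma[OF wl(1) j(1,2), of ?C]
      by (simp add: i(3) j(3))
  qed
qed

section \<open>Operads and morphisms\<close>

lemma is_opsD: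
  assumes "is_ops P as bss ys"
  shows "length bss = length as" "length ys = length as"
    "\<And>i. i < length as \<Longrightarrow> is_op P (as ! i) (bss ! i) (ys ! i)"
  using assms by (auto simp: is_ops_def)

lemma is_ops_colors:
  assumes "is_ops P as bss ys"
  shows "set as \<subseteq> colors P" "\<And>bs. bs \<in> set bss \<Longrightarrow> set bs \<subseteq> colors P"
proof -
  show "set as \<subseteq> colors P"
  proof
    fix c assume "c \<in> set as"
    then obtain i where "i < length as" "c = as ! i" by (metis in_set_conv_nth)
    then show "c \<in> colors P" using is_opsD(3)[OF assms, of i] by (simp add: is_op_def)
  qed
  show "set bs \<subseteq> colors P" if bs: "bs \<in> set bss" for bs
  proof -
    obtain i where "i < length bss" "bs = bss ! i" using bs by (metis in_set_conv_nth)
    then show ?thesis using is_opsD(1)[OF assms] is_opsD(3)[OF assms, of i] by (simp add: is_op_def)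
  qed
qed

lemma map_map_idI: "(\<And>c. c \<in> set (concat xss) \<Longrightarrow> f c = c) \<Longrightarrow> map (map f) xss = xss"
  by (intro map_idI) auto

lemma is_ops_concat:
  assumes "length csss = length bss" "length zss = length bss"
    and "\<And>i. i < length bss \<Longrightarrow> is_ops P (bss ! i) (csss ! i) (zss ! i)"
  shows "is_ops P (concat bss) (concat csss) (concat zss)"
  using assms
proof (induction bss arbitrary: csss zss)
  case Nil
  then show ?case by (simp add: is_ops_def)
next
  case (Cons bs bss)
  obtain css csss' zs zss' where eq: "csss = css # csss'" "zss = zs # zss'"
    using Cons.prems by (metis length_Suc_conv)
  have "is_ops P bs css zs" using Cons.prems(3)[of 0] eq by simp
  moreover have "is_ops P (concat bss) (concat csss') (concat zss')"
    using Cons.prems Cons.prems(3)[of "Suc i" for i] eq by (intro Cons.IH) auto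
  ultimately show ?case
    by (simp add: eq is_ops_def nth_append)
qed

lemma is_ops_permute_list:
  assumes "is_ops P as bss ys" "\<sigma> permutes {..<length as}"
  shows "is_ops P (permute_list \<sigma> as) (permute_list \<sigma> bss) (permute_list \<sigma> ys)"
proof -
  have "\<sigma> i < length as" if "i < length as" for i
    using permutes_in_image[OF assms(2), of i] that by simp
  then show ?thesis using assms by (simp add: is_ops_def permute_list_nth)
qed

context operad_hom
begin

lemma cmap_color: "c \<in> colors (hdom \<phi>) \<Longrightarrow> cmap \<phi> c \<in> colors (hcod \<phi>)"
  using cmap_ext by (auto simp: PiE_def)

lemma omap_ops:
  assumes "is_ops (hdom \<phi>) as bss ys"
  shows "is_ops (hcod \<phi>) (map (cmap \<phi>) as) (map (map (cmap \<phi>)) bss)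
    (map (\<lambda>i. omap \<phi> (as ! i) (bss ! i) (ys ! i)) [0..<length as])"
  using assms omap_op by (simp add: is_ops_def)

end

text \<open>Outside the colors and operations of the domain both morphisms take the value
  \<open>undefined\<close>, so agreement where it is meaningful gives equality of records. All
  equations between operad morphisms below are proved this way.\<close>

lemma operad_hom_eqI:
  fixes \<phi> \<psi> :: "('c, 'x, 'd, 'y) operad_hom"
  assumes "operad_hom \<phi>" "operad_hom \<psi>" "hdom \<phi> = hdom \<psi>" "hcod \<phi> = hcod \<psi>"
    and cmap: "\<And>c. c \<in> colors (hdom \<phi>) \<Longrightarrow> cmap \<phi> c = cmap \<psi> c"
    and omap: "\<And>t cs x. is_op (hdom \<phi>) t cs x \<Longrightarrow> omap \<phi> t cs x = omap \<psi> t cs x"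
  shows "\<phi> = \<psi>"
proof -
  interpret \<phi>: operad_hom \<phi> by fact
  interpret \<psi>: operad_hom \<psi> by fact
  have "cmap \<phi> = cmap \<psi>"
    using \<phi>.cmap_ext \<psi>.cmap_ext assms(3,4) cmap by (intro PiE_ext) auto
  moreover have "omap \<phi> = omap \<psi>"
  proof (intro ext)
    fix t cs x show "omap \<phi> t cs x = omap \<psi> t cs x"
      using omap \<phi>.omap_ext \<psi>.omap_ext assms(3) by (cases "is_op (hdom \<phi>) t cs x") auto
  qed
  ultimately show ?thesis using assms(3,4) by simp
qed

section \<open>Identities, composites and the category of operads\<close>

lemma hom_id_simps:
  "hdom (hom_id P) = P" "hcod (hom_id P) = P"
  "c \<in> colors P \<Longrightarrow> cmap (hom_id P) c = c"
  "set cs \<subseteq> colors P \<Longrightarrow> map (cmap (hom_id P)) cs = cs"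
  "is_op P t cs x \<Longrightarrow> omap (hom_id P) t cs x = x"
  by (auto simp: hom_id_def intro!: map_idI)

lemma hom_id_hom:
  assumes "operad P"
  shows "operad_hom (hom_id P)"
proof -
  interpret operad P by fact
  show ?thesis
  proof
    show "cmap (hom_id P) \<in> colors (hdom (hom_id P)) \<rightarrow>\<^sub>E colors (hcod (hom_id P))"
      by (simp add: hom_id_def)
    show "omap (hom_id P) t cs x = undefined" if "\<not> is_op (hdom (hom_id P)) t cs x" for t cs x
      using that by (simp add: hom_id_def)
  next
    fix t as bss x ys assume x: "is_op (hdom (hom_id P)) t as x" and ys: "is_ops (hdom (hom_id P)) as bss ys"
    have "map (map (cmap (hom_id P))) bss = bss"
      using is_ops_colors(2)[OF ys] by (intro map_map_idI hom_id_simps(3)) (auto simp: hom_id_simps(1))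
    moreover have "map (\<lambda>i. omap (hom_id P) (as ! i) (bss ! i) (ys ! i)) [0..<length as] = ys"
      using ys by (intro nth_equalityI) (auto simp: is_ops_def hom_id_simps)
    moreover have "t \<in> colors P" "set as \<subseteq> colors P" using x by (auto simp: is_op_def hom_id_simps)
    ultimately show "omap (hom_id P) t (concat bss) (gamma (hdom (hom_id P)) t as bss x ys) =
        gamma (hcod (hom_id P)) (cmap (hom_id P) t) (map (cmap (hom_id P)) as)
          (map (map (cmap (hom_id P))) bss) (omap (hom_id P) t as x)
          (map (\<lambda>i. omap (hom_id P) (as ! i) (bss ! i) (ys ! i)) [0..<length as])"
      using gamma_op[of t as x bss ys] x ys by (simp add: hom_id_simps)
  next
    fix t cs x \<sigma> assume x: "is_op (hdom (hom_id P)) t cs x" and \<sigma>: "\<sigma> permutes {..<length cs}"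
    then show "omap (hom_id P) t (permute_list \<sigma> cs) (act (hdom (hom_id P)) t cs \<sigma> x) =
        act (hcod (hom_id P)) (cmap (hom_id P) t) (map (cmap (hom_id P)) cs) \<sigma> (omap (hom_id P) t cs x)"
      using act_op[of t cs x \<sigma>] by (simp add: hom_id_simps is_op_def[of P t cs])
  qed (use opunit_op in \<open>auto simp: hom_id_simps is_op_def\<close>)
qed

lemma hom_comp_simps:
  "hdom (hom_comp \<psi> \<phi>) = hdom \<phi>" "hcod (hom_comp \<psi> \<phi>) = hcod \<psi>"
  "c \<in> colors (hdom \<phi>) \<Longrightarrow> cmap (hom_comp \<psi> \<phi>) c = cmap \<psi> (cmap \<phi> c)"
  "set cs \<subseteq> colors (hdom \<phi>) \<Longrightarrow> map (cmap (hom_comp \<psi> \<phi>)) cs = map (cmap \<psi>) (map (cmap \<phi>) cs)"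
  "is_op (hdom \<phi>) t cs x \<Longrightarrow>
    omap (hom_comp \<psi> \<phi>) t cs x = omap \<psi> (cmap \<phi> t) (map (cmap \<phi>) cs) (omap \<phi> t cs x)"
  by (auto simp: hom_comp_def compose_def)

lemma hom_comp_hom:
  assumes "operad_hom \<phi>" "operad_hom \<psi>" "hdom \<psi> = hcod \<phi>" "operad (hdom \<phi>)"
  shows "operad_hom (hom_comp \<psi> \<phi>)"
proof -
  interpret \<phi>: operad_hom \<phi> by fact
  interpret \<psi>: operad_hom \<psi> by fact
  interpret P: operad "hdom \<phi>" by fact
  let ?\<chi> = "hom_comp \<psi> \<phi>"
  have op: "t \<in> colors (hdom \<phi>)" "set cs \<subseteq> colors (hdom \<phi>)" if "is_op (hdom \<phi>) t cs x" for t cs x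
    using that by (auto simp: is_op_def)
  show ?thesis
  proof
    show "cmap ?\<chi> \<in> colors (hdom ?\<chi>) \<rightarrow>\<^sub>E colors (hcod ?\<chi>)"
      using \<phi>.cmap_color \<psi>.cmap_color assms(3) by (auto simp: hom_comp_def compose_def PiE_def)
    show "omap ?\<chi> t cs x = undefined" if "\<not> is_op (hdom ?\<chi>) t cs x" for t cs x
      using that by (simp add: hom_comp_def)
    show "is_op (hcod ?\<chi>) (cmap ?\<chi> t) (map (cmap ?\<chi>) cs) (omap ?\<chi> t cs x)"
      if "is_op (hdom ?\<chi>) t cs x" for t cs x
      using \<phi>.omap_op[of t cs x] \<psi>.omap_op[of "cmap \<phi> t" "map (cmap \<phi>) cs"] op[of t cs x] that assms(3)
      by (simp add: hom_comp_simps del: map_map)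
    show "omap ?\<chi> c [c] (opunit (hdom ?\<chi>) c) = opunit (hcod ?\<chi>) (cmap ?\<chi> c)"
      if "c \<in> colors (hdom ?\<chi>)" for c
      using that P.opunit_op[of c] \<phi>.omap_opunit[of c] \<psi>.omap_opunit[of "cmap \<phi> c"] \<phi>.cmap_color[of c] assms(3)
      by (simp add: hom_comp_simps)
  next
    fix t cs x \<sigma> assume x: "is_op (hdom ?\<chi>) t cs x" and \<sigma>: "\<sigma> permutes {..<length cs}"
    then show "omap ?\<chi> t (permute_list \<sigma> cs) (act (hdom ?\<chi>) t cs \<sigma> x) =
        act (hcod ?\<chi>) (cmap ?\<chi> t) (map (cmap ?\<chi>) cs) \<sigma> (omap ?\<chi> t cs x)"
      using P.act_op[of t cs x \<sigma>] \<phi>.omap_op[of t cs x] op[of t cs x] \<phi>.omap_act[of t cs x \<sigma>]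
        \<psi>.omap_act[of "cmap \<phi> t" "map (cmap \<phi>) cs" "omap \<phi> t cs x" \<sigma>] assms(3)
        permute_list_map[of \<sigma> cs "cmap \<phi>"]
      by (simp add: hom_comp_simps del: map_map)
  next
    fix t as bss x ys assume x: "is_op (hdom ?\<chi>) t as x" and ys: "is_ops (hdom ?\<chi>) as bss ys"
    let ?ys = "map (\<lambda>i. omap \<phi> (as ! i) (bss ! i) (ys ! i)) [0..<length as]"
    have x': "is_op (hdom \<phi>) t as x" and ys': "is_ops (hdom \<phi>) as bss ys"
      using x ys by (simp_all add: hom_comp_simps)
    have bss: "map (map (cmap ?\<chi>)) bss = map (map (cmap \<psi>)) (map (map (cmap \<phi>)) bss)"
      using is_ops_colors(2)[OF ys'] by (simp add: hom_comp_simps)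
    \<comment> \<open>The images are rewritten as lookups in the mapped lists, the shape in which
      \<psi> preserves the composition of the family already mapped by \<phi>.\<close>
    have ys2: "map (\<lambda>i. omap ?\<chi> (as ! i) (bss ! i) (ys ! i)) [0..<length as] =
      map (\<lambda>i. omap \<psi> (map (cmap \<phi>) as ! i) (map (map (cmap \<phi>)) bss ! i) (?ys ! i)) [0..<length (map (cmap \<phi>) as)]"
      using is_opsD[OF ys'] by (auto simp: hom_comp_simps)
    have "omap ?\<chi> t (concat bss) (gamma (hdom ?\<chi>) t as bss x ys) =
        omap \<psi> (cmap \<phi> t) (concat (map (map (cmap \<phi>)) bss)) (omap \<phi> t (concat bss) (gamma (hdom \<phi>) t as bss x ys))"
      using P.gamma_op[OF x' ys'] by (simp add: hom_comp_simps map_concat)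
    also have "\<dots> = gamma (hcod \<psi>) (cmap \<psi> (cmap \<phi> t)) (map (cmap \<psi>) (map (cmap \<phi>) as))
        (map (map (cmap \<psi>)) (map (map (cmap \<phi>)) bss)) (omap \<psi> (cmap \<phi> t) (map (cmap \<phi>) as) (omap \<phi> t as x))
        (map (\<lambda>i. omap \<psi> (map (cmap \<phi>) as ! i) (map (map (cmap \<phi>)) bss ! i) (?ys ! i)) [0..<length (map (cmap \<phi>) as)])"
      unfolding \<phi>.omap_gamma[OF x' ys'] using \<psi>.omap_gamma \<phi>.omap_op[OF x'] \<phi>.omap_ops[OF ys'] assms(3)
      by simp
    finally show "omap ?\<chi> t (concat bss) (gamma (hdom ?\<chi>) t as bss x ys) =
        gamma (hcod ?\<chi>) (cmap ?\<chi> t) (map (cmap ?\<chi>) as) (map (map (cmap ?\<chi>)) bss) (omap ?\<chi> t as x)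
          (map (\<lambda>i. omap ?\<chi> (as ! i) (bss ! i) (ys ! i)) [0..<length as])"
      unfolding bss ys2 using op[OF x'] x' by (simp only: hom_comp_simps)
  qed
qed

lemma category_Opd: "category (Opd :: (('c, 'x) operad, ('c, 'x, 'c, 'x) operad_hom) category)"
proof
  fix \<phi> \<psi> :: "('c, 'x, 'c, 'x) operad_hom"
  assume *: "\<phi> \<in> Arr Opd" "\<psi> \<in> Arr Opd" "src Opd \<psi> = tgt Opd \<phi>"
  then show "cmp Opd \<psi> \<phi> \<in> Arr Opd" "src Opd (cmp Opd \<psi> \<phi>) = src Opd \<phi>"
    "tgt Opd (cmp Opd \<psi> \<phi>) = tgt Opd \<psi>"
    using hom_comp_hom[of \<phi> \<psi>] by (auto simp: Opd_def hom_comp_simps)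
  fix \<chi> :: "('c, 'x, 'c, 'x) operad_hom"
  assume **: "\<chi> \<in> Arr Opd" "src Opd \<chi> = tgt Opd \<psi>"
  interpret \<phi>: operad_hom \<phi> using * by (simp add: Opd_def)
  have "hom_comp (hom_comp \<chi> \<psi>) \<phi> = hom_comp \<chi> (hom_comp \<psi> \<phi>)"
  proof (rule operad_hom_eqI)
    show "operad_hom (hom_comp (hom_comp \<chi> \<psi>) \<phi>)" "operad_hom (hom_comp \<chi> (hom_comp \<psi> \<phi>))"
      using * ** by (auto intro!: hom_comp_hom simp: Opd_def hom_comp_simps)
    show "omap (hom_comp (hom_comp \<chi> \<psi>) \<phi>) t cs x = omap (hom_comp \<chi> (hom_comp \<psi> \<phi>)) t cs x"
      if "is_op (hdom (hom_comp (hom_comp \<chi> \<psi>) \<phi>)) t cs x" for t cs x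
      using that \<phi>.omap_op[of t cs x] *
      by (simp add: hom_comp_simps Opd_def is_op_def[of "hdom \<phi>"] del: map_map)
  qed (use * \<phi>.cmap_color in \<open>simp_all add: hom_comp_simps Opd_def\<close>)
  then show "cmp Opd (cmp Opd \<chi> \<psi>) \<phi> = cmp Opd \<chi> (cmp Opd \<psi> \<phi>)" by (simp add: Opd_def)
next
  fix \<phi> :: "('c, 'x, 'c, 'x) operad_hom"
  assume *: "\<phi> \<in> Arr Opd"
  interpret \<phi>: operad_hom \<phi> using * by (simp add: Opd_def)
  have P: "operad (hdom \<phi>)" "operad (hcod \<phi>)" using * by (simp_all add: Opd_def)
  have op: "t \<in> colors (hdom \<phi>)" "set cs \<subseteq> colors (hdom \<phi>)" if "is_op (hdom \<phi>) t cs x" for t cs x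
    using that by (auto simp: is_op_def)
  have "hom_comp (hom_id (hcod \<phi>)) \<phi> = \<phi>"
  proof (rule operad_hom_eqI)
    show "operad_hom (hom_comp (hom_id (hcod \<phi>)) \<phi>)"
      using P by (intro hom_comp_hom hom_id_hom \<phi>.operad_hom_axioms) (simp_all add: hom_id_simps)
  qed (use \<phi>.operad_hom_axioms \<phi>.cmap_color \<phi>.omap_op in \<open>simp_all add: hom_comp_simps hom_id_simps\<close>)
  moreover have "hom_comp \<phi> (hom_id (hdom \<phi>)) = \<phi>"
  proof (rule operad_hom_eqI)
    show "operad_hom (hom_comp \<phi> (hom_id (hdom \<phi>)))"
      using P by (intro hom_comp_hom hom_id_hom \<phi>.operad_hom_axioms) (simp_all add: hom_id_simps)
  qed (use \<phi>.operad_hom_axioms op in \<open>simp_all add: hom_comp_simps hom_id_simps\<close>)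
  ultimately show "cmp Opd (idn Opd (tgt Opd \<phi>)) \<phi> = \<phi>" "cmp Opd \<phi> (idn Opd (src Opd \<phi>)) = \<phi>"
    by (simp_all add: Opd_def)
qed (auto simp: Opd_def hom_id_simps hom_id_hom)

section \<open>Quotients of operads\<close>

text \<open>No equivalence relation is mentioned: \<open>Q\<close> is any structure onto whose
  operations \<open>q\<close> maps those of \<open>P\<close>, with structure maps computed on
  preimages. That \<open>Q\<close> is an operad is a conclusion, not an assumption.\<close>

locale operad_quotient = P: operad P for P :: "('c, 'x) operad" +
  fixes Q :: "('c, 'y) operad" and q :: "'x \<Rightarrow> 'y"
  assumes colors_quotient: "colors Q = colors P"
    and is_op_quotient: "is_op Q t cs y \<longleftrightarrow> (\<exists>x. is_op P t cs x \<and> y = q x)"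
    and act_quotient: "\<lbrakk>is_op P t cs x; \<sigma> permutes {..<length cs}\<rbrakk> \<Longrightarrow>
      act Q t cs \<sigma> (q x) = q (act P t cs \<sigma> x)"
    and gamma_quotient: "\<lbrakk>is_op P t as x; is_ops P as bss ys\<rbrakk> \<Longrightarrow>
      gamma Q t as bss (q x) (map q ys) = q (gamma P t as bss x ys)"
    and opunit_quotient: "c \<in> colors P \<Longrightarrow> opunit Q c = q (opunit P c)"
begin

lemma lift_op:
  assumes "is_op Q t cs y"
  obtains x where "is_op P t cs x" "y = q x"
  using assms is_op_quotient by blast

lemma lift_ops:
  assumes "is_ops Q as bss ys"
  obtains xs where "is_ops P as bss xs" "ys = map q xs"
proof -
  have "\<forall>i<length as. \<exists>x. is_op P (as ! i) (bss ! i) x \<and> ys ! i = q x"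
    using assms is_op_quotient by (simp add: is_ops_def)
  then obtain f where f: "\<And>i. i < length as \<Longrightarrow> is_op P (as ! i) (bss ! i) (f i) \<and> ys ! i = q (f i)"
    by metis
  show thesis
  proof (rule that[of "map f [0..<length as]"])
    show "is_ops P as bss (map f [0..<length as])" using f assms by (simp add: is_ops_def)
    show "ys = map q (map f [0..<length as])"
      using f assms by (intro nth_equalityI) (auto simp: is_ops_def)
  qed
qed

lemma quotient_op: "is_op P t cs x \<Longrightarrow> is_op Q t cs (q x)"
  using is_op_quotient by blast

text \<open>The axioms are closure conditions and equations, so it suffices to lift all arguments
  along \<open>q\<close>, apply the axiom in \<open>P\<close> and map the result down. Moving
  \<open>q\<close> past a structure map requires its arguments to be genuine operations, which is
  why each equation needs closure facts first.\<close>

lemma operad_quotient: "operad Q"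
proof
  fix t cs y \<sigma> assume "is_op Q t cs y" and \<sigma>: "\<sigma> permutes {..<length cs}"
  from this(1) obtain x where x: "is_op P t cs x" "y = q x" by (rule lift_op)
  show "is_op Q t (permute_list \<sigma> cs) (act Q t cs \<sigma> y)"
    using P.act_op[OF x(1) \<sigma>] act_quotient[OF x(1) \<sigma>] x(2) by (simp add: quotient_op)
  fix \<sigma>' assume \<sigma>': "\<sigma>' permutes {..<length cs}"
  then show "act Q t (permute_list \<sigma> cs) \<sigma>' (act Q t cs \<sigma> y) = act Q t cs (\<sigma> \<circ> \<sigma>') y"
    using P.act_op[OF x(1) \<sigma>] act_quotient[OF x(1) \<sigma>] x P.act_act[OF x(1) \<sigma> \<sigma>']
      act_quotient[OF x(1) permutes_compose[OF \<sigma>' \<sigma>]] act_quotient[OF P.act_op[OF x(1) \<sigma>], of \<sigma>']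
    by simp
next
  fix t as y bss ys assume "is_op Q t as y" "is_ops Q as bss ys"
  then obtain x xs where x: "is_op P t as x" "y = q x" and xs: "is_ops P as bss xs" "ys = map q xs"
    by (metis lift_op lift_ops)
  have \<gamma>: "gamma Q t as bss y ys = q (gamma P t as bss x xs)"
    using gamma_quotient[OF x(1) xs(1)] x xs by simp
  note len = is_opsD(1,2)[OF xs(1)]
  show "is_op Q t (concat bss) (gamma Q t as bss y ys)"
    unfolding \<gamma> by (intro quotient_op P.gamma_op x xs)
  show "gamma Q t (permute_list \<sigma> as) (permute_list \<sigma> bss) (act Q t as \<sigma> y) (permute_list \<sigma> ys) =
      act Q t (concat bss) (block_perm \<sigma> (permute_list \<sigma> (map length bss))) (gamma Q t as bss y ys)"
    if \<sigma>: "\<sigma> permutes {..<length as}" for \<sigma>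
  proof -
    \<comment> \<open>Only for a permutation of all inputs of the composite may \<open>q\<close> be
      moved past the action.\<close>
    have "block_perm \<sigma> (permute_list \<sigma> (map length bss)) permutes {..<length (concat bss)}"
      using block_perm_permutes[of \<sigma> "permute_list \<sigma> (map length bss)"] \<sigma> len
        sum_list_permute_list[of \<sigma> "map length bss"] by (simp add: length_concat)
    then show ?thesis
      using P.equivariance_outer[OF x(1) xs(1) \<sigma>] act_quotient[OF P.gamma_op[OF x(1) xs(1)]]
        gamma_quotient[OF P.act_op[OF x(1) \<sigma>] is_ops_permute_list[OF xs(1) \<sigma>]] act_quotient[OF x(1) \<sigma>]
        \<sigma> len permute_list_map[of \<sigma> xs q]
      unfolding \<gamma> by (simp add: x xs)
  qed
  show "gamma Q t as (map2 permute_list \<tau>s bss) y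
        (map (\<lambda>i. act Q (as ! i) (bss ! i) (\<tau>s ! i) (ys ! i)) [0..<length as]) =
      act Q t (concat bss) (sum_perm (map length bss) \<tau>s) (gamma Q t as bss y ys)"
    if \<tau>s: "length \<tau>s = length as" "\<And>i. i < length as \<Longrightarrow> \<tau>s ! i permutes {..<length (bss ! i)}" for \<tau>s
  proof -
    let ?xs = "map (\<lambda>i. act P (as ! i) (bss ! i) (\<tau>s ! i) (xs ! i)) [0..<length as]"
    have "sum_perm (map length bss) \<tau>s permutes {..<length (concat bss)}"
      using sum_perm_permutes[of "map length bss" \<tau>s] \<tau>s len by (simp add: length_concat)
    moreover have "is_ops P as (map2 permute_list \<tau>s bss) ?xs"
      using is_opsD[OF xs(1)] \<tau>s by (simp add: is_ops_def P.act_op)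
    moreover have "map (\<lambda>i. act Q (as ! i) (bss ! i) (\<tau>s ! i) (ys ! i)) [0..<length as] = map q ?xs"
      using is_opsD[OF xs(1)] \<tau>s by (simp add: xs(2) act_quotient)
    ultimately show ?thesis
      using P.equivariance_inner[OF x(1) xs(1) \<tau>s] act_quotient[OF P.gamma_op[OF x(1) xs(1)]]
        gamma_quotient[OF x(1)]
      unfolding \<gamma> by (simp add: x(2) del: map_map)
  qed
  fix csss :: "'c list list list" and zss :: "'y list list"
  assume l: "length csss = length as" "length zss = length as"
    and zss: "\<And>i. i < length as \<Longrightarrow> is_ops Q (bss ! i) (csss ! i) (zss ! i)"
  have "\<exists>us. is_ops P (bss ! i) (csss ! i) us \<and> zss ! i = map q us" if "i < length as" for i
    using zss[OF that] by (metis lift_ops)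
  \<comment> \<open>One lift is chosen for each inner family. Any choice will do, since the images
    under \<open>q\<close> are prescribed.\<close>
  then obtain f where f: "\<And>i. i < length as \<Longrightarrow>
      is_ops P (bss ! i) (csss ! i) (f i) \<and> zss ! i = map q (f i)"
    by metis
  define uss where "uss = map f [0..<length as]"
  have uss: "length uss = length as" "\<And>i. i < length as \<Longrightarrow> is_ops P (bss ! i) (csss ! i) (uss ! i)"
    using f by (simp_all add: uss_def)
  have zss_eq: "zss = map (map q) uss"
    using f l by (intro nth_equalityI) (auto simp: uss_def)
  let ?us = "map (\<lambda>i. gamma P (as ! i) (bss ! i) (csss ! i) (xs ! i) (uss ! i)) [0..<length as]"
  have ops: "is_ops P (concat bss) (concat csss) (concat uss)"
    using l uss len by (intro is_ops_concat) auto
  have us: "is_ops P as (map concat csss) ?us"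
    using is_opsD[OF xs(1)] l uss by (simp add: is_ops_def[of P as] P.gamma_op)
  have "map (\<lambda>i. gamma Q (as ! i) (bss ! i) (csss ! i) (ys ! i) (zss ! i)) [0..<length as] = map q ?us"
    using is_opsD[OF xs(1)] uss by (simp add: zss_eq xs(2) gamma_quotient)
  moreover have "concat zss = map q (concat uss)" by (simp add: zss_eq map_concat)
  ultimately show "gamma Q t (concat bss) (concat csss) (gamma Q t as bss y ys) (concat zss) =
      gamma Q t as (map concat csss) y
        (map (\<lambda>i. gamma Q (as ! i) (bss ! i) (csss ! i) (ys ! i) (zss ! i)) [0..<length as])"
    using gamma_quotient[OF P.gamma_op[OF x(1) xs(1)] ops] gamma_quotient[OF x(1) us]
      P.assoc[OF x(1) xs(1) l(1) uss]
    unfolding \<gamma> by (simp add: x(2) del: map_map)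
next
  fix t cs y assume "is_op Q t cs y"
  then obtain x where x: "is_op P t cs x" "y = q x" by (rule lift_op)
  have t: "t \<in> colors P" "set cs \<subseteq> colors P" using x(1) by (auto simp: is_op_def)
  show "act Q t cs id y = y" using x act_quotient[OF x(1) permutes_id] P.act_id[OF x(1)] by simp
  have "is_ops P [t] [cs] [x]" using x(1) by (simp add: is_ops_def)
  then show "gamma Q t [t] [cs] (opunit Q t) [y] = y"
    using gamma_quotient[OF P.opunit_op[OF t(1)], of "[cs]" "[x]"] P.unit_left[OF x(1)] t
    by (simp add: x opunit_quotient)
  have "is_ops P cs (map (\<lambda>c. [c]) cs) (map (opunit P) cs)"
    using t P.opunit_op by (auto simp: is_ops_def subset_iff)
  moreover have "map (opunit Q) cs = map q (map (opunit P) cs)"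
    using t by (auto simp: opunit_quotient)
  ultimately show "gamma Q t cs (map (\<lambda>c. [c]) cs) y (map (opunit Q) cs) = y"
    using gamma_quotient[OF x(1)] P.unit_right[OF x(1)] x(2) by (simp del: map_map)
qed (simp add: colors_quotient opunit_quotient quotient_op P.opunit_op)

lemma projection_hom:
  assumes \<pi>: "hdom \<pi> = P" "hcod \<pi> = Q" "cmap \<pi> = restrict id (colors P)"
    "omap \<pi> = (\<lambda>t cs x. if is_op P t cs x then q x else undefined)"
  shows "operad_hom \<pi>"
proof
  have id: "cmap \<pi> c = c" if "c \<in> colors P" for c using that \<pi> by simp
  have ids: "map (cmap \<pi>) cs = cs" if "set cs \<subseteq> colors P" for cs
    using that id by (intro map_idI) auto
  have op: "t \<in> colors P" "set cs \<subseteq> colors P" if "is_op P t cs x" for t cs x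
    using that by (auto simp: is_op_def)
  show "cmap \<pi> \<in> colors (hdom \<pi>) \<rightarrow>\<^sub>E colors (hcod \<pi>)" using \<pi> colors_quotient by simp
  show "omap \<pi> c [c] (opunit (hdom \<pi>) c) = opunit (hcod \<pi>) (cmap \<pi> c)" if "c \<in> colors (hdom \<pi>)" for c
    using that \<pi> P.opunit_op by (simp add: opunit_quotient)
  show "is_op (hcod \<pi>) (cmap \<pi> t) (map (cmap \<pi>) cs) (omap \<pi> t cs x)" if "is_op (hdom \<pi>) t cs x" for t cs x
    using that \<pi>(1,2,4) id ids op[of t cs x] by (simp add: quotient_op)
  show "omap \<pi> t (permute_list \<sigma> cs) (act (hdom \<pi>) t cs \<sigma> x) =
      act (hcod \<pi>) (cmap \<pi> t) (map (cmap \<pi>) cs) \<sigma> (omap \<pi> t cs x)"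
    if "is_op (hdom \<pi>) t cs x" "\<sigma> permutes {..<length cs}" for t cs x \<sigma>
    using that \<pi>(1,2,4) id ids op[of t cs x] P.act_op[of t cs x \<sigma>] by (simp add: act_quotient)
  fix t as bss x ys assume x: "is_op (hdom \<pi>) t as x" and ys: "is_ops (hdom \<pi>) as bss ys"
  have "map (map (cmap \<pi>)) bss = bss"
    using is_ops_colors(2)[OF ys] \<pi>(1) by (intro map_map_idI id) auto
  moreover have "map (\<lambda>i. omap \<pi> (as ! i) (bss ! i) (ys ! i)) [0..<length as] = map q ys"
    using is_opsD[OF ys] \<pi>(1,4) by (intro nth_equalityI) auto
  ultimately show "omap \<pi> t (concat bss) (gamma (hdom \<pi>) t as bss x ys) =
      gamma (hcod \<pi>) (cmap \<pi> t) (map (cmap \<pi>) as) (map (map (cmap \<pi>)) bss) (omap \<pi> t as x)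
        (map (\<lambda>i. omap \<pi> (as ! i) (bss ! i) (ys ! i)) [0..<length as])"
    using x ys \<pi>(1,2,4) id ids op[of t as x] P.gamma_op[of t as x bss ys] by (simp add: gamma_quotient)
qed (use assms in simp)

text \<open>The factorization property of the quotient in the form of a check: \<psi> is given
  beforehand, and its agreement with \<phi> on preimages takes the place of a well-definedness
  argument.\<close>

lemma descended_hom:
  assumes "operad_hom \<phi>" "hdom \<phi> = P"
    and \<psi>: "hdom \<psi> = Q" "hcod \<psi> = hcod \<phi>" "cmap \<psi> = cmap \<phi>"
    and desc: "\<And>t cs x. is_op P t cs x \<Longrightarrow> omap \<psi> t cs (q x) = omap \<phi> t cs x"
    and ext: "\<And>t cs y. \<not> is_op Q t cs y \<Longrightarrow> omap \<psi> t cs y = undefined"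
  shows "operad_hom \<psi>"
proof -
  interpret \<phi>: operad_hom \<phi> by fact
  show ?thesis
  proof
    show "cmap \<psi> \<in> colors (hdom \<psi>) \<rightarrow>\<^sub>E colors (hcod \<psi>)"
      using \<phi>.cmap_ext \<psi> assms(2) colors_quotient by simp
    show "omap \<psi> t cs y = undefined" if "\<not> is_op (hdom \<psi>) t cs y" for t cs y
      using that \<psi> ext by simp
    show "omap \<psi> c [c] (opunit (hdom \<psi>) c) = opunit (hcod \<psi>) (cmap \<psi> c)" if "c \<in> colors (hdom \<psi>)" for c
      using that \<psi> \<phi>.omap_opunit[of c] P.opunit_op[of c] assms(2)
      by (simp add: colors_quotient opunit_quotient desc)
  next
    fix t cs y assume "is_op (hdom \<psi>) t cs y"
    then have "is_op Q t cs y" using \<psi> by simp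
    then obtain x where x: "is_op P t cs x" "y = q x" by (rule lift_op)
    then show "is_op (hcod \<psi>) (cmap \<psi> t) (map (cmap \<psi>) cs) (omap \<psi> t cs y)"
      using \<phi>.omap_op \<psi> assms(2) by (simp add: desc)
    fix \<sigma> assume "\<sigma> permutes {..<length cs}"
    then show "omap \<psi> t (permute_list \<sigma> cs) (act (hdom \<psi>) t cs \<sigma> y) =
        act (hcod \<psi>) (cmap \<psi> t) (map (cmap \<psi>) cs) \<sigma> (omap \<psi> t cs y)"
      using x \<phi>.omap_act \<psi> assms(2) P.act_op[of t cs x \<sigma>] by (simp add: desc act_quotient)
  next
    fix t as bss y ys assume "is_op (hdom \<psi>) t as y" "is_ops (hdom \<psi>) as bss ys"
    then obtain x xs where x: "is_op P t as x" "y = q x" and xs: "is_ops P as bss xs" "ys = map q xs"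
      using \<psi>(1) by (metis lift_op lift_ops)
    have ys: "map (\<lambda>i. omap \<psi> (as ! i) (bss ! i) (ys ! i)) [0..<length as] =
        map (\<lambda>i. omap \<phi> (as ! i) (bss ! i) (xs ! i)) [0..<length as]"
      using is_opsD[OF xs(1)] by (simp add: xs(2) desc)
    show "omap \<psi> t (concat bss) (gamma (hdom \<psi>) t as bss y ys) =
        gamma (hcod \<psi>) (cmap \<psi> t) (map (cmap \<psi>) as) (map (map (cmap \<psi>)) bss) (omap \<psi> t as y)
          (map (\<lambda>i. omap \<psi> (as ! i) (bss ! i) (ys ! i)) [0..<length as])"
      unfolding ys using x xs \<phi>.omap_gamma[of t as x bss xs] \<psi> assms(2) P.gamma_op[OF x(1) xs(1)]
      by (simp add: desc gamma_quotient)
  qed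
qed

end

section \<open>The operad of a category\<close>

lemma cat_operad_simps [simp]:
  "colors (cat_operad C) = Obj C"
  "act (cat_operad C) t cs \<sigma> (Word w) = Word (word_act \<sigma> w)"
  "gamma (cat_operad C) t as bss (Word w) (map Word vs) = Word (word_gamma C w vs)"
  "opunit (cat_operad C) = (\<lambda>c. Word (id, [idn C c]))"
  by (simp_all add: cat_operad_def o_def)

lemma is_op_cat_operad:
  "is_op (cat_operad C) t cs x \<longleftrightarrow> t \<in> Obj C \<and> set cs \<subseteq> Obj C \<and> (\<exists>w\<in>words C t cs. x = Word w)"
  by (auto simp: is_op_def cat_operad_def)

lemma is_ops_cat_operad:
  assumes "is_ops (cat_operad C) as bss ys"
  obtains vs where "ys = map Word vs" "length bss = length as" "length vs = length as"
    "\<And>i. i < length as \<Longrightarrow> vs ! i \<in> words C (as ! i) (bss ! i)"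
proof
  note ops = is_opsD[OF assms]
  have "ys ! i = Word (the_word (ys ! i)) \<and> the_word (ys ! i) \<in> words C (as ! i) (bss ! i)"
    if "i < length as" for i
    using ops(3)[OF that] by (auto simp: is_op_cat_operad)
  then show "ys = map Word (map the_word ys)"
    "\<And>i. i < length as \<Longrightarrow> map the_word ys ! i \<in> words C (as ! i) (bss ! i)"
    using ops(2) by (auto intro: nth_equalityI)
qed (use is_opsD[OF assms] in simp_all)

lemma operad_cat_operad:
  assumes "category C"
  shows "operad (cat_operad C)"
proof
  interpret category C by fact
  fix t cs x \<sigma> assume "is_op (cat_operad C) t cs x" and \<sigma>: "\<sigma> permutes {..<length cs}"
  then obtain w where x: "x = Word w" and w: "w \<in> words C t cs" and cs: "t \<in> Obj C" "set cs \<subseteq> Obj C"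
    by (auto simp: is_op_cat_operad)
  have ar: "arity w = length cs" using w by (simp add: words_iff)
  show "is_op (cat_operad C) t (permute_list \<sigma> cs) (act (cat_operad C) t cs \<sigma> x)"
    using word_act_words[OF w \<sigma>] cs \<sigma> by (simp add: is_op_cat_operad x)
  show "act (cat_operad C) t (permute_list \<sigma> cs) \<sigma>' (act (cat_operad C) t cs \<sigma> x) =
      act (cat_operad C) t cs (\<sigma> \<circ> \<sigma>') x" if "\<sigma>' permutes {..<length cs}" for \<sigma>'
    using that ar by (simp add: x word_act_def comp_assoc permute_list_compose)
next
  interpret category C by fact
  show "is_op (cat_operad C) c [c] (opunit (cat_operad C) c)" if "c \<in> colors (cat_operad C)" for c
    using that by (simp add: is_op_cat_operad words_def permutes_id idn_Arr src_idn tgt_idn)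
next
  interpret category C by fact
  fix t cs x assume "is_op (cat_operad C) t cs x"
  then obtain w where x: "x = Word w" and w: "w \<in> words C t cs" by (auto simp: is_op_cat_operad)
  have wf: "wf_word w" "arity w = length cs"
    and f: "\<And>i. i < length cs \<Longrightarrow> snd w ! i \<in> Arr C \<and> src C (snd w ! i) = cs ! i \<and> tgt C (snd w ! i) = t"
    using w by (auto simp: words_iff)
  show "act (cat_operad C) t cs id x = x" by (simp add: x word_act_def)
  have "cmp C (idn C t) (snd w ! r) = snd w ! r" if "r < arity w" for r
    using f[of r] cmp_idn_left[of "snd w ! r"] wf(2) that by simp
  then show "gamma (cat_operad C) t [t] [cs] (opunit (cat_operad C) t) [x] = x"
    using word_gamma_unit_left[of w C "idn C t"] wf(1) cat_operad_simps(3)[of C t "[t]" "[cs]" _ "[w]"]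
    by (simp add: x)
  have "cmp C (snd w ! i) (map (idn C) cs ! i) = snd w ! i" if "i < arity w" for i
    using f[of i] cmp_idn_right[of "snd w ! i"] wf(2) that by simp
  then show "gamma (cat_operad C) t cs (map (\<lambda>c. [c]) cs) x (map (opunit (cat_operad C)) cs) = x"
    using word_gamma_unit_right[of w "map (idn C) cs" C] wf
      cat_operad_simps(3)[of C t cs "map (\<lambda>c. [c]) cs" w "map (\<lambda>c. (id, [idn C c])) cs"]
    by (simp add: x o_def)
next
  interpret category C by fact
  fix t as x bss ys assume ops: "is_op (cat_operad C) t as x" "is_ops (cat_operad C) as bss ys"
  obtain w where x: "x = Word w" and w: "w \<in> words C t as" and as: "t \<in> Obj C" "set as \<subseteq> Obj C"
    using ops(1) by (auto simp: is_op_cat_operad)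
  obtain vs where ys: "ys = map Word vs" and len: "length bss = length as" "length vs = length as"
    and vs: "\<And>i. i < length as \<Longrightarrow> vs ! i \<in> words C (as ! i) (bss ! i)"
    using ops(2) by (rule is_ops_cat_operad) blast
  note fam = word_gamma_words[OF assms w len vs]
  have ar: "arity w = length as" "\<And>i. i < length as \<Longrightarrow> arity (vs ! i) = length (bss ! i)"
    using w vs by (auto simp: words_iff)
  have ks: "map arity vs = map length bss" using len ar by (intro nth_equalityI) auto
  show "is_op (cat_operad C) t (concat bss) (gamma (cat_operad C) t as bss x ys)"
    using fam(2) as is_ops_colors(2)[OF ops(2)] by (auto simp: is_op_cat_operad x ys)
  show "gamma (cat_operad C) t (permute_list \<sigma> as) (permute_list \<sigma> bss) (act (cat_operad C) t as \<sigma> x)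
        (permute_list \<sigma> ys) =
      act (cat_operad C) t (concat bss) (block_perm \<sigma> (permute_list \<sigma> (map length bss)))
        (gamma (cat_operad C) t as bss x ys)" if "\<sigma> permutes {..<length as}" for \<sigma>
    using word_gamma_act_outer[OF fam(1), of \<sigma> C] that ar len permute_list_map[of \<sigma> vs Word]
    by (simp add: x ys ks)
  show "gamma (cat_operad C) t as (map2 permute_list \<tau>s bss) x
        (map (\<lambda>i. act (cat_operad C) (as ! i) (bss ! i) (\<tau>s ! i) (ys ! i)) [0..<length as]) =
      act (cat_operad C) t (concat bss) (sum_perm (map length bss) \<tau>s) (gamma (cat_operad C) t as bss x ys)"
    if \<tau>s: "length \<tau>s = length as" "\<And>i. i < length as \<Longrightarrow> \<tau>s ! i permutes {..<length (bss ! i)}" for \<tau>s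
  proof -
    have "map (\<lambda>i. act (cat_operad C) (as ! i) (bss ! i) (\<tau>s ! i) (ys ! i)) [0..<length as] =
        map Word (map2 word_act \<tau>s vs)"
      using len \<tau>s(1) by (intro nth_equalityI) (auto simp: ys)
    then show ?thesis
      using word_gamma_act_inner[OF fam(1), of \<tau>s C] \<tau>s len ar
      by (simp add: x ys ks del: map_map)
  qed
  fix csss zss assume l: "length csss = length as" "length zss = length as"
    and zss: "\<And>i. i < length as \<Longrightarrow> is_ops (cat_operad C) (bss ! i) (csss ! i) (zss ! i)"
  \<comment> \<open>All operations here are of the form \<open>Word w\<close>, so the selector
    recovers the words of all inner families uniformly, without a choice for each index.\<close>
  define uss where "uss = map (map the_word) zss"
  have uss: "zss ! i = map Word (uss ! i) \<and> length (csss ! i) = length (bss ! i) \<and>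
      length (uss ! i) = length (bss ! i) \<and>
      (\<forall>r<length (bss ! i). uss ! i ! r \<in> words C (bss ! i ! r) (csss ! i ! r))"
    if "i < length as" for i
    using zss[OF that] by (rule is_ops_cat_operad) (use that l in \<open>auto simp: uss_def o_def\<close>)
  have uss_len: "length uss = length vs" using l len by (simp add: uss_def)
  have zss_eq: "zss = map (map Word) uss" using uss l by (intro nth_equalityI) (auto simp: uss_def)
  have "word_gamma C (word_gamma C w vs) (concat uss) = word_gamma C w (map2 (word_gamma C) vs uss)"
  proof (rule word_gamma_assoc[OF fam(1) uss_len])
    show "word_family (vs ! i) (uss ! i)" if "i < length vs" for i
      using word_gamma_words(1)[OF assms vs, of i "csss ! i" "uss ! i"] uss[of i] that len by simp
    fix i r q assume "i < length vs" "r < arity (vs ! i)" "q < arity (uss ! i ! r)"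
    then show "cmp C (cmp C (snd w ! i) (snd (vs ! i) ! r)) (snd (uss ! i ! r) ! q) =
        cmp C (snd w ! i) (cmp C (snd (vs ! i) ! r) (snd (uss ! i ! r) ! q))"
      using w vs[of i] uss[of i] len ar by (intro cmp_assoc) (auto simp: words_iff)
  qed
  moreover have "map (\<lambda>i. gamma (cat_operad C) (as ! i) (bss ! i) (csss ! i) (ys ! i) (zss ! i))
      [0..<length as] = map Word (map2 (word_gamma C) vs uss)"
    using len uss_len by (intro nth_equalityI) (auto simp: ys zss_eq)
  moreover have "concat zss = map Word (concat uss)" by (simp add: zss_eq map_concat)
  ultimately show "gamma (cat_operad C) t (concat bss) (concat csss)
        (gamma (cat_operad C) t as bss x ys) (concat zss) =
      gamma (cat_operad C) t as (map concat csss) x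
        (map (\<lambda>i. gamma (cat_operad C) (as ! i) (bss ! i) (csss ! i) (ys ! i) (zss ! i)) [0..<length as])"
    by (simp add: x ys del: map_map)
qed

section \<open>The operad of an orthogonal category\<close>

lemma the_class_orth_class: "the_class (orth_class Cb w) = {u. orth_eq Cb w u}"
  by (simp add: orth_class_def)

lemma is_op_orth_operad:
  "is_op (orth_operad Cb) t cs y \<longleftrightarrow> t \<in> Obj (ucat Cb) \<and> set cs \<subseteq> Obj (ucat Cb) \<and>
    (\<exists>w\<in>words (ucat Cb) t cs. y = orth_class Cb w)"
  by (auto simp: is_op_def orth_operad_def)

text \<open>A structure map of \<open>orth_operad\<close> collects all words equivalent to some
  result on representatives. Reflexivity shows that this set contains the class of the result on the
  given representatives; compatibility and transitivity show that it contains nothing else.\<close>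

lemma orth_operad_quotient:
  assumes Cb: "orth_category Cb"
  shows "operad_quotient (cat_operad (ucat Cb)) (orth_operad Cb) (\<lambda>x. orth_class Cb (the_word x))"
proof -
  interpret orth_category Cb by (rule Cb)
  interpret operad "cat_operad (ucat Cb)" by (rule operad_cat_operad[OF category_axioms])
  show ?thesis
  proof
    show "colors (orth_operad Cb) = colors (cat_operad (ucat Cb))" by (simp add: orth_operad_def)
    show "is_op (orth_operad Cb) t cs y \<longleftrightarrow>
        (\<exists>x. is_op (cat_operad (ucat Cb)) t cs x \<and> y = orth_class Cb (the_word x))" for t cs y
      unfolding is_op_cat_operad is_op_orth_operad by (metis operation.sel(1))
    show "opunit (orth_operad Cb) c = orth_class Cb (the_word (opunit (cat_operad (ucat Cb)) c))" for c
      by (simp add: orth_operad_def)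
  next
    fix t cs x \<sigma> assume "is_op (cat_operad (ucat Cb)) t cs x" and \<sigma>: "\<sigma> permutes {..<length cs}"
    then obtain w where x: "x = Word w" and w: "w \<in> words (ucat Cb) t cs"
      by (auto simp: is_op_cat_operad)
    have wf: "wf_word w" and \<sigma>': "\<sigma> permutes {..<arity w}" using w \<sigma> by (auto simp: words_iff)
    have "orth_eq Cb w w" using wf by (simp add: orth_eq_refl wf_word_def)
    then have "(\<exists>v. orth_eq Cb w v \<and> orth_eq Cb (word_act \<sigma> v) u) \<longleftrightarrow> orth_eq Cb (word_act \<sigma> w) u" for u
      using orth_eq_act[OF Cb _ \<sigma>'] orth_eq_trans by blast
    then show "act (orth_operad Cb) t cs \<sigma> (orth_class Cb (the_word x)) =
        orth_class Cb (the_word (act (cat_operad (ucat Cb)) t cs \<sigma> x))"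
      by (simp add: x orth_operad_def the_class_orth_class) (simp add: orth_class_def)
  next
    fix t as x bss ys
    assume ops: "is_op (cat_operad (ucat Cb)) t as x" "is_ops (cat_operad (ucat Cb)) as bss ys"
    obtain w where x: "x = Word w" and w: "w \<in> words (ucat Cb) t as"
      using ops(1) by (auto simp: is_op_cat_operad)
    obtain vs where ys: "ys = map Word vs" and len: "length bss = length as" "length vs = length as"
      and vs: "\<And>i. i < length as \<Longrightarrow> vs ! i \<in> words (ucat Cb) (as ! i) (bss ! i)"
      using ops(2) by (rule is_ops_cat_operad) blast
    have refl: "orth_eq Cb w w" "list_all2 (orth_eq Cb) vs vs"
      using w vs len by (auto simp: list_all2_conv_all_nth words_iff wf_word_def intro!: orth_eq_refl)
    have all2: "list_all2 (\<lambda>v y. v \<in> the_class y) us (map (orth_class Cb) vs) \<longleftrightarrow>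
        list_all2 (orth_eq Cb) vs us" for us
      by (auto simp: list_all2_conv_all_nth the_class_orth_class)
    have "(\<exists>v. orth_eq Cb w v \<and> (\<exists>us. list_all2 (orth_eq Cb) vs us \<and>
        orth_eq Cb (word_gamma (ucat Cb) v us) u)) \<longleftrightarrow> orth_eq Cb (word_gamma (ucat Cb) w vs) u" for u
      using orth_eq_gamma[OF Cb w len vs] orth_eq_trans refl by blast
    then show "gamma (orth_operad Cb) t as bss (orth_class Cb (the_word x))
        (map (\<lambda>x. orth_class Cb (the_word x)) ys) =
      orth_class Cb (the_word (gamma (cat_operad (ucat Cb)) t as bss x ys))"
      by (simp add: x ys orth_operad_def the_class_orth_class o_def all2) (simp add: orth_class_def)
  qed
qed

lemma operad_orth_operad: "orth_category Cb \<Longrightarrow> operad (orth_operad Cb)"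
  by (rule operad_quotient.operad_quotient[OF orth_operad_quotient])

lemma orth_proj_simps:
  "hdom (orth_proj Cb) = cat_operad (ucat Cb)" "hcod (orth_proj Cb) = orth_operad Cb"
  "c \<in> Obj (ucat Cb) \<Longrightarrow> cmap (orth_proj Cb) c = c"
  "set cs \<subseteq> Obj (ucat Cb) \<Longrightarrow> map (cmap (orth_proj Cb)) cs = cs"
  "is_op (cat_operad (ucat Cb)) t cs (Word w) \<Longrightarrow> omap (orth_proj Cb) t cs (Word w) = orth_class Cb w"
  by (auto simp: orth_proj_def intro!: map_idI)

lemma orth_proj_hom: "orth_category Cb \<Longrightarrow> operad_hom (orth_proj Cb)"
  by (rule operad_quotient.projection_hom[OF orth_operad_quotient]) (simp_all add: orth_proj_def)

section \<open>Operad morphisms induced by functors\<close>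

definition word_map :: "('m \<Rightarrow> 'n) \<Rightarrow> 'm word \<Rightarrow> 'n word" where
  "word_map h w = (fst w, map h (snd w))"

definition cat_operad_map ::
  "('a, 'f, 'b, 'g) functr \<Rightarrow> ('a, 'f operation, 'b, 'g operation) operad_hom" where
  "cat_operad_map F = \<lparr>hdom = cat_operad (fdom F), hcod = cat_operad (fcod F), cmap = fobj F,
     omap = (\<lambda>t cs x. if is_op (cat_operad (fdom F)) t cs x
       then Word (word_map (farr F) (the_word x)) else undefined)\<rparr>"

text \<open>Like the structure maps of the quotient, the map on operations takes all representatives
  at once and so avoids choosing one.\<close>

definition orth_operad_map ::
  "('o, 'm) orth_functor \<Rightarrow> ('o, 'm operation, 'o, 'm operation) operad_hom" where
  "orth_operad_map F = \<lparr>hdom = orth_operad (odom F), hcod = orth_operad (ocod F),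
     cmap = fobj (ufun F),
     omap = (\<lambda>t cs y. if is_op (orth_operad (odom F)) t cs y
       then Class {u. \<exists>v\<in>the_class y. orth_eq (ocod F) (word_map (farr (ufun F)) v) u}
       else undefined)\<rparr>"

lemma cat_operad_map_simps:
  "hdom (cat_operad_map F) = cat_operad (fdom F)" "hcod (cat_operad_map F) = cat_operad (fcod F)"
  "cmap (cat_operad_map F) = fobj F"
  "is_op (cat_operad (fdom F)) t cs (Word w) \<Longrightarrow>
    omap (cat_operad_map F) t cs (Word w) = Word (word_map (farr F) w)"
  by (simp_all add: cat_operad_map_def)

context is_functor
begin

lemma farr_Arr: "f \<in> Arr (fdom F) \<Longrightarrow> farr F f \<in> Arr (fcod F)"
  using farr_ext by (auto simp: PiE_def)

lemma fobj_Obj: "c \<in> Obj (fdom F) \<Longrightarrow> fobj F c \<in> Obj (fcod F)"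
  using fobj_ext by (auto simp: PiE_def)

lemma word_map_words:
  assumes "w \<in> words (fdom F) t cs"
  shows "word_map (farr F) w \<in> words (fcod F) (fobj F t) (map (fobj F) cs)"
  using assms farr_Arr farr_src farr_tgt by (auto simp: words_def word_map_def)

text \<open>A functor changes neither arities nor permutations, so the permutation parts are given
  by literally the same formula; the arrows agree by functoriality, the colors ensuring that they
  are composable.\<close>

lemma word_map_gamma:
  assumes w: "w \<in> words (fdom F) t as" and len: "length bss = length as" "length vs = length as"
    and vs: "\<And>i. i < length as \<Longrightarrow> vs ! i \<in> words (fdom F) (as ! i) (bss ! i)"
  shows "word_map (farr F) (word_gamma (fdom F) w vs) =
    word_gamma (fcod F) (word_map (farr F) w) (map (word_map (farr F)) vs)"
proof -
  let ?m = "word_map (farr F)"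
  have "map (map (farr F)) (map2 (\<lambda>f v. map (cmp (fdom F) f) (snd v)) (snd w) vs) =
      map2 (\<lambda>f v. map (cmp (fcod F) f) (snd v)) (snd (?m w)) (map ?m vs)"
  proof (rule nth_equalityI)
    fix i assume "i < length (map (map (farr F)) (map2 (\<lambda>f v. map (cmp (fdom F) f) (snd v)) (snd w) vs))"
    then have i: "i < length as" "i < length (snd w)" "i < length vs" using len by auto
    have f: "snd w ! i \<in> Arr (fdom F)" "src (fdom F) (snd w ! i) = as ! i"
      using w i by (auto simp: words_iff)
    have "\<forall>g\<in>set (snd (vs ! i)). g \<in> Arr (fdom F) \<and> tgt (fdom F) g = as ! i"
      using vs[OF i(1)] by (auto simp: words_iff in_set_conv_nth)
    then show "map (map (farr F)) (map2 (\<lambda>f v. map (cmp (fdom F) f) (snd v)) (snd w) vs) ! i =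
        map2 (\<lambda>f v. map (cmp (fcod F) f) (snd v)) (snd (?m w)) (map ?m vs) ! i"
      using i f by (auto simp: word_map_def farr_cmp)
  qed (simp add: word_map_def)
  then show ?thesis
    by (simp add: word_gamma_def word_map_def[of _ "(_, _)"] map_concat Let_def del: map_map)
      (simp add: word_map_def o_def)
qed

lemma cat_operad_map_hom: "operad_hom (cat_operad_map F)"
proof
  let ?\<phi> = "cat_operad_map F"
  show "cmap ?\<phi> \<in> colors (hdom ?\<phi>) \<rightarrow>\<^sub>E colors (hcod ?\<phi>)"
    using fobj_ext by (simp add: cat_operad_map_simps)
  show "omap ?\<phi> t cs x = undefined" if "\<not> is_op (hdom ?\<phi>) t cs x" for t cs x
    using that by (simp add: cat_operad_map_def)
  show "omap ?\<phi> c [c] (opunit (hdom ?\<phi>) c) = opunit (hcod ?\<phi>) (cmap ?\<phi> c)"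
    if "c \<in> colors (hdom ?\<phi>)" for c
    using that operad.opunit_op[OF operad_cat_operad[OF dom.category_axioms], of c]
    by (simp add: cat_operad_map_simps word_map_def farr_idn)
next
  let ?\<phi> = "cat_operad_map F"
  fix t cs x assume x: "is_op (hdom ?\<phi>) t cs x"
  then obtain w where w: "x = Word w" "w \<in> words (fdom F) t cs" "t \<in> Obj (fdom F)" "set cs \<subseteq> Obj (fdom F)"
    by (auto simp: is_op_cat_operad cat_operad_map_simps)
  show "is_op (hcod ?\<phi>) (cmap ?\<phi> t) (map (cmap ?\<phi>) cs) (omap ?\<phi> t cs x)"
    using w x word_map_words fobj_Obj by (auto simp: cat_operad_map_simps is_op_cat_operad)
  fix \<sigma> assume \<sigma>: "\<sigma> permutes {..<length cs}"
  have "is_op (cat_operad (fdom F)) t (permute_list \<sigma> cs) (Word (word_act \<sigma> w))"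
    using word_act_words[OF w(2) \<sigma>] w \<sigma> by (auto simp: is_op_cat_operad)
  moreover have "arity w = length cs" using w by (simp add: words_iff)
  ultimately show "omap ?\<phi> t (permute_list \<sigma> cs) (act (hdom ?\<phi>) t cs \<sigma> x) =
      act (hcod ?\<phi>) (cmap ?\<phi> t) (map (cmap ?\<phi>) cs) \<sigma> (omap ?\<phi> t cs x)"
    using x \<sigma> by (simp add: w(1) cat_operad_map_simps word_map_def word_act_def permute_list_map)
next
  let ?\<phi> = "cat_operad_map F"
  fix t as bss x ys assume ops: "is_op (hdom ?\<phi>) t as x" "is_ops (hdom ?\<phi>) as bss ys"
  obtain w where x: "x = Word w" and w: "w \<in> words (fdom F) t as"
    using ops(1) by (auto simp: is_op_cat_operad cat_operad_map_simps)
  obtain vs where ys: "ys = map Word vs" and len: "length bss = length as" "length vs = length as"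
    and vs: "\<And>i. i < length as \<Longrightarrow> vs ! i \<in> words (fdom F) (as ! i) (bss ! i)"
    using ops(2)[unfolded cat_operad_map_simps] by (rule is_ops_cat_operad) blast
  have "map (\<lambda>i. omap ?\<phi> (as ! i) (bss ! i) (ys ! i)) [0..<length as] =
      map Word (map (word_map (farr F)) vs)"
    using is_opsD(3)[OF ops(2)] len by (intro nth_equalityI) (auto simp: ys cat_operad_map_simps)
  moreover have "is_op (cat_operad (fdom F)) t (concat bss) (Word (word_gamma (fdom F) w vs))"
    using operad.gamma_op[OF operad_cat_operad[OF dom.category_axioms], of t as x bss ys] ops
    by (simp add: x ys cat_operad_map_simps)
  ultimately show "omap ?\<phi> t (concat bss) (gamma (hdom ?\<phi>) t as bss x ys) =
      gamma (hcod ?\<phi>) (cmap ?\<phi> t) (map (cmap ?\<phi>) as) (map (map (cmap ?\<phi>)) bss) (omap ?\<phi> t as x)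
        (map (\<lambda>i. omap ?\<phi> (as ! i) (bss ! i) (ys ! i)) [0..<length as])"
    using ops(1) word_map_gamma[OF w len vs]
    by (simp add: x ys cat_operad_map_simps del: map_map)
qed

end

context is_orth_functor
begin

lemma orth_eq_word_map:
  assumes "w \<in> words (ucat (odom F)) t cs" "orth_eq (odom F) w w'"
  shows "orth_eq (ocod F) (word_map (farr (ufun F)) w) (word_map (farr (ufun F)) w')"
  using assms preserves_orth
  by (auto simp: orth_eq_iff[OF odom.orth_category_axioms] orth_eq_iff[OF ocod.orth_category_axioms]
      word_map_def wf_word_def)

lemma orth_operad_map_simps:
  "hdom (orth_operad_map F) = orth_operad (odom F)" "hcod (orth_operad_map F) = orth_operad (ocod F)"
  "cmap (orth_operad_map F) = fobj (ufun F)"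
  "is_op (cat_operad (ucat (odom F))) t cs (Word w) \<Longrightarrow>
    omap (orth_operad_map F) t cs (orth_class (odom F) w) =
      orth_class (ocod F) (word_map (farr (ufun F)) w)"
proof -
  assume "is_op (cat_operad (ucat (odom F))) t cs (Word w)"
  then have w: "w \<in> words (ucat (odom F)) t cs" "t \<in> Obj (ucat (odom F))" "set cs \<subseteq> Obj (ucat (odom F))"
    by (auto simp: is_op_cat_operad)
  have "orth_eq (odom F) w w" using w by (auto simp: words_iff wf_word_def intro!: orth_eq_refl)
  \<comment> \<open>Any representative has an image equivalent to that of \<open>w\<close>, and
    \<open>w\<close> is itself a representative, so the union over representatives is a single
    class.\<close>
  then have "(\<exists>v. orth_eq (odom F) w v \<and> orth_eq (ocod F) (word_map (farr (ufun F)) v) u) \<longleftrightarrow>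
      orth_eq (ocod F) (word_map (farr (ufun F)) w) u" for u
    using orth_eq_word_map[OF w(1)] orth_eq_trans by blast
  then show "omap (orth_operad_map F) t cs (orth_class (odom F) w) =
      orth_class (ocod F) (word_map (farr (ufun F)) w)"
    using w by (auto simp: orth_operad_map_def is_op_orth_operad the_class_orth_class)
      (auto simp: orth_class_def)
qed (simp_all add: orth_operad_map_def)

lemma is_op_word_map:
  assumes "is_op (cat_operad (ucat (odom F))) t cs (Word w)"
  shows "is_op (cat_operad (ucat (ocod F))) (fobj (ufun F) t) (map (fobj (ufun F)) cs)
    (Word (word_map (farr (ufun F)) w))"
  using assms word_map_words fobj_Obj by (auto simp: is_op_cat_operad fdom_ufun fcod_ufun)

lemma orth_proj_comp_map_simps:
  "hdom (hom_comp (orth_proj (ocod F)) (cat_operad_map (ufun F))) = cat_operad (ucat (odom F))"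
  "hcod (hom_comp (orth_proj (ocod F)) (cat_operad_map (ufun F))) = orth_operad (ocod F)"
  "cmap (hom_comp (orth_proj (ocod F)) (cat_operad_map (ufun F))) = fobj (ufun F)"
  "is_op (cat_operad (ucat (odom F))) t cs (Word w) \<Longrightarrow>
    omap (hom_comp (orth_proj (ocod F)) (cat_operad_map (ufun F))) t cs (Word w) =
      orth_class (ocod F) (word_map (farr (ufun F)) w)"
proof -
  let ?\<phi> = "hom_comp (orth_proj (ocod F)) (cat_operad_map (ufun F))"
  show "cmap ?\<phi> = fobj (ufun F)"
  proof
    fix c show "cmap ?\<phi> c = fobj (ufun F) c"
    proof (cases "c \<in> Obj (fdom (ufun F))")
      case True
      then show ?thesis
        using fobj_Obj by (simp add: hom_comp_simps cat_operad_map_simps orth_proj_simps fcod_ufun)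
    \<comment> \<open>Off the objects of the domain, the composite and the object map of the functor
      are both \<open>undefined\<close>.\<close>
    next
      case False
      then show ?thesis
        using fobj_ext by (auto simp: hom_comp_def compose_def cat_operad_map_simps PiE_def extensional_def)
    qed
  qed
  show "omap ?\<phi> t cs (Word w) = orth_class (ocod F) (word_map (farr (ufun F)) w)"
    if "is_op (cat_operad (ucat (odom F))) t cs (Word w)"
    using that is_op_word_map[OF that]
    by (simp add: hom_comp_simps cat_operad_map_simps orth_proj_simps fdom_ufun)
qed (simp_all add: hom_comp_simps cat_operad_map_simps orth_proj_simps fdom_ufun)

lemma orth_operad_map_hom: "operad_hom (orth_operad_map F)"
proof (rule operad_quotient.descended_hom[OF orth_operad_quotient[OF odom.orth_category_axioms]])
  show "operad_hom (hom_comp (orth_proj (ocod F)) (cat_operad_map (ufun F)))"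
    using orth_proj_hom[OF ocod.orth_category_axioms] cat_operad_map_hom operad_cat_operad[OF dom.category_axioms]
    by (intro hom_comp_hom) (simp_all add: cat_operad_map_simps orth_proj_simps fcod_ufun)
  show "omap (orth_operad_map F) t cs (orth_class (odom F) (the_word x)) =
      omap (hom_comp (orth_proj (ocod F)) (cat_operad_map (ufun F))) t cs x"
    if op: "is_op (cat_operad (ucat (odom F))) t cs x" for t cs x
  proof -
    obtain w where "x = Word w" using op by (auto simp: is_op_cat_operad)
    then show ?thesis using op by (simp add: orth_operad_map_simps orth_proj_comp_map_simps)
  qed
  show "omap (orth_operad_map F) t cs y = undefined" if "\<not> is_op (orth_operad (odom F)) t cs y" for t cs y
    using that by (simp add: orth_operad_map_def)
qed (simp_all add: orth_operad_map_simps orth_proj_comp_map_simps)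

text \<open>Both composites send a word \<open>w\<close> to the class of its image under the
  functor, so the naturality square is the descent condition read as an equation of
  morphisms.\<close>

lemma orth_proj_natural:
  "hom_comp (orth_proj (ocod F)) (cat_operad_map (ufun F)) =
    hom_comp (orth_operad_map F) (orth_proj (odom F))"
proof (rule operad_hom_eqI)
  show "operad_hom (hom_comp (orth_proj (ocod F)) (cat_operad_map (ufun F)))"
    using orth_proj_hom[OF ocod.orth_category_axioms] cat_operad_map_hom operad_cat_operad[OF dom.category_axioms]
    by (intro hom_comp_hom) (simp_all add: cat_operad_map_simps orth_proj_simps fcod_ufun)
  show "operad_hom (hom_comp (orth_operad_map F) (orth_proj (odom F)))"
    using orth_proj_hom[OF odom.orth_category_axioms] orth_operad_map_hom
      operad_cat_operad[OF odom.category_axioms]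
    by (intro hom_comp_hom) (simp_all add: orth_operad_map_simps orth_proj_simps)
next
  fix t cs x assume x: "is_op (hdom (hom_comp (orth_proj (ocod F)) (cat_operad_map (ufun F)))) t cs x"
  then have x': "is_op (cat_operad (ucat (odom F))) t cs x" by (simp only: orth_proj_comp_map_simps)
  then obtain w where w: "x = Word w" "t \<in> Obj (ucat (odom F))" "set cs \<subseteq> Obj (ucat (odom F))"
    by (auto simp: is_op_cat_operad)
  have "omap (hom_comp (orth_operad_map F) (orth_proj (odom F))) t cs x =
      orth_class (ocod F) (word_map (farr (ufun F)) w)"
    using x' w by (simp add: hom_comp_simps orth_proj_simps orth_operad_map_simps)
  then show "omap (hom_comp (orth_proj (ocod F)) (cat_operad_map (ufun F))) t cs x =
      omap (hom_comp (orth_operad_map F) (orth_proj (odom F))) t cs x"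
    using x' w by (simp add: orth_proj_comp_map_simps)
qed (simp_all add: orth_proj_comp_map_simps hom_comp_simps orth_proj_simps orth_operad_map_simps
    cat_operad_map_simps fdom_ufun)

end

section \<open>The functors and the natural transformation\<close>

lemma functor_eqI:
  fixes F G :: "('a, 'f, 'b, 'g) functr"
  assumes "is_functor F" "is_functor G" "fdom F = fdom G" "fcod F = fcod G"
    and "\<And>c. c \<in> Obj (fdom F) \<Longrightarrow> fobj F c = fobj G c" "\<And>f. f \<in> Arr (fdom F) \<Longrightarrow> farr F f = farr G f"
  shows "F = G"
proof -
  interpret F: is_functor F by fact
  interpret G: is_functor G by fact
  have "fobj F = fobj G" using F.fobj_ext G.fobj_ext assms(3-5) by (intro PiE_ext) auto
  moreover have "farr F = farr G" using F.farr_ext G.farr_ext assms(3,4,6) by (intro PiE_ext) auto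
  ultimately show ?thesis using assms(3,4) by simp
qed

section \<open>Composition of functors; small categories, orthogonal categories and the forgetful
  functor\<close>

lemma functor_id_simps:
  "fdom (functor_id C) = C" "fcod (functor_id C) = C"
  "c \<in> Obj C \<Longrightarrow> fobj (functor_id C) c = c" "f \<in> Arr C \<Longrightarrow> farr (functor_id C) f = f"
  by (simp_all add: functor_id_def)

lemma functor_id_functor:
  assumes "category C"
  shows "is_functor (functor_id C)"
proof -
  interpret category C by fact
  show ?thesis
    by (intro is_functor.intro is_functor_axioms.intro)
      (simp_all add: functor_id_def category_axioms src_Obj tgt_Obj idn_Arr cmp_Arr)
qed

lemma functor_comp_simps:
  "fdom (functor_comp G F) = fdom F" "fcod (functor_comp G F) = fcod G"
  "c \<in> Obj (fdom F) \<Longrightarrow> fobj (functor_comp G F) c = fobj G (fobj F c)"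
  "f \<in> Arr (fdom F) \<Longrightarrow> farr (functor_comp G F) f = farr G (farr F f)"
  by (simp_all add: functor_comp_def compose_def)

lemma functor_comp_functor:
  assumes "is_functor F" "is_functor G" "fdom G = fcod F"
  shows "is_functor (functor_comp G F)"
proof -
  interpret F: is_functor F by fact
  interpret G: is_functor G by fact
  \<comment> \<open>The laws of \<open>G\<close> are restated over the codomain of \<open>F\<close>,
    so that they apply to the values of \<open>F\<close> as they stand.\<close>
  note G = G.fobj_Obj[unfolded assms(3)] G.farr_Arr[unfolded assms(3)]
    G.farr_src[unfolded assms(3)] G.farr_tgt[unfolded assms(3)]
    G.farr_idn[unfolded assms(3)] G.farr_cmp[unfolded assms(3)]
  show ?thesis
  proof (intro is_functor.intro is_functor_axioms.intro)
    show "fobj (functor_comp G F) \<in> Obj (fdom (functor_comp G F)) \<rightarrow>\<^sub>E Obj (fcod (functor_comp G F))"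
      using F.fobj_Obj G(1) by (auto simp: functor_comp_def compose_def)
    show "farr (functor_comp G F) \<in> Arr (fdom (functor_comp G F)) \<rightarrow>\<^sub>E Arr (fcod (functor_comp G F))"
      using F.farr_Arr G(2) by (auto simp: functor_comp_def compose_def)
  qed (simp_all add: functor_comp_simps F.dom.category_axioms G.cod.category_axioms
      F.fobj_Obj F.farr_Arr F.farr_src F.farr_tgt F.farr_idn F.farr_cmp G
      F.dom.src_Obj F.dom.tgt_Obj F.dom.idn_Arr F.dom.cmp_Arr)
qed

lemma functor_comp_assoc:
  assumes "is_functor F" "is_functor G" "is_functor H" "fdom G = fcod F" "fdom H = fcod G"
  shows "functor_comp (functor_comp H G) F = functor_comp H (functor_comp G F)"
proof -
  interpret F: is_functor F by fact
  show ?thesis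
    using assms F.fobj_Obj F.farr_Arr
    by (intro functor_eqI functor_comp_functor) (simp_all add: functor_comp_simps)
qed

lemma functor_comp_id_left:
  assumes "is_functor F"
  shows "functor_comp (functor_id (fcod F)) F = F"
proof -
  interpret F: is_functor F by fact
  show ?thesis
    using assms F.fobj_Obj F.farr_Arr F.cod.category_axioms
    by (intro functor_eqI functor_comp_functor functor_id_functor)
      (simp_all add: functor_comp_simps functor_id_simps)
qed

lemma functor_comp_id_right:
  assumes "is_functor F"
  shows "functor_comp F (functor_id (fdom F)) = F"
proof -
  interpret F: is_functor F by fact
  show ?thesis
    using assms F.dom.category_axioms
    by (intro functor_eqI functor_comp_functor functor_id_functor)
      (simp_all add: functor_comp_simps functor_id_simps)
qed

lemma category_Cat: "category (Cat :: (('o, 'm) category, ('o, 'm, 'o, 'm) functr) category)"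
  by (rule category.intro)
    (auto simp: Cat_def functor_comp_simps functor_id_simps functor_comp_assoc functor_comp_id_left
      functor_comp_id_right intro: functor_comp_functor functor_id_functor
      dest: is_functor.axioms(1) is_functor.axioms(2))

lemma orth_functor_id:
  assumes "orth_category Cb"
  shows "is_orth_functor \<lparr>odom = Cb, ocod = Cb, ufun = functor_id (ucat Cb)\<rparr>"
proof -
  interpret orth_category Cb by fact
  show ?thesis
    \<comment> \<open>The arrow map of \<open>functor_id\<close> is the identity on arrows only, so
      preservation of orthogonality relies on orthogonal pairs consisting of arrows.\<close>
    using orth_Arr
    by (intro is_orth_functor.intro is_orth_functor_axioms.intro)
      (auto simp: functor_id_simps functor_id_functor category_axioms orth_category_axioms)
qed

lemma orth_functor_comp:
  assumes "is_orth_functor F" "is_orth_functor G" "odom G = ocod F"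
  shows "is_orth_functor \<lparr>odom = odom F, ocod = ocod G, ufun = functor_comp (ufun G) (ufun F)\<rparr>"
proof -
  interpret F: is_orth_functor F by fact
  interpret G: is_orth_functor G by fact
  have "is_functor (functor_comp (ufun G) (ufun F))"
    by (rule functor_comp_functor[OF F.is_functor_axioms G.is_functor_axioms])
      (simp add: G.fdom_ufun F.fcod_ufun assms(3))
  then show ?thesis
    using F.odom.orth_Arr F.preserves_orth G.preserves_orth assms(3)
    by (intro is_orth_functor.intro is_orth_functor_axioms.intro)
      (auto simp: functor_comp_simps F.fdom_ufun G.fcod_ufun F.odom.orth_category_axioms
        G.ocod.orth_category_axioms)
qed

lemma category_OrthCat: "category (OrthCat :: (('o, 'm) orth_category, ('o, 'm) orth_functor) category)"
proof -
  have orth: "orth_category (odom F)" "orth_category (ocod F)" "is_functor (ufun F)"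
    "fdom (ufun F) = ucat (odom F)" "fcod (ufun F) = ucat (ocod F)"
    if "is_orth_functor F" for F :: "('o, 'm) orth_functor"
  proof -
    interpret is_orth_functor F by (rule that)
    show "orth_category (odom F)" "orth_category (ocod F)" "is_functor (ufun F)"
      "fdom (ufun F) = ucat (odom F)" "fcod (ufun F) = ucat (ocod F)"
      by (fact odom.orth_category_axioms ocod.orth_category_axioms is_functor_axioms fdom_ufun fcod_ufun)+
  qed
  show ?thesis
  proof (rule category.intro)
    fix F :: "('o, 'm) orth_functor" assume F: "F \<in> Arr OrthCat"
    then have "is_orth_functor F" by (simp add: OrthCat_def)
    then show "cmp OrthCat (idn OrthCat (tgt OrthCat F)) F = F" "cmp OrthCat F (idn OrthCat (src OrthCat F)) = F"
      using functor_comp_id_left[of "ufun F"] functor_comp_id_right[of "ufun F"] orth[of F]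
      by (simp_all add: OrthCat_def)
  next
    fix F G H :: "('o, 'm) orth_functor"
    assume "F \<in> Arr OrthCat" "G \<in> Arr OrthCat" "H \<in> Arr OrthCat"
      "src OrthCat G = tgt OrthCat F" "src OrthCat H = tgt OrthCat G"
    then show "cmp OrthCat (cmp OrthCat H G) F = cmp OrthCat H (cmp OrthCat G F)"
      using functor_comp_assoc[of "ufun F" "ufun G" "ufun H"] orth[of F] orth[of G] orth[of H]
      by (simp add: OrthCat_def)
  qed (auto simp: OrthCat_def orth intro: orth_functor_comp orth_functor_id)
qed

lemma Forget_functor:
  "is_functor (Forget :: (('o, 'm) orth_category, ('o, 'm) orth_functor,
    ('o, 'm) category, ('o, 'm, 'o, 'm) functr) functr)"
proof -
  have orth: "is_functor (ufun F)" "fdom (ufun F) = ucat (odom F)" "fcod (ufun F) = ucat (ocod F)"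
    "orth_category (odom F)" "orth_category (ocod F)"
    if "is_orth_functor F" for F :: "('o, 'm) orth_functor"
    using that by (auto simp: is_orth_functor_def is_orth_functor_axioms_def)
  show ?thesis
    \<comment> \<open>The first pass keeps \<open>Cat\<close> and \<open>OrthCat\<close> folded, so
      that the facts that they are categories apply; the second unfolds them for the functor
      laws.\<close>
    by (intro is_functor.intro is_functor_axioms.intro)
      (auto simp: Forget_def category_Cat category_OrthCat,
        auto simp: Cat_def OrthCat_def orth orth_functor_id orth_functor_comp dest: orth_category.axioms(1))
qed

section \<open>The two operad functors and the natural projection\<close>

definition cat_operad_functor ::
  "(('o, 'm) category, ('o, 'm, 'o, 'm) functr,
    ('o, 'm operation) operad, ('o, 'm operation, 'o, 'm operation) operad_hom) functr" where
  "cat_operad_functor = \<lparr>fdom = Cat, fcod = Opd,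
     fobj = restrict cat_operad (Obj Cat), farr = restrict cat_operad_map (Arr Cat)\<rparr>"

definition orth_operad_functor ::
  "(('o, 'm) orth_category, ('o, 'm) orth_functor,
    ('o, 'm operation) operad, ('o, 'm operation, 'o, 'm operation) operad_hom) functr" where
  "orth_operad_functor = \<lparr>fdom = OrthCat, fcod = Opd,
     fobj = restrict orth_operad (Obj OrthCat), farr = restrict orth_operad_map (Arr OrthCat)\<rparr>"

lemma cat_operad_map_id:
  assumes "category C"
  shows "cat_operad_map (functor_id C) = hom_id (cat_operad C)"
proof (rule operad_hom_eqI)
  show "operad_hom (cat_operad_map (functor_id C))"
    by (rule is_functor.cat_operad_map_hom[OF functor_id_functor[OF assms]])
  show "operad_hom (hom_id (cat_operad C))"
    by (rule hom_id_hom[OF operad_cat_operad[OF assms]])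
next
  fix t cs x assume x: "is_op (hdom (cat_operad_map (functor_id C))) t cs x"
  then obtain w where w: "x = Word w" "w \<in> words C t cs"
    by (auto simp: is_op_cat_operad cat_operad_map_simps functor_id_simps)
  have "map (farr (functor_id C)) (snd w) = snd w"
    using w(2) by (intro map_idI) (auto simp: words_iff in_set_conv_nth functor_id_simps)
  then show "omap (cat_operad_map (functor_id C)) t cs x = omap (hom_id (cat_operad C)) t cs x"
    using x by (simp add: w cat_operad_map_simps functor_id_simps hom_id_simps word_map_def)
qed (simp_all add: cat_operad_map_simps functor_id_simps hom_id_simps)

lemma word_map_comp:
  assumes "w \<in> words (fdom F) t cs"
  shows "word_map (farr (functor_comp G F)) w = word_map (farr G) (word_map (farr F) w)"
  using assms by (auto simp: word_map_def words_iff in_set_conv_nth functor_comp_simps)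

lemma cat_operad_map_comp:
  assumes "is_functor F" "is_functor G" "fdom G = fcod F"
  shows "cat_operad_map (functor_comp G F) = hom_comp (cat_operad_map G) (cat_operad_map F)"
proof (rule operad_hom_eqI)
  interpret F: is_functor F by fact
  interpret G: is_functor G by fact
  show "operad_hom (cat_operad_map (functor_comp G F))"
    by (rule is_functor.cat_operad_map_hom[OF functor_comp_functor[OF assms]])
  show "operad_hom (hom_comp (cat_operad_map G) (cat_operad_map F))"
    using F.cat_operad_map_hom G.cat_operad_map_hom operad_cat_operad[OF F.dom.category_axioms] assms(3)
    by (intro hom_comp_hom) (simp_all add: cat_operad_map_simps)
  fix t cs x assume "is_op (hdom (cat_operad_map (functor_comp G F))) t cs x"
  then have x: "is_op (cat_operad (fdom F)) t cs x" by (simp add: cat_operad_map_simps functor_comp_simps)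
  then obtain w where w: "x = Word w" "w \<in> words (fdom F) t cs" by (auto simp: is_op_cat_operad)
  \<comment> \<open>In the composite, the outer morphism is evaluated at the image word; its formula
    applies once that word is known to be an operation over \<open>fcod F\<close>.\<close>
  have "is_op (cat_operad (fcod F)) (fobj F t) (map (fobj F) cs) (Word (word_map (farr F) w))"
    using F.cat_operad_map_hom x operad_hom.omap_op[of "cat_operad_map F" t cs x]
    by (simp add: cat_operad_map_simps w)
  then show "omap (cat_operad_map (functor_comp G F)) t cs x =
      omap (hom_comp (cat_operad_map G) (cat_operad_map F)) t cs x"
    using x w assms(3) word_map_comp[OF w(2), of G]
    by (simp add: cat_operad_map_simps functor_comp_simps hom_comp_simps)
qed (simp_all add: cat_operad_map_simps functor_comp_simps hom_comp_simps)

lemma cat_operad_functor: "is_functor (cat_operad_functor :: (('o, 'm) category, ('o, 'm, 'o, 'm) functr,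
    ('o, 'm operation) operad, ('o, 'm operation, 'o, 'm operation) operad_hom) functr)"
proof -
  have cat: "category (fdom F)" "category (fcod F)" "operad (cat_operad (fdom F))"
    "operad (cat_operad (fcod F))" if "is_functor F" for F :: "('o, 'm, 'o, 'm) functr"
    using that operad_cat_operad by (auto simp: is_functor_def)
  show ?thesis
    by (intro is_functor.intro is_functor_axioms.intro)
      (auto simp: cat_operad_functor_def category_Cat category_Opd,
        auto simp: Cat_def Opd_def operad_cat_operad cat_operad_map_simps is_functor.cat_operad_map_hom
          cat cat_operad_map_id cat_operad_map_comp functor_id_functor functor_comp_functor)
qed

lemma orth_operad_map_id:
  fixes Cb :: "('o, 'm) orth_category"
  assumes Cb: "orth_category Cb"
  defines "F \<equiv> \<lparr>odom = Cb, ocod = Cb, ufun = functor_id (ucat Cb)\<rparr>"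
  shows "orth_operad_map F = hom_id (orth_operad Cb)"
proof (rule operad_hom_eqI)
  interpret F: is_orth_functor F unfolding F_def by (rule orth_functor_id[OF Cb])
  have simps: "odom F = Cb" "ocod F = Cb" "ufun F = functor_id (ucat Cb)" by (simp_all add: F_def)
  show "operad_hom (orth_operad_map F)" by (rule F.orth_operad_map_hom)
  show "operad_hom (hom_id (orth_operad Cb))" by (rule hom_id_hom[OF operad_orth_operad[OF Cb]])
  show "hdom (orth_operad_map F) = hdom (hom_id (orth_operad Cb))"
    "hcod (orth_operad_map F) = hcod (hom_id (orth_operad Cb))"
    by (simp_all add: F.orth_operad_map_simps simps hom_id_simps)
  show "cmap (orth_operad_map F) c = cmap (hom_id (orth_operad Cb)) c"
    if "c \<in> colors (hdom (orth_operad_map F))" for c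
    using that by (simp add: F.orth_operad_map_simps simps hom_id_simps functor_id_simps orth_operad_def)
  fix t cs y assume "is_op (hdom (orth_operad_map F)) t cs y"
  then have y: "is_op (orth_operad Cb) t cs y" by (simp add: F.orth_operad_map_simps simps)
  then obtain w where w: "y = orth_class Cb w" "w \<in> words (ucat Cb) t cs"
    and op: "is_op (cat_operad (ucat Cb)) t cs (Word w)"
    by (auto simp: is_op_orth_operad is_op_cat_operad)
  have "map (farr (functor_id (ucat Cb))) (snd w) = snd w"
    using w(2) by (intro map_idI) (auto simp: words_iff in_set_conv_nth functor_id_simps)
  then show "omap (orth_operad_map F) t cs y = omap (hom_id (orth_operad Cb)) t cs y"
    using y op F.orth_operad_map_simps(4)[of t cs w]
    by (simp add: w simps hom_id_simps word_map_def)
qed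

lemma orth_operad_map_comp:
  fixes F G :: "('o, 'm) orth_functor"
  assumes F: "is_orth_functor F" and G: "is_orth_functor G" and dom: "odom G = ocod F"
  defines "H \<equiv> \<lparr>odom = odom F, ocod = ocod G, ufun = functor_comp (ufun G) (ufun F)\<rparr>"
  shows "orth_operad_map H = hom_comp (orth_operad_map G) (orth_operad_map F)"
proof (rule operad_hom_eqI)
  interpret F: is_orth_functor F by fact
  interpret G: is_orth_functor G by fact
  interpret H: is_orth_functor H unfolding H_def by (rule orth_functor_comp[OF F G dom])
  have simps: "odom H = odom F" "ocod H = ocod G" "ufun H = functor_comp (ufun G) (ufun F)"
    by (simp_all add: H_def)
  have colors: "colors (orth_operad (odom F)) = Obj (fdom (ufun F))"
    by (simp add: orth_operad_def F.fdom_ufun)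
  show "operad_hom (orth_operad_map H)" by (rule H.orth_operad_map_hom)
  show "operad_hom (hom_comp (orth_operad_map G) (orth_operad_map F))"
    using F.orth_operad_map_hom G.orth_operad_map_hom operad_orth_operad[OF F.odom.orth_category_axioms] dom
    by (intro hom_comp_hom) (simp_all add: F.orth_operad_map_simps G.orth_operad_map_simps)
  show "hdom (orth_operad_map H) = hdom (hom_comp (orth_operad_map G) (orth_operad_map F))"
    "hcod (orth_operad_map H) = hcod (hom_comp (orth_operad_map G) (orth_operad_map F))"
    by (simp_all add: F.orth_operad_map_simps G.orth_operad_map_simps H.orth_operad_map_simps simps
        hom_comp_simps)
  show "cmap (orth_operad_map H) c = cmap (hom_comp (orth_operad_map G) (orth_operad_map F)) c"
    if "c \<in> colors (hdom (orth_operad_map H))" for c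
    using that by (simp add: F.orth_operad_map_simps G.orth_operad_map_simps H.orth_operad_map_simps simps
        hom_comp_simps functor_comp_simps colors)
  fix t cs y assume "is_op (hdom (orth_operad_map H)) t cs y"
  then have y: "is_op (orth_operad (odom F)) t cs y" by (simp add: H.orth_operad_map_simps simps)
  then obtain w where w: "y = orth_class (odom F) w" "w \<in> words (ucat (odom F)) t cs"
    and op: "is_op (cat_operad (ucat (odom F))) t cs (Word w)"
    by (auto simp: is_op_orth_operad is_op_cat_operad)
  \<comment> \<open>The image of the representative is an operation over the domain of
    \<open>G\<close>, so the second morphism can be evaluated on its class.\<close>
  have op': "is_op (cat_operad (ucat (odom G))) (fobj (ufun F) t) (map (fobj (ufun F)) cs)
      (Word (word_map (farr (ufun F)) w))"
    using F.is_op_word_map[OF op] by (simp add: dom)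
  have "omap (orth_operad_map H) t cs y =
      orth_class (ocod G) (word_map (farr (ufun G)) (word_map (farr (ufun F)) w))"
    using H.orth_operad_map_simps(4)[of t cs w] op w word_map_comp[of w "ufun F" t cs "ufun G"]
    by (simp add: simps F.fdom_ufun)
  also have "\<dots> = omap (hom_comp (orth_operad_map G) (orth_operad_map F)) t cs y"
    using y op w F.orth_operad_map_simps(4)[OF op] G.orth_operad_map_simps(4)[OF op']
    by (simp add: hom_comp_simps F.orth_operad_map_simps(1-3) dom)
  finally show "omap (orth_operad_map H) t cs y =
      omap (hom_comp (orth_operad_map G) (orth_operad_map F)) t cs y" .
qed

lemma orth_operad_functor: "is_functor (orth_operad_functor :: (('o, 'm) orth_category, ('o, 'm) orth_functor,
    ('o, 'm operation) operad, ('o, 'm operation, 'o, 'm operation) operad_hom) functr)"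
proof -
  have orth: "orth_category (odom F)" "orth_category (ocod F)" "operad (orth_operad (odom F))"
    "operad (orth_operad (ocod F))" if "is_orth_functor F" for F :: "('o, 'm) orth_functor"
    using that operad_orth_operad by (auto simp: is_orth_functor_def)
  show ?thesis
    by (intro is_functor.intro is_functor_axioms.intro)
      (auto simp: orth_operad_functor_def category_OrthCat category_Opd,
        auto simp: OrthCat_def Opd_def operad_orth_operad is_orth_functor.orth_operad_map_simps
          is_orth_functor.orth_operad_map_hom orth orth_operad_map_id orth_operad_map_comp
          orth_functor_id orth_functor_comp)
qed

lemma orth_proj_natural_transformation:
  "natural_transformation (functor_comp cat_operad_functor Forget) orth_operad_functor
    (orth_proj :: ('o, 'm) orth_category \<Rightarrow> _)"
proof (intro natural_transformation.intro natural_transformation_axioms.intro)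
  let ?F = "functor_comp cat_operad_functor Forget :: (('o, 'm) orth_category, ('o, 'm) orth_functor,
    ('o, 'm operation) operad, ('o, 'm operation, 'o, 'm operation) operad_hom) functr"
  have cod: "fcod ?F = Opd" and dom: "fdom ?F = OrthCat"
    by (simp_all add: functor_comp_def cat_operad_functor_def Forget_def)
  show "is_functor ?F"
    by (rule functor_comp_functor[OF Forget_functor cat_operad_functor])
      (simp add: cat_operad_functor_def Forget_def)
  \<comment> \<open>The restrictions in the two functors evaluate because the underlying category of
    an orthogonal category is an object of \<open>Cat\<close>.\<close>
  have obj: "fobj ?F Cb = cat_operad (ucat Cb)" if "Cb \<in> Obj OrthCat" for Cb
    using that by (auto simp: functor_comp_def compose_def cat_operad_functor_def Forget_def
        Cat_def OrthCat_def dest: orth_category.axioms(1))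
  have arr: "farr ?F F = cat_operad_map (ufun F)" if "F \<in> Arr OrthCat" for F
    using that by (auto simp: functor_comp_def compose_def cat_operad_functor_def Forget_def
        Cat_def OrthCat_def is_orth_functor_def)
  show "orth_proj Cb \<in> Arr (fcod ?F)" "src (fcod ?F) (orth_proj Cb) = fobj ?F Cb"
    "tgt (fcod ?F) (orth_proj Cb) = fobj orth_operad_functor Cb"
    if "Cb \<in> Obj (fdom ?F)" for Cb :: "('o, 'm) orth_category"
  proof -
    have "Cb \<in> Obj OrthCat" using that by (simp only: dom)
    then show "orth_proj Cb \<in> Arr (fcod ?F)" "src (fcod ?F) (orth_proj Cb) = fobj ?F Cb"
      "tgt (fcod ?F) (orth_proj Cb) = fobj orth_operad_functor Cb"
      unfolding cod
      by (auto simp: obj OrthCat_def Opd_def orth_proj_simps orth_proj_hom operad_orth_operad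
          orth_operad_functor_def intro: operad_cat_operad orth_category.axioms(1))
  qed
  show "cmp (fcod ?F) (orth_proj (tgt (fdom ?F) F)) (farr ?F F) =
      cmp (fcod ?F) (farr orth_operad_functor F) (orth_proj (src (fdom ?F) F))"
    if "F \<in> Arr (fdom ?F)" for F :: "('o, 'm) orth_functor"
  proof -
    have F: "F \<in> Arr OrthCat" using that by (simp only: dom)
    then have "is_orth_functor F" by (simp add: OrthCat_def)
    then show ?thesis
      using F is_orth_functor.orth_proj_natural[of F] unfolding cod dom
      by (simp add: arr orth_operad_functor_def) (simp add: OrthCat_def Opd_def)
  qed
qed (simp_all add: orth_operad_functor functor_comp_simps, simp_all add: orth_operad_functor_def Forget_def cat_operad_functor_def)

theorem proposition3p11:
  shows "\<exists>(G :: (('o, 'm) category, ('o, 'm, 'o, 'm) functr,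
               ('o, 'm operation) operad, ('o, 'm operation, 'o, 'm operation) operad_hom) functr)
          (Gb :: (('o, 'm) orth_category, ('o, 'm) orth_functor,
               ('o, 'm operation) operad, ('o, 'm operation, 'o, 'm operation) operad_hom) functr).
    is_functor G \<and> fdom G = Cat \<and> fcod G = Opd \<and>
    (\<forall>C \<in> Obj Cat. fobj G C = cat_operad C) \<and>
    (\<forall>F \<in> Arr Cat.
      (\<forall>c \<in> Obj (fdom F). cmap (farr G F) c = fobj F c) \<and>
      (\<forall>t \<in> Obj (fdom F). \<forall>cs. set cs \<subseteq> Obj (fdom F) \<longrightarrow>
        (\<forall>(\<sigma>, fs) \<in> words (fdom F) t cs.
          omap (farr G F) t cs (Word (\<sigma>, fs)) = Word (\<sigma>, map (farr F) fs)))) \<and>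
    is_functor Gb \<and> fdom Gb = OrthCat \<and> fcod Gb = Opd \<and>
    (\<forall>Cb \<in> Obj OrthCat. fobj Gb Cb = orth_operad Cb) \<and>
    (\<forall>F \<in> Arr OrthCat.
      (\<forall>c \<in> Obj (ucat (odom F)). cmap (farr Gb F) c = fobj (ufun F) c) \<and>
      (\<forall>t \<in> Obj (ucat (odom F)). \<forall>cs. set cs \<subseteq> Obj (ucat (odom F)) \<longrightarrow>
        (\<forall>(\<sigma>, fs) \<in> words (ucat (odom F)) t cs.
          omap (farr Gb F) t cs (orth_class (odom F) (\<sigma>, fs)) =
            orth_class (ocod F) (\<sigma>, map (farr (ufun F)) fs)))) \<and>
    natural_transformation (functor_comp G Forget) Gb orth_proj"
proof (intro exI conjI ballI allI impI; (clarify)?)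
  \<comment> \<open>The existential introduction leaves both functors schematic; the statements
    shown here instantiate them.\<close>
  show "is_functor cat_operad_functor" by (rule cat_operad_functor)
  show "is_functor orth_operad_functor" by (rule orth_operad_functor)
  show "natural_transformation (functor_comp cat_operad_functor Forget) orth_operad_functor orth_proj"
    by (rule orth_proj_natural_transformation)
next
  fix F :: "('o, 'm, 'o, 'm) functr" and t cs \<sigma> fs
  assume "F \<in> Arr Cat" "t \<in> Obj (fdom F)" "set cs \<subseteq> Obj (fdom F)" "(\<sigma>, fs) \<in> words (fdom F) t cs"
  then show "omap (farr cat_operad_functor F) t cs (Word (\<sigma>, fs)) = Word (\<sigma>, map (farr F) fs)"
    using cat_operad_map_simps(4)[of F t cs "(\<sigma>, fs)"]
    by (simp add: cat_operad_functor_def is_op_cat_operad word_map_def)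
next
  fix F :: "('o, 'm) orth_functor" and t cs \<sigma> fs
  assume F: "F \<in> Arr OrthCat" and w: "t \<in> Obj (ucat (odom F))" "set cs \<subseteq> Obj (ucat (odom F))"
    "(\<sigma>, fs) \<in> words (ucat (odom F)) t cs"
  then have "is_orth_functor F" by (simp add: OrthCat_def)
  then show "omap (farr orth_operad_functor F) t cs (orth_class (odom F) (\<sigma>, fs)) =
      orth_class (ocod F) (\<sigma>, map (farr (ufun F)) fs)"
    using F w is_orth_functor.orth_operad_map_simps(4)[of F t cs "(\<sigma>, fs)"]
    by (simp add: orth_operad_functor_def is_op_cat_operad word_map_def)
qed (simp_all add: cat_operad_functor_def orth_operad_functor_def cat_operad_map_def orth_operad_map_def)

end
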